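(* Let $d\ge2$ and let $u$ be a polyharmonic function of order $N\ge1$ in the unit ball $B\subset\mathbb{R}^d$, i.e. $\Delta^Nu(x)=0$ in $B$. Then the $r$-complexification of $u$ satisfies $u\in H^2(\mathcal{B})$ if and only if $$\Delta^ju_{|\partial B}\in H^{-j}(\mathbb{S}^{d-1})\qquad\text{for }j=0,1,\dots,N-1,$$ where $H^s(\mathbb{S}^{d-1})$ denotes the Sobolev space of exponent $s$.
   Context: $B=\{x\in\mathbb{R}^d:|x|<1\}$, $\mathbb{D}=\{z\in\mathbb{C}:|z|<1\}$; $\mathbb{S}^{d-1}=\partial B$ carries the rotation-invariant measure $d\theta$. $\mathcal{H}_k(\mathbb{R}^d)$ is the space of harmonic homogeneous polynomials of degree $k$, $a_k=\dim\mathcal{H}_k(\mathbb{R}^d)$, and $Y_{k,\ell}$ ($\ell=1,\dots,a_k$) is a fixed real-valued basis of $\mathcal{H}_k(\mathbb{R}^d)$ orthonormal for $\int_{\mathbb{S}^{d-1}}f\overline g\,d\theta$. By Almansi's theorem, a polyharmonic function $u$ of order $N$ in $B$ has an expansion, uniformly convergent on compact subsets of $B$, $u(r\theta)=\sum_{k=0}^\infty\sum_{\ell=1}^{a_k}\sum_{j=0}^{N-1}u_{k,\ell;j}r^{k+2j}Y_{k,\ell}(\theta)$. Its $r$-complexification is the (formal) series $u(z,\theta)=\sum_{k,\ell}\sum_{j=0}^{N-1}u_{k,\ell;j}z^{k+2j}Y_{k,\ell}(\theta)$. $\mathcal{B}=\mathbb{D}\times\mathbb{S}^{d-1}/\mathbb{Z}_2$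 (with $(z,\theta)$ and $(-z,-\theta)$ identified) is the unit ball of the Klein-Dirac quadric. The polyharmonic Hardy space $H^2(\mathcal{B})$ consists of the functions $f(z,\theta)=\sum_{k=0}^{\infty}\sum_{\ell=1}^{a_k}\sum_{j=0}^{\infty}f_{k,\ell;j}z^{k+2j}Y_{k,\ell}(\theta)$ with $\sum_{k,\ell,j}|f_{k,\ell;j}|^2<\infty$. The boundary value $\Delta^ju_{|\partial B}$ is understood through its Laplace-Fourier series $\sum_{k,\ell}g^j_{k,\ell}Y_{k,\ell}(\theta)$, where $g^j_{k,\ell}=\lim_{r\to1^-}\int_{\mathbb{S}^{d-1}}(\Delta^ju)(r\theta)Y_{k,\ell}(\theta)\,d\theta$ (the limit exists, the integral being a polynomial in $r$). A series $\sum_{k,\ell}g_{k,\ell}Y_{k,\ell}$ belongs to $H^s(\mathbb{S}^{d-1})$ iff $\sum_{k,\ell}(1+k)^{2s}|g_{k,\ell}|^2<\infty$. *)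

theory Defs
  imports "HOL-Analysis.Analysis" "HOL-Library.Function_Algebras"
begin

section \<open>Polyharmonic functions\<close>

definition partial_deriv ::
  "'a::euclidean_space \<Rightarrow> ('a \<Rightarrow> 'b::real_normed_vector) \<Rightarrow> 'a \<Rightarrow> 'b" where
  "partial_deriv b f x = vector_derivative (\<lambda>t. f (x + t *\<^sub>R b)) (at 0)"

definition laplacian ::
  "('a::euclidean_space \<Rightarrow> 'b::real_normed_vector) \<Rightarrow> 'a \<Rightarrow> 'b" where
  "laplacian f x = (\<Sum>b\<in>Basis. partial_deriv b (partial_deriv b f) x)"

text \<open>\<open>Ck_on n S f\<close>: \<open>f\<close> is \<open>n\<close> times continuously differentiable on the open set \<open>S\<close>.\<close>

primrec Ck_on ::
  "nat \<Rightarrow> 'a::euclidean_space set \<Rightarrow> ('a \<Rightarrow> 'b::real_normed_vector) \<Rightarrow> bool" where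
  "Ck_on 0 S f \<longleftrightarrow> continuous_on S f"
| "Ck_on (Suc n) S f \<longleftrightarrow>
     (\<forall>x\<in>S. f differentiable at x) \<and> (\<forall>b\<in>Basis. Ck_on n S (partial_deriv b f))"

definition polyharmonic_on ::
  "nat \<Rightarrow> 'a::euclidean_space set \<Rightarrow> ('a \<Rightarrow> 'b::real_normed_vector) \<Rightarrow> bool" where
  "polyharmonic_on N S u \<longleftrightarrow> Ck_on (2 * N) S u \<and> (\<forall>x\<in>S. (laplacian ^^ N) u x = 0)"

section \<open>The surface measure of the unit sphere\<close>

text \<open>
  The measure of \<open>A\<close> is \<open>d\<close> times the volume of the cone \<open>{r\<theta> | 0 < r < 1, \<theta> \<in> A}\<close>
  (see \<open>emeasure_sphere_measure\<close>), i.e. the usual surface area measure. Its rotation invariance is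
  \<open>sphere_measure_rotation_invariant\<close> below.
\<close>

definition sphere_measure :: "'a::euclidean_space measure" where
  "sphere_measure = scale_measure (ennreal DIM('a))
     (distr (restrict_space lborel (ball 0 1 - {0})) (restrict_space borel (sphere 0 1)) sgn)"

lemma space_sphere_measure: "space sphere_measure = sphere 0 1"
  by (simp add: sphere_measure_def space_scale_measure space_restrict_space)

lemma sets_sphere_measure: "sets sphere_measure = sets (restrict_space borel (sphere 0 1))"
  by (simp add: sphere_measure_def)

lemma measurable_sgn_sphere:
  "sgn \<in> measurable (restrict_space lborel (ball 0 1 - {0::'a::euclidean_space}))
     (restrict_space borel (sphere 0 1))"
proof (rule measurable_restrict_space2)
  show "sgn \<in> space (restrict_space lborel (ball 0 1 - {0::'a})) \<rightarrow> sphere 0 1"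
    by (auto simp: space_restrict_space norm_sgn)
  have "sgn \<in> borel_measurable (borel :: 'a measure)"
    unfolding sgn_div_norm [abs_def] by measurable
  then show "sgn \<in> borel_measurable (restrict_space lborel (ball 0 1 - {0::'a}))"
    by (intro measurable_restrict_space1) simp
qed

lemma sphere_cone_eq:
  fixes A :: "'a::euclidean_space set"
  assumes "A \<subseteq> sphere 0 1"
  shows "{r *\<^sub>R \<theta> | r \<theta>. 0 < r \<and> r < 1 \<and> \<theta> \<in> A} = sgn -` A \<inter> (ball 0 1 - {0})"
    (is "?R = ?L")
proof (intro equalityI subsetI)
  fix x assume x: "x \<in> ?L"
  then have "x = norm x *\<^sub>R sgn x" by (simp add: sgn_div_norm)
  moreover have "0 < norm x" "norm x < 1" "sgn x \<in> A" using x by auto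
  ultimately show "x \<in> ?R" by blast
next
  fix x assume "x \<in> ?R"
  then obtain r \<theta> where r: "x = r *\<^sub>R \<theta>" "0 < r" "r < 1" "\<theta> \<in> A" by auto
  moreover have "norm \<theta> = 1" using r assms by auto
  ultimately show "x \<in> ?L" by (auto simp: sgn_div_norm)
qed

lemma emeasure_sphere_measure:
  fixes A :: "'a::euclidean_space set"
  assumes "A \<in> sets borel" "A \<subseteq> sphere 0 1"
  shows "emeasure sphere_measure A =
    ennreal DIM('a) * emeasure lborel {r *\<^sub>R \<theta> | r \<theta>. 0 < r \<and> r < 1 \<and> \<theta> \<in> A}"
proof -
  have A: "A \<in> sets (restrict_space borel (sphere 0 1))"
    using assms by (auto simp: sets_restrict_space_iff)
  show ?thesis
    unfolding sphere_measure_def emeasure_scale_measure sphere_cone_eq [OF assms(2)]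
    by (subst emeasure_distr [OF measurable_sgn_sphere A])
       (simp add: emeasure_restrict_space space_restrict_space)
qed

lemma lborel_distr_orthogonal:
  fixes T :: "'a::euclidean_space \<Rightarrow> 'a"
  assumes T: "orthogonal_transformation T"
  shows "distr lborel borel T = lborel"
proof -
  let ?M = "distr lborel borel T"
  obtain T' where T': "orthogonal_transformation T'" "\<And>x. T' (T x) = x" "\<And>x. T (T' x) = x"
  proof
    show "orthogonal_transformation (inv T)" using T by (rule orthogonal_transformation_inv)
    have "bij T" using T by (rule orthogonal_transformation_bij)
    then show "inv T (T x) = x" "T (inv T x) = x" for x
      by (simp_all add: bij_is_inj bij_is_surj surj_f_inv_f)
  qed
  have lin: "linear T'" using T'(1) by (rule orthogonal_transformation_linear)
  have "continuous_on UNIV T"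
    using T by (simp add: linear_continuous_on linear_linear orthogonal_transformation_linear)
  then have meas: "T \<in> borel_measurable lborel"
    by (simp add: borel_measurable_continuous_onI)
  have ball: "emeasure ?M (ball x r) = emeasure lborel (ball x r)" for x r
  proof -
    have iso: "dist x (T y) = dist (T' x) y" for y
      using T'(1) T'(2) [of y] by (metis orthogonal_transformation_isometry)
    have "T -` ball x r = ball (T' x) r"
      by (auto simp: iso)
    then have "emeasure ?M (ball x r) = emeasure lborel (ball (T' x) r)"
      by (subst emeasure_distr [OF meas]) auto
    then show ?thesis
      by (cases "r > 0") (simp_all add: emeasure_ball ball_empty)
  qed
  have null: "N \<in> null_sets ?M" if N: "N \<in> null_sets lborel" for N
  proof -
    have Nb: "N \<in> sets borel" and "negligible N"
      using N by (auto simp: negligible_iff_null_sets null_sets_completionI)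
    then have "negligible (T' ` N)"
      using lin by (intro negligible_differentiable_image_negligible)
        (auto intro: linear_imp_differentiable_on)
    moreover have "T' ` N = T -` N"
      by (auto simp: T'(3) image_iff) (metis T'(2))
    moreover have "T -` N \<in> sets borel"
      using measurable_sets [OF meas, of N] Nb by simp
    ultimately have "T -` N \<in> null_sets lborel"
      by (simp add: negligible_iff_null_sets null_sets_completion_iff)
    then show ?thesis
      using Nb by (auto simp: null_sets_def emeasure_distr [OF meas])
  qed
  have op: "emeasure ?M S = emeasure lborel S" if S: "open S" for S
  proof -
    obtain C where C: "countable C" "C \<subseteq> {(x, r). ball x r \<subseteq> S}"
        "pairwise (\<lambda>i j. disjnt (ball (fst i) (snd i)) (ball (fst j) (snd j))) C"
        "negligible (S - (\<Union>i\<in>C. ball (fst i) (snd i)))"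
    proof (rule Vitali_covering_theorem_balls [of S "{(x, r). ball x r \<subseteq> S}" fst snd])
      fix x d assume x: "x \<in> S" "0 < (d::real)"
      then obtain e where "e > 0" "ball x e \<subseteq> S" using S open_contains_ball by blast
      then have "(x, min e (d / 2)) \<in> {(x, r). ball x r \<subseteq> S}" by auto
      then show "\<exists>i. i \<in> {(x, r). ball x r \<subseteq> S} \<and> x \<in> ball (fst i) (snd i) \<and> snd i < d"
        using x \<open>e > 0\<close> by (intro exI [of _ "(x, min e (d / 2))"]) auto
    qed
    let ?B = "\<lambda>i. ball (fst i) (snd i) :: 'a set" and ?U = "\<Union>i\<in>C. ball (fst i) (snd i)"
    have "?B i \<subseteq> S" if "i \<in> C" for i
      using subsetD [OF C(2) that] by (simp add: case_prod_beta)
    then have U: "?U \<subseteq> S" by (rule UN_least)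
    have Ub: "?U \<in> sets borel" by (intro borel_open) auto
    have N: "S - ?U \<in> null_sets lborel"
      using C(4) S Ub by (simp add: negligible_iff_null_sets null_sets_completion_iff)
    have disj: "disjoint_family_on ?B C"
      using C(3) by (auto simp: disjoint_family_on_def pairwise_def disjnt_def)
    have S_eq: "?U \<union> (S - ?U) = S" using U by auto
    have "emeasure P S = (\<integral>\<^sup>+i. emeasure P (?B i) \<partial>count_space C)"
      if P: "sets P = sets borel" "S - ?U \<in> null_sets P" for P :: "'a measure"
    proof -
      have "emeasure P S = emeasure P (?U \<union> (S - ?U))" by (simp only: S_eq)
      also have "\<dots> = emeasure P ?U"
        using Ub P by (intro emeasure_Un_null_set) auto
      also have "\<dots> = (\<integral>\<^sup>+i. emeasure P (?B i) \<partial>count_space C)"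
        using C(1) disj P by (intro emeasure_UN_countable) auto
      finally show ?thesis .
    qed
    from this [of ?M] this [of lborel] show ?thesis
      using N null by (simp add: ball)
  qed
  show ?thesis
  proof (rule lborel_eqI [symmetric])
    fix l u :: 'a assume "\<And>b. b \<in> Basis \<Longrightarrow> l \<bullet> b \<le> u \<bullet> b"
    then show "emeasure ?M (box l u) = (\<Prod>b\<in>Basis. (u - l) \<bullet> b)"
      unfolding op [OF open_box] by (rule emeasure_lborel_box)
  qed simp
qed

lemma sphere_measure_rotation_invariant:
  fixes T :: "'a::euclidean_space \<Rightarrow> 'a"
  assumes T: "orthogonal_transformation T"
  shows "distr sphere_measure sphere_measure T = sphere_measure"
proof (rule measure_eqI)
  fix A assume "A \<in> sets (distr sphere_measure sphere_measure T)"
  then have A: "A \<in> sets borel" "A \<subseteq> sphere 0 1"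
    by (auto simp: sets_sphere_measure sets_restrict_space_iff)
  have scale: "T (r *\<^sub>R x) = r *\<^sub>R T x" and nrm: "norm (T x) = norm x" for r x
    using T by (auto simp: orthogonal_transformation_linear linear_scale
        orthogonal_transformation_norm)
  have "continuous_on UNIV T"
    using T by (simp add: linear_continuous_on linear_linear orthogonal_transformation_linear)
  then have meas: "T \<in> borel_measurable borel"
    by (simp add: borel_measurable_continuous_onI)
  have "T \<in> measurable sphere_measure sphere_measure"
    unfolding measurable_cong_sets [OF sets_sphere_measure sets_sphere_measure]
    using meas by (intro measurable_restrict_space3) (auto simp: nrm)
  then have "emeasure (distr sphere_measure sphere_measure T) A =
      emeasure sphere_measure (T -` A \<inter> sphere 0 1)"
    using \<open>A \<in> sets (distr sphere_measure sphere_measure T)\<close>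
    by (simp add: emeasure_distr space_sphere_measure)
  also have "T -` A \<inter> sphere 0 1 = T -` A"
    using A(2) nrm by force
  also have "emeasure sphere_measure (T -` A) = emeasure sphere_measure A"
  proof -
    have TA: "T -` A \<in> sets borel" "T -` A \<subseteq> sphere 0 1"
      using measurable_sets [OF meas A(1)] A(2) nrm by auto
    have "sgn \<in> borel_measurable (borel :: 'a measure)"
      unfolding sgn_div_norm [abs_def] by measurable
    then have cone: "sgn -` A \<inter> (ball 0 1 - {0}) \<in> sets borel"
      using measurable_sets [of sgn borel borel A] A(1) by simp
    have "T -` (sgn -` A \<inter> (ball 0 1 - {0})) = sgn -` (T -` A) \<inter> (ball 0 1 - {0})"
      using nrm by (auto simp: sgn_div_norm scale) (metis norm_eq_zero)+
    then have "emeasure lborel (sgn -` (T -` A) \<inter> (ball 0 1 - {0})) =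
        emeasure (distr lborel borel T) (sgn -` A \<inter> (ball 0 1 - {0}))"
      using cone meas by (simp add: emeasure_distr)
    then show ?thesis
      by (simp only: emeasure_sphere_measure [OF A] emeasure_sphere_measure [OF TA]
          sphere_cone_eq [OF A(2)] sphere_cone_eq [OF TA(2)] lborel_distr_orthogonal [OF T])
  qed
  finally show "emeasure (distr sphere_measure sphere_measure T) A = emeasure sphere_measure A" .
qed simp

section \<open>Spherical harmonics\<close>

definition cfun_scale :: "complex \<Rightarrow> ('a \<Rightarrow> complex) \<Rightarrow> 'a \<Rightarrow> complex" where
  "cfun_scale c f = (\<lambda>x. c * f x)"

global_interpretation cfun: vector_space cfun_scale
  by standard (auto simp: cfun_scale_def fun_eq_iff algebra_simps)

text \<open>The harmonic homogeneous polynomials of degree \<open>k\<close>, with complex coefficients.\<close>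

definition harmonic_polys :: "nat \<Rightarrow> ('a::euclidean_space \<Rightarrow> complex) set" where
  "harmonic_polys k = {p. polynomial_function p \<and>
     (\<forall>t x. p (t *\<^sub>R x) = of_real t ^ k * p x) \<and> (\<forall>x. laplacian p x = 0)}"

definition harmonic_dim :: "'a::euclidean_space itself \<Rightarrow> nat \<Rightarrow> nat" where
  "harmonic_dim _ k = cfun.dim (harmonic_polys k :: ('a \<Rightarrow> complex) set)"

definition harmonic_index :: "'a::euclidean_space itself \<Rightarrow> (nat \<times> nat) set" where
  "harmonic_index D = (SIGMA k:UNIV. {1..harmonic_dim D k})"

text \<open>
  \<open>Y k l\<close> for \<open>1 \<le> l \<le> harmonic_dim D k\<close> is a real-valued orthonormal basis of \<open>harmonic_polys k\<close>;
  the values of \<open>Y k l\<close> for other \<open>l\<close> are irrelevant.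
\<close>

definition harmonic_basis :: "(nat \<Rightarrow> nat \<Rightarrow> 'a::euclidean_space \<Rightarrow> complex) \<Rightarrow> bool" where
  "harmonic_basis Y \<longleftrightarrow> (\<forall>k. let I = {1..harmonic_dim TYPE('a) k} in
     (\<forall>l\<in>I. \<forall>x. Y k l x \<in> \<real>) \<and>
     inj_on (Y k) I \<and> cfun.independent (Y k ` I) \<and> cfun.span (Y k ` I) = harmonic_polys k \<and>
     (\<forall>l\<in>I. \<forall>m\<in>I. (LINT \<theta>|sphere_measure. Y k l \<theta> * cnj (Y k m \<theta>)) = (if l = m then 1 else 0)))"

section \<open>The \<open>r\<close>-complexification\<close>

text \<open>
  The family \<open>c\<close> of Almansi coefficients, extended by zero outside its index range. For a compact
  \<open>K\<close> in the unit ball the convergence is uniform in all \<open>(r, \<theta>)\<close> with \<open>r\<theta> \<in> K\<close>.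
\<close>

definition almansi_expansion ::
  "nat \<Rightarrow> (nat \<Rightarrow> nat \<Rightarrow> 'a::euclidean_space \<Rightarrow> complex) \<Rightarrow> ('a \<Rightarrow> complex) \<Rightarrow>
   (nat \<Rightarrow> nat \<Rightarrow> nat \<Rightarrow> complex) \<Rightarrow> bool" where
  "almansi_expansion N Y u c \<longleftrightarrow>
     (\<forall>k l j. (k, l) \<notin> harmonic_index TYPE('a) \<or> N \<le> j \<longrightarrow> c k l j = 0) \<and>
     (\<forall>K. compact K \<and> K \<subseteq> ball 0 1 \<longrightarrow>
        uniform_limit {(r, \<theta>). 0 \<le> r \<and> \<theta> \<in> sphere 0 1 \<and> r *\<^sub>R \<theta> \<in> K}
          (\<lambda>n (r, \<theta>). \<Sum>k<n. \<Sum>l=1..harmonic_dim TYPE('a) k. \<Sum>j<N.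
             c k l j * of_real r ^ (k + 2 * j) * Y k l \<theta>)
          (\<lambda>(r, \<theta>). u (r *\<^sub>R \<theta>)) sequentially)"

definition almansi_coeffs ::
  "nat \<Rightarrow> (nat \<Rightarrow> nat \<Rightarrow> 'a::euclidean_space \<Rightarrow> complex) \<Rightarrow> ('a \<Rightarrow> complex) \<Rightarrow>
   nat \<Rightarrow> nat \<Rightarrow> nat \<Rightarrow> complex" where
  "almansi_coeffs N Y u = (THE c. almansi_expansion N Y u c)"

definition r_complexification ::
  "nat \<Rightarrow> (nat \<Rightarrow> nat \<Rightarrow> 'a::euclidean_space \<Rightarrow> complex) \<Rightarrow> ('a \<Rightarrow> complex) \<Rightarrow>
   complex \<times> 'a \<Rightarrow> complex" where
  "r_complexification N Y u = (\<lambda>(z, \<theta>). \<Sum>\<^sub>\<infinity>(k, l)\<in>harmonic_index TYPE('a). \<Sum>j<N.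
     almansi_coeffs N Y u k l j * z ^ (k + 2 * j) * Y k l \<theta>)"

section \<open>The polyharmonic Hardy space\<close>

text \<open>
  Functions on the unit ball of the Klein-Dirac quadric, the quotient of \<open>ball 0 1 \<times> sphere 0 1\<close>
  under \<open>(z, \<theta>) \<sim> (-z, -\<theta>)\<close>, are represented by functions on the product; only their
  values there matter. The invariance \<open>f (-z, -\<theta>) = f (z, \<theta>)\<close> is automatic for the sum of the
  series, since \<open>Y k l (-\<theta>) = (-1) ^ k * Y k l \<theta>\<close>.
\<close>

definition hardy_space ::
  "(nat \<Rightarrow> nat \<Rightarrow> 'a::euclidean_space \<Rightarrow> complex) \<Rightarrow> (complex \<times> 'a \<Rightarrow> complex) set" where
  "hardy_space Y = {f. \<exists>c :: nat \<Rightarrow> nat \<Rightarrow> nat \<Rightarrow> complex.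
     (\<lambda>((k, l), j). (cmod (c k l j))\<^sup>2) summable_on (harmonic_index TYPE('a) \<times> UNIV) \<and>
     (\<forall>z\<in>ball 0 1. \<forall>\<theta>\<in>sphere 0 1.
        ((\<lambda>((k, l), j). c k l j * z ^ (k + 2 * j) * Y k l \<theta>) has_sum f (z, \<theta>))
          (harmonic_index TYPE('a) \<times> UNIV))}"

section \<open>Boundary values and Sobolev spaces on the sphere\<close>

text \<open>Laplace-Fourier coefficients of the boundary value of a function on the unit ball.\<close>

definition boundary_coeffs ::
  "(nat \<Rightarrow> nat \<Rightarrow> 'a::euclidean_space \<Rightarrow> complex) \<Rightarrow> ('a \<Rightarrow> complex) \<Rightarrow> nat \<Rightarrow> nat \<Rightarrow> complex" where
  "boundary_coeffs Y v k l = Lim (at_left 1) (\<lambda>r. LINT \<theta>|sphere_measure. v (r *\<^sub>R \<theta>) * Y k l \<theta>)"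

text \<open>
  \<open>sobolev_sphere D s\<close> is the Sobolev space of exponent \<open>s\<close> on the unit sphere of \<open>D\<close>; its elements,
  the series \<open>\<Sum> g k l * Y k l\<close>, are represented by their coefficient families.
\<close>

definition sobolev_sphere :: "'a::euclidean_space itself \<Rightarrow> real \<Rightarrow> (nat \<Rightarrow> nat \<Rightarrow> complex) set" where
  "sobolev_sphere D s = {g.
     (\<lambda>(k, l). (1 + real k) powr (2 * s) * (cmod (g k l))\<^sup>2) summable_on harmonic_index D}"

end

theory Submission
  imports Defs
begin

text \<open>
  Both sides of the equivalence say that the Almansi coefficients of \<open>u\<close> are square summable.
  For a basis element \<open>Y\<close> of degree \<open>k\<close> the moments \<open>F\<^sub>j(r) = \<integral> (\<Delta>\<^sup>j u)(r\<theta>) Y(\<theta>) d\<theta>\<close>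
  satisfy the Euler equations \<open>F\<^sub>j'' + (d - 1)/r F\<^sub>j' - k(k + d - 2)/r\<^sup>2 F\<^sub>j = F\<^sub>j\<^sub>+\<^sub>1\<close>, because the angular
  part of the Laplacian is a sum of squares of infinitesimal rotations and hence symmetric on the
  sphere. Being bounded at 0, \<open>F\<^sub>j\<close> is a combination of \<open>r\<^sup>k, r\<^sup>k\<^sup>+\<^sup>2, \<dots>\<close>, whose coefficients for
  \<open>j = 0\<close> are the Almansi coefficients. Completeness of the spherical harmonics together with the
  subexponential growth of \<open>Y\<close> and of the dimensions turns this into the Almansi expansion, which
  is unique. Evaluating at \<open>r = 1\<close>, the boundary data are related to the coefficients by a triangular
  system whose \<open>j\<close>-th row has order \<open>(1 + k)\<^sup>j\<close>, uniformly invertible after this scaling.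
\<close>

section \<open>Partial derivatives\<close>

text \<open>No series is differentiated: only the scalar moments are, under the integral sign, and
  the polyharmonic order is peeled off one Laplacian at a time. The regular solution for the
  right-hand side r^(k+2i) is r^(k+2i+2) divided by (2i+2)(2k+d+2i). This denominator is linear in
  k, so a product of j of them, a \<open>laplacian_factor\<close>, has order (1+k)^j: the j-th
  boundary value loses exactly j derivatives.

  Two obstacles shape the rest. \<open>almansi_coeffs\<close> is a definite description, so
  existence and uniqueness of the expansion must be known before it can be used. And
  \<open>hardy_space\<close> supplies just some square summable family, with j unbounded, which has
  to be identified with the Almansi family.

  Subexponential means below every q^k with q > 1. For the harmonics this comes from the mean value
  property on a small ball about a point of the sphere together with homogeneity, for the dimensions
  from the reproducing kernel, and for the Almansi coefficients from the values of the moments at N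
  radii close to 1.\<close>

lemma partial_deriv_eqI:
  assumes "(f has_derivative D) (at x)"
  shows "partial_deriv b f x = D b"
proof -
  have D: "bounded_linear D"
    using assms by (rule has_derivative_bounded_linear)
  have "((\<lambda>t. f (x + t *\<^sub>R b)) has_derivative (\<lambda>t. D (t *\<^sub>R b))) (at 0)"
    by (rule has_derivative_compose [where g = f])
       (use assms in \<open>auto intro!: derivative_eq_intros\<close>)
  then have "((\<lambda>t. f (x + t *\<^sub>R b)) has_vector_derivative D b) (at 0)"
    using D by (simp add: has_vector_derivative_def linear_simps)
  then show ?thesis
    unfolding partial_deriv_def by (rule vector_derivative_at)
qed

lemma has_derivative_partial_deriv:
  fixes f :: "'a::euclidean_space \<Rightarrow> 'b::real_normed_vector"
  assumes "f differentiable at x"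
  shows "(f has_derivative (\<lambda>h. \<Sum>b\<in>Basis. (h \<bullet> b) *\<^sub>R partial_deriv b f x)) (at x)"
proof -
  obtain D where D: "(f has_derivative D) (at x)"
    using assms by (auto simp: differentiable_def)
  have lin: "linear D"
    using D has_derivative_linear by blast
  have "D h = (\<Sum>b\<in>Basis. (h \<bullet> b) *\<^sub>R partial_deriv b f x)" for h
  proof -
    have "D h = D (\<Sum>b\<in>Basis. (h \<bullet> b) *\<^sub>R b)"
      by (simp add: euclidean_representation)
    also have "\<dots> = (\<Sum>b\<in>Basis. (h \<bullet> b) *\<^sub>R D b)"
      using lin by (simp add: linear_sum linear_scale)
    finally show ?thesis
      by (simp add: partial_deriv_eqI [OF D])
  qed
  then show ?thesis
    using D by (metis (no_types, lifting) ext)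
qed

lemma partial_deriv_cong:
  fixes f g :: "'a::euclidean_space \<Rightarrow> 'b::real_normed_vector"
  assumes "open S" "x \<in> S" and eq: "\<And>y. y \<in> S \<Longrightarrow> f y = g y"
  shows "partial_deriv b f x = partial_deriv b g x"
proof -
  have "((\<lambda>t::real. x + t *\<^sub>R b) \<longlongrightarrow> x + 0 *\<^sub>R b) (nhds 0)"
    by (intro tendsto_intros filterlim_ident)
  then have "\<forall>\<^sub>F t in nhds (0::real). x + t *\<^sub>R b \<in> S"
    by (rule topological_tendstoD) (use assms in auto)
  then have "\<forall>\<^sub>F t in nhds (0::real). f (x + t *\<^sub>R b) = g (x + t *\<^sub>R b)"
    by eventually_elim (rule eq)
  then show ?thesis
    unfolding partial_deriv_def by (intro vector_derivative_cong_eq) auto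
qed

text \<open>Product and sum rules are known only at points of \<open>S\<close>; openness allows such
  identities to be differentiated again.\<close>

lemma Ck_on_cong:
  fixes f g :: "'a::euclidean_space \<Rightarrow> 'b::real_normed_vector"
  assumes "open S" "\<And>y. y \<in> S \<Longrightarrow> f y = g y" "Ck_on n S f"
  shows "Ck_on n S g"
  using assms(2,3)
proof (induction n arbitrary: f g)
  case 0
  then show ?case by (auto cong: continuous_on_cong)
next
  case (Suc n)
  have "g differentiable at x" if x: "x \<in> S" for x
  proof -
    obtain D where "(f has_derivative D) (at x)"
      using Suc.prems(2) x by (auto simp: differentiable_def)
    then have "(g has_derivative D) (at x)"
      by (rule has_derivative_transform_within_open [OF _ assms(1) x]) (use Suc.prems in auto)
    then show ?thesis by (auto simp: differentiable_def)
  qed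
  moreover have "Ck_on n S (partial_deriv b g)" if "b \<in> Basis" for b
  proof (rule Suc.IH)
    show "partial_deriv b f y = partial_deriv b g y" if "y \<in> S" for y
      by (rule partial_deriv_cong [OF assms(1) that Suc.prems(1)])
    show "Ck_on n S (partial_deriv b f)"
      using Suc.prems that by auto
  qed
  ultimately show ?case by simp
qed

lemma Ck_on_SucD: "Ck_on (Suc n) S f \<Longrightarrow> Ck_on n S f"
proof (induction n arbitrary: f)
  case 0
  then show ?case
    by (auto intro!: continuous_at_imp_continuous_on differentiable_imp_continuous_within)
next
  case (Suc n)
  then show ?case by simp
qed

lemma Ck_on_mono: "Ck_on m S f \<Longrightarrow> n \<le> m \<Longrightarrow> Ck_on n S f"
  by (induction m) (auto simp: le_Suc_eq simp del: Ck_on.simps dest: Ck_on_SucD)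

lemma partial_deriv_add:
  assumes "f differentiable at x" "g differentiable at x"
  shows "partial_deriv b (\<lambda>x. f x + g x) x = partial_deriv b f x + partial_deriv b g x"
proof -
  obtain D E where "(f has_derivative D) (at x)" "(g has_derivative E) (at x)"
    using assms by (auto simp: differentiable_def)
  then show ?thesis
    using partial_deriv_eqI [OF has_derivative_add] by (metis partial_deriv_eqI)
qed

lemma Ck_on_add:
  fixes f g :: "'a::euclidean_space \<Rightarrow> 'b::real_normed_vector"
  assumes "open S" "Ck_on n S f" "Ck_on n S g"
  shows "Ck_on n S (\<lambda>x. f x + g x)"
  using assms(2,3)
proof (induction n arbitrary: f g)
  case 0
  then show ?case by (auto intro: continuous_intros)
next
  case (Suc n)
  have "Ck_on n S (partial_deriv b (\<lambda>x. f x + g x))" if "b \<in> Basis" for b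
    by (rule Ck_on_cong [OF assms(1), of "\<lambda>x. partial_deriv b f x + partial_deriv b g x"])
       (use Suc that in \<open>auto simp: partial_deriv_add\<close>)
  then show ?case
    using Suc.prems by auto
qed

lemma partial_deriv_const: "partial_deriv b (\<lambda>x. c) = (\<lambda>x. 0)"
  using partial_deriv_eqI [OF has_derivative_const] by blast

lemma Ck_on_const: "Ck_on n S (\<lambda>x. c)"
  by (induction n arbitrary: c) (auto simp: partial_deriv_const)

lemma Ck_on_sum:
  fixes f :: "'i \<Rightarrow> 'a::euclidean_space \<Rightarrow> 'b::real_normed_vector"
  assumes "open S" "\<And>i. i \<in> I \<Longrightarrow> Ck_on n S (f i)"
  shows "Ck_on n S (\<lambda>x. \<Sum>i\<in>I. f i x)"
  using assms(2)
  by (induction I rule: infinite_finite_induct) (auto simp: Ck_on_const Ck_on_add [OF assms(1)])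

lemma Ck_on_laplacian:
  fixes f :: "'a::euclidean_space \<Rightarrow> 'b::real_normed_vector"
  assumes "open S" "Ck_on (Suc (Suc n)) S f"
  shows "Ck_on n S (laplacian f)"
  unfolding laplacian_def [abs_def]
  using assms by (intro Ck_on_sum) auto

text \<open>Moves the mean value property from the origin to an arbitrary centre.\<close>

lemma laplacian_shift: "laplacian (\<lambda>x. f (a + x)) x = laplacian f (a + x)"
  unfolding laplacian_def partial_deriv_def by (simp add: add.assoc)

section \<open>Derivatives of polynomial functions\<close>

lemma real_polynomial_function_partial_deriv:
  fixes f :: "'a::euclidean_space \<Rightarrow> real"
  assumes "real_polynomial_function f"
  shows "real_polynomial_function (partial_deriv b f)"
  using assms
proof induction
  case (linear f)
  then have "partial_deriv b f x = f b" for x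
    by (intro partial_deriv_eqI bounded_linear_imp_has_derivative)
  then have "partial_deriv b f = (\<lambda>x. f b)" by blast
  then show ?case by auto
next
  case (const c)
  then show ?case by (auto simp: partial_deriv_const)
next
  case (add f g)
  have "partial_deriv b (\<lambda>x. f x + g x) = (\<lambda>x. partial_deriv b f x + partial_deriv b g x)"
    using add by (auto simp: fun_eq_iff partial_deriv_add differentiable_at_real_polynomial_function)
  then show ?case using add by auto
next
  case (mult f g)
  have "partial_deriv b (\<lambda>x. f x * g x) x = f x * partial_deriv b g x + partial_deriv b f x * g x" for x
  proof -
    obtain D E where "(f has_derivative D) (at x)" "(g has_derivative E) (at x)"
      using mult by (meson differentiable_at_real_polynomial_function differentiable_def)
    then show ?thesis
      using partial_deriv_eqI [OF has_derivative_mult] by (metis partial_deriv_eqI)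
  qed
  then have "partial_deriv b (\<lambda>x. f x * g x) = (\<lambda>x. f x * partial_deriv b g x + partial_deriv b f x * g x)"
    by blast
  then show ?case using mult by auto
qed

lemma partial_deriv_bounded_linear:
  assumes "bounded_linear L" "f differentiable at x"
  shows "partial_deriv b (\<lambda>x. L (f x)) x = L (partial_deriv b f x)"
proof -
  obtain D where D: "(f has_derivative D) (at x)"
    using assms by (auto simp: differentiable_def)
  show ?thesis
    using partial_deriv_eqI [OF bounded_linear.has_derivative [OF assms(1) D]]
    by (simp add: partial_deriv_eqI [OF D])
qed

lemma polynomial_function_partial_deriv:
  fixes f :: "'a::euclidean_space \<Rightarrow> 'b::euclidean_space"
  assumes "polynomial_function f"
  shows "polynomial_function (partial_deriv b f)"
  unfolding polynomial_function_def
proof (intro allI impI)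
  fix L :: "'b \<Rightarrow> real"
  assume L: "bounded_linear L"
  have "L \<circ> partial_deriv b f = partial_deriv b (\<lambda>x. L (f x))"
    by (simp add: fun_eq_iff partial_deriv_bounded_linear [OF L]
        differentiable_at_polynomial_function [OF assms])
  moreover have "real_polynomial_function (\<lambda>x. L (f x))"
    using assms L by (simp add: polynomial_function_def o_def)
  ultimately show "real_polynomial_function (L \<circ> partial_deriv b f)"
    using real_polynomial_function_partial_deriv by metis
qed

lemma Ck_on_polynomial_function:
  fixes f :: "'a::euclidean_space \<Rightarrow> 'b::euclidean_space"
  shows "polynomial_function f \<Longrightarrow> Ck_on n S f"
  by (induction n arbitrary: f)
     (auto simp: polynomial_function_partial_deriv differentiable_at_polynomial_function
       continuous_on_polymonial_function)

lemma polynomial_function_laplacian: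
  fixes f :: "'a::euclidean_space \<Rightarrow> 'b::euclidean_space"
  shows "polynomial_function f \<Longrightarrow> polynomial_function (laplacian f)"
  unfolding laplacian_def [abs_def]
  by (intro polynomial_function_sum polynomial_function_partial_deriv) auto

lemma laplacian_lincomb:
  fixes f g :: "'a::euclidean_space \<Rightarrow> complex"
  assumes "polynomial_function f" "polynomial_function g"
  shows "laplacian (\<lambda>x. f x + c * g x) = (\<lambda>x. laplacian f x + c * laplacian g x)"
proof -
  have *: "partial_deriv b (\<lambda>x. f x + c * g x) = (\<lambda>x. partial_deriv b f x + c * partial_deriv b g x)"
    if "polynomial_function f" "polynomial_function g" for b and f g :: "'a \<Rightarrow> complex"
  proof
    fix x
    have d: "f differentiable at x" "g differentiable at x"
      using that by (auto intro: differentiable_at_polynomial_function)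
    show "partial_deriv b (\<lambda>x. f x + c * g x) x = partial_deriv b f x + c * partial_deriv b g x"
      using d by (subst partial_deriv_add)
        (auto simp: partial_deriv_bounded_linear [OF bounded_linear_mult_right]
          intro!: derivative_intros)
  qed
  show ?thesis
    unfolding laplacian_def using assms
    by (simp add: * polynomial_function_partial_deriv sum.distrib sum_distrib_left)
qed

section \<open>Integration over the unit sphere\<close>

lemma has_vector_derivative_iff_quotient:
  fixes f :: "real \<Rightarrow> 'b::real_normed_vector"
  shows "(f has_vector_derivative f') (at a) \<longleftrightarrow> ((\<lambda>t. (f t - f a) /\<^sub>R (t - a)) \<longlongrightarrow> f') (at a)"
proof -
  have "norm (f t - f a - (t - a) *\<^sub>R f') / norm (t - a) = norm ((f t - f a) /\<^sub>R (t - a) - f')"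
    if "t \<noteq> a" for t
  proof -
    have "(f t - f a) /\<^sub>R (t - a) - f' = (f t - f a - (t - a) *\<^sub>R f') /\<^sub>R (t - a)"
      using that by (simp add: scaleR_diff_right)
    then show ?thesis
      by (simp add: divide_inverse_commute)
  qed
  then have "((\<lambda>t. norm (f t - f a - (t - a) *\<^sub>R f') / norm (t - a)) \<longlongrightarrow> 0) (at a) \<longleftrightarrow>
      ((\<lambda>t. norm ((f t - f a) /\<^sub>R (t - a) - f')) \<longlongrightarrow> 0) (at a)"
    by (intro Lim_cong_within) auto
  then show ?thesis
    unfolding has_vector_derivative_def has_derivative_iff_norm tendsto_norm_zero_iff LIM_zero_iff
    by (simp add: bounded_linear_scaleR_left)
qed

text \<open>Differentiation under the integral sign. The mean value inequality on the convex set
  \<open>T\<close> bounds the difference quotients by \<open>B\<close>, which is integrable on a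
  finite measure space, so dominated convergence applies along every sequence tending to
  \<open>t0\<close>.\<close>

lemma has_vector_derivative_integral:
  fixes f :: "real \<Rightarrow> 'x \<Rightarrow> 'b::{banach, second_countable_topology}"
  assumes "finite_measure M" "open T" "convex T" "t0 \<in> T"
    and int: "\<And>t. t \<in> T \<Longrightarrow> integrable M (f t)"
    and meas: "f' t0 \<in> borel_measurable M"
    and deriv: "\<And>t x. t \<in> T \<Longrightarrow> x \<in> space M \<Longrightarrow> ((\<lambda>t. f t x) has_vector_derivative f' t x) (at t)"
    and bound: "\<And>t x. t \<in> T \<Longrightarrow> x \<in> space M \<Longrightarrow> norm (f' t x) \<le> B"
  shows "((\<lambda>t. LINT x|M. f t x) has_vector_derivative (LINT x|M. f' t0 x)) (at t0)"
proof -
  interpret finite_measure M by fact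
  define q where "q = (\<lambda>t x. (f t x - f t0 x) /\<^sub>R (t - t0))"
  have qint: "integrable M (q t)" if "t \<in> T" for t
    using int [OF that] int [OF \<open>t0 \<in> T\<close>] unfolding q_def by auto
  have qbound: "norm (q t x) \<le> B" if "t \<in> T" "t \<noteq> t0" "x \<in> space M" for t x
  proof -
    have "norm (f t x - f t0 x) \<le> B * norm (t - t0)"
    proof (rule differentiable_bound [OF \<open>convex T\<close> _ _ \<open>t \<in> T\<close> \<open>t0 \<in> T\<close>])
      fix s assume s: "s \<in> T"
      show "((\<lambda>t. f t x) has_derivative (\<lambda>h. h *\<^sub>R f' s x)) (at s within T)"
        using deriv [OF s that(3)] by (simp add: has_vector_derivative_def has_derivative_at_withinI)
      show "onorm (\<lambda>h. h *\<^sub>R f' s x) \<le> B"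
        using mult_right_mono [OF bound [OF s that(3)] abs_ge_zero]
        by (intro onorm_le) (simp add: mult.commute)
    qed
    then show ?thesis
      using that by (simp add: q_def divide_simps)
  qed
  have "((\<lambda>t. LINT x|M. q t x) \<longlongrightarrow> (LINT x|M. f' t0 x)) (at t0)"
    unfolding tendsto_at_iff_sequentially
  proof (intro allI impI, unfold o_def)
    fix X :: "nat \<Rightarrow> real"
    assume X: "\<forall>i. X i \<in> UNIV - {t0}" "X \<longlonglongrightarrow> t0"
    have "\<forall>\<^sub>F i in sequentially. X i \<in> T"
      using X(2) \<open>open T\<close> \<open>t0 \<in> T\<close> by (auto dest: topological_tendstoD)
    then obtain n where n: "\<And>i. i \<ge> n \<Longrightarrow> X i \<in> T"
      by (auto simp: eventually_sequentially)
    have "(\<lambda>i. LINT x|M. q (X (i + n)) x) \<longlonglongrightarrow> (LINT x|M. f' t0 x)"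
    proof (rule integral_dominated_convergence [where w = "\<lambda>x. B"])
      show "q (X (i + n)) \<in> borel_measurable M" for i
        using qint [of "X (i + n)"] n by auto
      show "AE x in M. (\<lambda>i. q (X (i + n)) x) \<longlonglongrightarrow> f' t0 x"
      proof (rule AE_I2)
        fix x assume x: "x \<in> space M"
        have "((\<lambda>t. q t x) \<longlongrightarrow> f' t0 x) (at t0)"
          using deriv [OF \<open>t0 \<in> T\<close> x]
          by (simp add: q_def has_vector_derivative_iff_quotient)
        then have "(\<lambda>i. q (X i) x) \<longlonglongrightarrow> f' t0 x"
          using X unfolding tendsto_at_iff_sequentially o_def by blast
        then show "(\<lambda>i. q (X (i + n)) x) \<longlonglongrightarrow> f' t0 x"
          by (rule LIMSEQ_ignore_initial_segment)
      qed
      show "AE x in M. norm (q (X (i + n)) x) \<le> B" for i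
        using qbound n X by auto
    qed (use meas in auto)
    then show "(\<lambda>i. LINT x|M. q (X i) x) \<longlonglongrightarrow> (LINT x|M. f' t0 x)"
      by (rule LIMSEQ_offset)
  qed
  moreover have "\<forall>\<^sub>F t in at t0. (LINT x|M. q t x) = ((LINT x|M. f t x) - (LINT x|M. f t0 x)) /\<^sub>R (t - t0)"
    using eventually_at_in_open' [OF \<open>open T\<close> \<open>t0 \<in> T\<close>]
    by eventually_elim (use int \<open>t0 \<in> T\<close> in \<open>simp add: q_def\<close>)
  ultimately have "((\<lambda>t. ((LINT x|M. f t x) - (LINT x|M. f t0 x)) /\<^sub>R (t - t0)) \<longlongrightarrow> (LINT x|M. f' t0 x)) (at t0)"
    by (rule Lim_transform_eventually)
  then show ?thesis
    unfolding has_vector_derivative_iff_quotient .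
qed

lemma finite_measure_sphere_measure: "finite_measure (sphere_measure :: 'a::euclidean_space measure)"
proof
  let ?c = "{r *\<^sub>R \<theta> | r \<theta>. 0 < r \<and> r < 1 \<and> \<theta> \<in> sphere 0 1} :: 'a set"
  have "?c \<subseteq> ball 0 1" by (auto simp: abs_if)
  then have "emeasure lborel ?c \<le> emeasure lborel (ball (0::'a) 1)"
    by (intro emeasure_mono) auto
  also have "\<dots> < \<infinity>"
    using emeasure_lborel_ball_finite by blast
  finally show "emeasure (sphere_measure :: 'a measure) (space sphere_measure) \<noteq> \<infinity>"
    by (simp add: space_sphere_measure emeasure_sphere_measure ennreal_mult_eq_top_iff)
qed

interpretation sphere_measure: finite_measure "sphere_measure :: 'a::euclidean_space measure"
  by (rule finite_measure_sphere_measure)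

abbreviation sphere_integral ::
  "('a::euclidean_space \<Rightarrow> 'b::{banach, second_countable_topology}) \<Rightarrow> 'b" (binder "SINT " 10) where
  "sphere_integral f \<equiv> integral\<^sup>L sphere_measure f"

lemma borel_measurable_sphere_measure:
  fixes f :: "'a::euclidean_space \<Rightarrow> 'b::topological_space"
  assumes "continuous_on (sphere 0 1) f"
  shows "f \<in> borel_measurable sphere_measure"
  unfolding measurable_cong_sets [OF sets_sphere_measure refl]
  by (rule borel_measurable_continuous_on_restrict [OF assms])

lemma integrable_sphere_measure:
  fixes f :: "'a::euclidean_space \<Rightarrow> 'b::{banach, second_countable_topology}"
  assumes "continuous_on (sphere 0 1) f"
  shows "integrable sphere_measure f"
proof -
  have "bounded (f ` sphere 0 1)"
    by (intro compact_imp_bounded compact_continuous_image assms compact_sphere)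
  then obtain B where "\<And>x. x \<in> sphere 0 1 \<Longrightarrow> norm (f x) \<le> B"
    unfolding bounded_iff by blast
  then show ?thesis
    by (intro sphere_measure.integrable_const_bound [where B = B] borel_measurable_sphere_measure assms)
       (auto simp: space_sphere_measure)
qed

lemma nn_integral_sphere_measure:
  fixes f :: "'a::euclidean_space \<Rightarrow> ennreal"
  assumes "f \<in> borel_measurable borel"
  shows "(\<integral>\<^sup>+x. f x \<partial>sphere_measure) =
    DIM('a) * (\<integral>\<^sup>+x. f (sgn x) * indicator (ball 0 1 - {0}) x \<partial>lborel)"
proof -
  have f: "f \<in> borel_measurable (restrict_space borel (sphere 0 1))"
    using assms by (rule measurable_restrict_space1)
  have "(\<integral>\<^sup>+x. f x \<partial>sphere_measure) =
    ennreal DIM('a) * (\<integral>\<^sup>+x. f (sgn x) \<partial>restrict_space lborel (ball 0 1 - {0::'a}))"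
    unfolding sphere_measure_def
    by (subst nn_integral_scale_measure) (auto simp: f nn_integral_distr [OF measurable_sgn_sphere])
  then show ?thesis
    by (simp add: nn_integral_restrict_space ennreal_of_nat_eq_real_of_nat)
qed

lemma sphere_integral_rotation:
  fixes f :: "'a::euclidean_space \<Rightarrow> 'b::{banach, second_countable_topology}" and T :: "'a \<Rightarrow> 'a"
  assumes T: "orthogonal_transformation T" and f: "continuous_on (sphere 0 1) f"
  shows "(LINT x|sphere_measure. f (T x)) = (LINT x|sphere_measure. f x)"
proof -
  have "continuous_on UNIV T"
    using T by (simp add: linear_continuous_on linear_linear orthogonal_transformation_linear)
  then have "T \<in> measurable sphere_measure sphere_measure"
    unfolding measurable_cong_sets [OF sets_sphere_measure sets_sphere_measure]
    using T by (intro measurable_restrict_space3)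
      (auto simp: orthogonal_transformation_norm borel_measurable_continuous_onI)
  then have "(LINT x|distr sphere_measure sphere_measure T. f x) = (LINT x|sphere_measure. f (T x))"
    by (intro integral_distr borel_measurable_sphere_measure f)
  then show ?thesis
    by (simp add: sphere_measure_rotation_invariant [OF T])
qed

text \<open>The cone over a nonempty relatively open part of the sphere contains a nonempty open set
  and cannot be Lebesgue null, so vanishing almost everywhere implies vanishing everywhere for
  continuous functions.\<close>

lemma sphere_integral_nonneg_eq_0D:
  fixes f :: "'a::euclidean_space \<Rightarrow> real"
  assumes f: "continuous_on (sphere 0 1) f" and nonneg: "\<And>x. x \<in> sphere 0 1 \<Longrightarrow> 0 \<le> f x"
    and 0: "(LINT x|sphere_measure. f x) = 0" and z: "z \<in> sphere 0 1"
  shows "f z = 0"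
proof (rule ccontr)
  assume "f z \<noteq> 0"
  have "AE x in sphere_measure. f x = 0"
    using 0 nonneg
    by (subst integral_nonneg_eq_0_iff_AE [OF integrable_sphere_measure [OF f], symmetric])
       (auto simp: space_sphere_measure)
  then obtain N where N: "{x \<in> sphere 0 1. f x \<noteq> 0} \<subseteq> N" "emeasure sphere_measure N = 0" "N \<in> sets sphere_measure"
    by (auto elim: AE_E simp: space_sphere_measure)
  have "continuous_on (ball 0 1 - {0}) (\<lambda>x. f (sgn x))"
    by (rule continuous_on_compose2 [OF f]) (auto intro!: continuous_on_sgn continuous_intros simp: norm_sgn split: if_splits)
  moreover have "open (ball 0 1 - {0::'a})" by auto
  ultimately have op: "open ((ball 0 1 - {0}) \<inter> (\<lambda>x. f (sgn x)) -` (- {0}))"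
    by (intro continuous_open_preimage) auto
  let ?U = "(ball 0 1 - {0}) \<inter> (\<lambda>x. f (sgn x)) -` (- {0})"
  \<comment> \<open>The cone lies inside the open ball; the midpoint of the segment from 0 to
    \<open>z\<close> is a point of it on the ray of \<open>z\<close>.\<close>
  have "(1/2) *\<^sub>R z \<in> ?U"
    using z \<open>f z \<noteq> 0\<close> by (auto simp: sgn_div_norm)
  then have ne: "?U \<noteq> {}" by blast
  have N': "N \<in> sets borel" "N \<subseteq> sphere 0 1"
    using N(3) by (auto simp: sets_sphere_measure sets_restrict_space_iff)
  have "?U \<subseteq> sgn -` N \<inter> (ball 0 1 - {0})"
    using N(1) by (auto simp: norm_sgn subset_iff)
  moreover have "sgn \<in> borel_measurable (borel :: 'a measure)"
    unfolding sgn_div_norm [abs_def] by measurable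
  then have "sgn -` N \<inter> (ball 0 1 - {0}) \<in> sets borel"
    using measurable_sets [of sgn borel borel N] N'(1) by simp
  moreover have "emeasure lborel (sgn -` N \<inter> (ball 0 1 - {0})) = 0"
    using N(2) emeasure_sphere_measure [OF N'] by (simp add: sphere_cone_eq [OF N'(2)])
  ultimately have "emeasure lborel ?U = 0"
    by (metis (no_types, lifting) emeasure_mono le_zero_eq sets_lborel)
  then have "?U \<in> null_sets lborel"
    using op by auto
  then have "negligible ?U"
    by (simp add: negligible_iff_null_sets null_sets_completionI)
  then show False
    using op ne open_not_negligible by blast
qed

section \<open>The angular part of the Laplacian\<close>

text \<open>The vector field generates the rotations in the plane of \<open>a\<close> and
  \<open>b\<close>. The integral of \<open>v\<close> composed with such a rotation does not depend
  on the angle, and its derivative at angle 0 is the integral in question.\<close>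

lemma rotation_field_integral_eq_0:
  fixes v :: "'a::euclidean_space \<Rightarrow> complex"
  assumes ab: "a \<in> Basis" "b \<in> Basis" "a \<noteq> b" and "0 \<le> r"
    and v: "\<And>x. x \<in> sphere 0 r \<Longrightarrow> (v has_derivative v' x) (at x)"
    and cont: "continuous_on (sphere 0 r) (\<lambda>x. v' x ((x \<bullet> a) *\<^sub>R b - (x \<bullet> b) *\<^sub>R a))"
  shows "(SINT \<theta>. v' (r *\<^sub>R \<theta>) ((r *\<^sub>R \<theta> \<bullet> a) *\<^sub>R b - (r *\<^sub>R \<theta> \<bullet> b) *\<^sub>R a)) = 0"
proof -
  define Z where "Z = (\<lambda>x. (x \<bullet> a) *\<^sub>R b - (x \<bullet> b) *\<^sub>R a)"
  \<comment> \<open>Rotation by the angle \<open>t\<close> in the plane spanned by \<open>a\<close>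
    and \<open>b\<close>, the identity on the orthogonal complement; \<open>Z\<close> is its
    generator.\<close>
  define R where "R = (\<lambda>t x. x + (cos t - 1) *\<^sub>R ((x \<bullet> a) *\<^sub>R a + (x \<bullet> b) *\<^sub>R b) + sin t *\<^sub>R Z x)"
  have inn: "a \<bullet> a = 1" "b \<bullet> b = 1" "a \<bullet> b = 0" "b \<bullet> a = 0"
    using ab by (auto simp: inner_Basis)
  have Rscale: "R t (c *\<^sub>R x) = c *\<^sub>R R t x" for t c x
    by (simp add: R_def Z_def algebra_simps)
  have Rorth: "orthogonal_transformation (R t)" for t
  proof -
    have "linear (R t)"
      by (rule linearI) (auto simp: R_def Z_def algebra_simps)
    moreover have "norm (R t x) = norm x" for x
    proof -
      \<comment> \<open>Abstracting cosine and sine to \<open>C\<close> and \<open>S\<close> makes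
        this a polynomial identity; the relation between their squares enters only
        afterwards.\<close>
      have "R t x \<bullet> R t x = x \<bullet> x + (C\<^sup>2 + S\<^sup>2 - 1) * ((x \<bullet> a)\<^sup>2 + (x \<bullet> b)\<^sup>2)"
        if "cos t = C" "sin t = S" for C S
        by (simp add: R_def Z_def inner_add_left inner_add_right inner_diff_left inner_diff_right inn
            inner_commute [of a x] inner_commute [of b x] power2_eq_square algebra_simps that)
      from this [OF refl refl] show ?thesis by (simp add: norm_eq_sqrt_inner)
    qed
    ultimately show ?thesis by (simp add: orthogonal_transformation)
  qed
  have Rsphere: "R t (r *\<^sub>R x) \<in> sphere 0 r" if "x \<in> sphere 0 1" for t x
    using that \<open>0 \<le> r\<close> Rorth by (auto simp: orthogonal_transformation)
  have Rderiv: "((\<lambda>t. R t x) has_vector_derivative Z (R t x)) (at t)" for t x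
  proof -
    have "((\<lambda>t. R t x) has_vector_derivative
        (- sin t) *\<^sub>R ((x \<bullet> a) *\<^sub>R a + (x \<bullet> b) *\<^sub>R b) + cos t *\<^sub>R Z x) (at t)"
      unfolding R_def by (auto intro!: derivative_eq_intros)
    moreover have "(- sin t) *\<^sub>R ((x \<bullet> a) *\<^sub>R a + (x \<bullet> b) *\<^sub>R b) + cos t *\<^sub>R Z x = Z (R t x)"
      by (simp add: R_def Z_def inner_add_left inner_diff_left inn algebra_simps)
    ultimately show ?thesis by simp
  qed
  have R0: "R 0 x = x" for x by (simp add: R_def)
  have vcont: "continuous_on (sphere 0 r) v"
    using v by (meson continuous_at_imp_continuous_on has_derivative_continuous)
  have gcont: "continuous_on (sphere 0 1) (\<lambda>\<theta>. v (r *\<^sub>R \<theta>))"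
    by (rule continuous_on_compose2 [OF vcont]) (use \<open>0 \<le> r\<close> in \<open>auto intro!: continuous_intros\<close>)
  have "bounded ((\<lambda>x. v' x (Z x)) ` sphere 0 r)"
    using cont by (intro compact_imp_bounded compact_continuous_image) (auto simp: Z_def)
  then obtain B where B: "\<And>x. x \<in> sphere 0 r \<Longrightarrow> norm (v' x (Z x)) \<le> B"
    unfolding bounded_iff by blast
  have "((\<lambda>t. SINT \<theta>. v (R t (r *\<^sub>R \<theta>))) has_vector_derivative
      (SINT \<theta>. v' (R 0 (r *\<^sub>R \<theta>)) (Z (R 0 (r *\<^sub>R \<theta>))))) (at 0)"
  proof (rule has_vector_derivative_integral [OF finite_measure_sphere_measure, where T = UNIV and B = B])
    fix t :: real
    have "continuous_on UNIV (R t)"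
      using Rorth by (simp add: linear_continuous_on linear_linear orthogonal_transformation_linear)
    then have Rc: "continuous_on S (\<lambda>\<theta>. R t (r *\<^sub>R \<theta>))" for S
      by (rule continuous_on_compose2) (auto intro!: continuous_intros)
    show "integrable sphere_measure (\<lambda>\<theta>. v (R t (r *\<^sub>R \<theta>)))"
      using Rsphere by (intro integrable_sphere_measure continuous_on_compose2 [OF vcont] Rc) auto
    fix \<theta> :: 'a assume "\<theta> \<in> space sphere_measure"
    then have "R t (r *\<^sub>R \<theta>) \<in> sphere 0 r"
      using Rsphere by (simp add: space_sphere_measure)
    then show "((\<lambda>t. v (R t (r *\<^sub>R \<theta>))) has_vector_derivative v' (R t (r *\<^sub>R \<theta>)) (Z (R t (r *\<^sub>R \<theta>)))) (at t)"
      and "norm (v' (R t (r *\<^sub>R \<theta>)) (Z (R t (r *\<^sub>R \<theta>)))) \<le> B"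
      using vector_derivative_diff_chain_within [OF Rderiv has_derivative_at_withinI [OF v]] B
      by (auto simp: o_def)
  next
    show "(\<lambda>\<theta>. v' (R 0 (r *\<^sub>R \<theta>)) (Z (R 0 (r *\<^sub>R \<theta>)))) \<in> borel_measurable sphere_measure"
      unfolding R0 Z_def
      by (intro borel_measurable_sphere_measure continuous_on_compose2 [OF cont])
         (use \<open>0 \<le> r\<close> in \<open>auto intro!: continuous_intros\<close>)
  qed auto
  moreover have "(SINT \<theta>. v (R t (r *\<^sub>R \<theta>))) = (SINT \<theta>. v (r *\<^sub>R \<theta>))" for t
    unfolding Rscale by (rule sphere_integral_rotation [OF Rorth gcont])
  ultimately show ?thesis
    using vector_derivative_unique_at [OF _ has_vector_derivative_const] by (auto simp: R0 Z_def)
qed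

definition rotation_deriv :: "'a \<Rightarrow> 'a \<Rightarrow> ('a::euclidean_space \<Rightarrow> complex) \<Rightarrow> 'a \<Rightarrow> complex" where
  "rotation_deriv a b f x = (x \<bullet> a) *\<^sub>R partial_deriv b f x - (x \<bullet> b) *\<^sub>R partial_deriv a f x"

text \<open>In polar coordinates this is r d/dr, while \<open>radial_hessian\<close> is r^2 times
  the second derivative in r.\<close>

definition euler_deriv :: "('a::euclidean_space \<Rightarrow> complex) \<Rightarrow> 'a \<Rightarrow> complex" where
  "euler_deriv f x = (\<Sum>a\<in>Basis. (x \<bullet> a) *\<^sub>R partial_deriv a f x)"

definition radial_hessian :: "('a::euclidean_space \<Rightarrow> complex) \<Rightarrow> 'a \<Rightarrow> complex" where
  "radial_hessian f x =
    (\<Sum>a\<in>Basis. \<Sum>b\<in>Basis. ((x \<bullet> a) * (x \<bullet> b)) *\<^sub>R partial_deriv a (partial_deriv b f) x)"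

text \<open>The Laplace-Beltrami operator of the sphere acting in the angular variable, from the
  polar form of the Laplacian multiplied by r^2. Cartesian coordinates keep it free of divisions by
  r.\<close>

definition angular_laplacian :: "('a::euclidean_space \<Rightarrow> complex) \<Rightarrow> 'a \<Rightarrow> complex" where
  "angular_laplacian f x = (norm x)\<^sup>2 *\<^sub>R laplacian f x - (real DIM('a) - 1) *\<^sub>R euler_deriv f x
     - radial_hessian f x"

text \<open>A first order operator without constant term obeys the product rule, and the integral of
  the rotational derivative of \<open>f * g\<close> vanishes by
  \<open>rotation_field_integral_eq_0\<close>. That lemma requires \<open>a\<close> and
  \<open>b\<close> to be distinct; for equal ones the operator is zero.\<close>

lemma rotation_deriv_integral_by_parts:
  fixes f g :: "'a::euclidean_space \<Rightarrow> complex"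
  assumes ab: "a \<in> Basis" "b \<in> Basis" and r: "0 \<le> r" "sphere 0 r \<subseteq> S"
    and f: "Ck_on (Suc 0) S f" and g: "Ck_on (Suc 0) S g"
  shows "(SINT \<theta>. rotation_deriv a b f (r *\<^sub>R \<theta>) * g (r *\<^sub>R \<theta>)) =
    - (SINT \<theta>. f (r *\<^sub>R \<theta>) * rotation_deriv a b g (r *\<^sub>R \<theta>))"
proof (cases "a = b")
  case True
  then show ?thesis by (simp add: rotation_deriv_def)
next
  case False
  define df where "df = (\<lambda>x h. \<Sum>b\<in>Basis. (h \<bullet> b) *\<^sub>R partial_deriv b f x)"
  define dg where "dg = (\<lambda>x h. \<Sum>b\<in>Basis. (h \<bullet> b) *\<^sub>R partial_deriv b g x)"
  have d: "(f has_derivative df x) (at x)" "(g has_derivative dg x) (at x)" if "x \<in> sphere 0 r" for x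
    using subsetD [OF r(2) that] f g unfolding df_def dg_def
    by (auto intro!: has_derivative_partial_deriv)
  have cont0: "continuous_on (sphere 0 r) h" "continuous_on (sphere 0 r) (rotation_deriv a b h)"
    if "Ck_on (Suc 0) S h" for h :: "'a \<Rightarrow> complex"
    using continuous_on_subset [OF _ r(2)] that ab Ck_on_SucD [OF that]
    unfolding rotation_deriv_def [abs_def] by (auto intro!: continuous_intros)
  have cont: "continuous_on (sphere 0 1) (\<lambda>\<theta>. h (r *\<^sub>R \<theta>))"
    "continuous_on (sphere 0 1) (\<lambda>\<theta>. rotation_deriv a b h (r *\<^sub>R \<theta>))"
    if "Ck_on (Suc 0) S h" for h :: "'a \<Rightarrow> complex"
    using r by (auto intro!: continuous_intros continuous_on_compose2 [OF cont0(1) [OF that]]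
        continuous_on_compose2 [OF cont0(2) [OF that]])
  have part: "(\<Sum>c\<in>Basis. (((x \<bullet> a) *\<^sub>R b - (x \<bullet> b) *\<^sub>R a) \<bullet> c) *\<^sub>R partial_deriv c h x) = rotation_deriv a b h x"
    for h :: "'a \<Rightarrow> complex" and x
    using ab by (simp add: rotation_deriv_def inner_diff_left inner_Basis if_distrib [of "\<lambda>t. _ * t"]
        if_distrib [of "\<lambda>t. t *\<^sub>R _"] scaleR_diff_left sum_subtractf cong: if_cong)
  have eq: "f x * dg x ((x \<bullet> a) *\<^sub>R b - (x \<bullet> b) *\<^sub>R a) + df x ((x \<bullet> a) *\<^sub>R b - (x \<bullet> b) *\<^sub>R a) * g x
    = f x * rotation_deriv a b g x + rotation_deriv a b f x * g x" for x
    unfolding df_def dg_def part ..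
  have contr: "continuous_on (sphere 0 r) (\<lambda>x. f x * rotation_deriv a b g x + rotation_deriv a b f x * g x)"
    using cont0 [OF f] cont0 [OF g] by (intro continuous_intros)
  have "(SINT \<theta>. f (r *\<^sub>R \<theta>) * rotation_deriv a b g (r *\<^sub>R \<theta>)
      + rotation_deriv a b f (r *\<^sub>R \<theta>) * g (r *\<^sub>R \<theta>)) = 0"
    using rotation_field_integral_eq_0 [OF ab False r(1), where v = "\<lambda>x. f x * g x"
        and v' = "\<lambda>x h. f x * dg x h + df x h * g x", unfolded eq]
    using d contr by (auto intro!: has_derivative_mult)
  then show ?thesis
    using cont f g
    by (subst (asm) Bochner_Integration.integral_add)
       (auto simp: eq_neg_iff_add_eq_0 add.commute intro!: integrable_sphere_measure continuous_intros)
qed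

lemma partial_deriv_scaleR_inner:
  fixes f :: "'a::euclidean_space \<Rightarrow> 'b::real_normed_vector"
  assumes "f differentiable at x"
  shows "partial_deriv b (\<lambda>x. (x \<bullet> a) *\<^sub>R f x) x = (b \<bullet> a) *\<^sub>R f x + (x \<bullet> a) *\<^sub>R partial_deriv b f x"
proof -
  obtain D where D: "(f has_derivative D) (at x)"
    using assms by (auto simp: differentiable_def)
  have "((\<lambda>x. (x \<bullet> a) *\<^sub>R f x) has_derivative (\<lambda>h. (x \<bullet> a) *\<^sub>R D h + (h \<bullet> a) *\<^sub>R f x)) (at x)"
    by (auto intro!: derivative_eq_intros D)
  then show ?thesis
    by (simp add: partial_deriv_eqI partial_deriv_eqI [OF D])
qed

lemma partial_deriv_scaleR:
  fixes f :: "'a::euclidean_space \<Rightarrow> 'b::real_normed_vector"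
  shows "f differentiable at x \<Longrightarrow> partial_deriv b (\<lambda>x. c *\<^sub>R f x) x = c *\<^sub>R partial_deriv b f x"
  by (rule partial_deriv_bounded_linear [OF bounded_linear_scaleR_right])

lemma Ck_on_scaleR:
  fixes f :: "'a::euclidean_space \<Rightarrow> 'b::real_normed_vector"
  assumes "open S" "Ck_on n S f"
  shows "Ck_on n S (\<lambda>x. c *\<^sub>R f x)"
  using assms(2)
proof (induction n arbitrary: f)
  case 0
  then show ?case by (auto intro: continuous_intros)
next
  case (Suc n)
  have "Ck_on n S (partial_deriv b (\<lambda>x. c *\<^sub>R f x))" if "b \<in> Basis" for b
    by (rule Ck_on_cong [OF assms(1), of "\<lambda>x. c *\<^sub>R partial_deriv b f x"])
       (use Suc that in \<open>auto simp: partial_deriv_scaleR\<close>)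
  then show ?case
    using Suc.prems by auto
qed

lemma Ck_on_scaleR_inner:
  fixes f :: "'a::euclidean_space \<Rightarrow> 'b::real_normed_vector"
  assumes "open S" "Ck_on n S f"
  shows "Ck_on n S (\<lambda>x. (x \<bullet> a) *\<^sub>R f x)"
  using assms(2)
proof (induction n arbitrary: f)
  case 0
  then show ?case by (auto intro!: continuous_intros)
next
  case (Suc n)
  have "Ck_on n S (partial_deriv b (\<lambda>x. (x \<bullet> a) *\<^sub>R f x))" if "b \<in> Basis" for b
    by (rule Ck_on_cong [OF assms(1), of "\<lambda>x. (b \<bullet> a) *\<^sub>R f x + (x \<bullet> a) *\<^sub>R partial_deriv b f x"])
       (use Suc that assms(1) Ck_on_SucD [OF Suc.prems] in
        \<open>auto simp: partial_deriv_scaleR_inner intro!: Ck_on_add Ck_on_scaleR\<close>)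
  then show ?case
    using Suc.prems by (auto intro!: derivative_intros)
qed

lemma rotation_deriv_eq:
  "rotation_deriv a b f = (\<lambda>x. (x \<bullet> a) *\<^sub>R partial_deriv b f x + (- 1) *\<^sub>R ((x \<bullet> b) *\<^sub>R partial_deriv a f x))"
  by (simp add: fun_eq_iff rotation_deriv_def)

lemma Ck_on_rotation_deriv:
  assumes "open S" "Ck_on (Suc n) S f" "a \<in> Basis" "b \<in> Basis"
  shows "Ck_on n S (rotation_deriv a b f)"
  unfolding rotation_deriv_eq using assms
  by (intro Ck_on_add Ck_on_scaleR_inner Ck_on_scaleR) auto

text \<open>The angular Laplacian as the Casimir operator of the rotation group. Ordered pairs (a,
  b) count every plane twice, hence the factor 2.\<close>

lemma sum_rotation_deriv_rotation_deriv:
  fixes f :: "'a::euclidean_space \<Rightarrow> complex"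
  assumes S: "open S" "x \<in> S" and f: "Ck_on 2 S f"
  shows "(\<Sum>a\<in>Basis. \<Sum>b\<in>Basis. rotation_deriv a b (rotation_deriv a b f) x) = 2 *\<^sub>R angular_laplacian f x"
proof -
  have diff: "partial_deriv b f differentiable at x" if "b \<in> Basis" for b
    using f S that by (auto simp: numeral_2_eq_2)
  have pd: "partial_deriv c (rotation_deriv a b f) x =
    (c \<bullet> a) *\<^sub>R partial_deriv b f x + (x \<bullet> a) *\<^sub>R partial_deriv c (partial_deriv b f) x
    - (c \<bullet> b) *\<^sub>R partial_deriv a f x - (x \<bullet> b) *\<^sub>R partial_deriv c (partial_deriv a f) x"
    if "a \<in> Basis" "b \<in> Basis" for a b c
  proof -
    have d: "(\<lambda>x. (x \<bullet> a) *\<^sub>R partial_deriv b f x) differentiable at x"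
        "(\<lambda>x. (x \<bullet> b) *\<^sub>R partial_deriv a f x) differentiable at x"
      using diff that by (auto intro!: derivative_intros)
    then have "partial_deriv c (rotation_deriv a b f) x =
      partial_deriv c (\<lambda>x. (x \<bullet> a) *\<^sub>R partial_deriv b f x) x
      + (- 1) *\<^sub>R partial_deriv c (\<lambda>x. (x \<bullet> b) *\<^sub>R partial_deriv a f x) x"
      unfolding rotation_deriv_eq
      by (subst partial_deriv_add, (auto intro!: derivative_intros) [2], subst partial_deriv_scaleR)
         auto
    then show ?thesis
      using diff that by (simp add: partial_deriv_scaleR_inner)
  qed
  define X p q where "X = (\<lambda>a. x \<bullet> a)" and "p = (\<lambda>a. partial_deriv a f x)"
    and "q = (\<lambda>a b. partial_deriv a (partial_deriv b f) x)"
  have "(\<Sum>a\<in>Basis. \<Sum>b\<in>Basis. rotation_deriv a b (rotation_deriv a b f) x) =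
    (\<Sum>a\<in>Basis. \<Sum>b\<in>Basis. (b \<bullet> a) *\<^sub>R (X a *\<^sub>R p b) + (X a * X a) *\<^sub>R q b b - X a *\<^sub>R p a - (X a * X b) *\<^sub>R q b a
      - X b *\<^sub>R p b - (X a * X b) *\<^sub>R q a b + (b \<bullet> a) *\<^sub>R (X b *\<^sub>R p a) + (X b * X b) *\<^sub>R q a a)"
    by (intro sum.cong refl, subst rotation_deriv_def)
       (simp add: pd X_def p_def q_def algebra_simps inner_commute inner_same_Basis)
  also have "\<dots> = (\<Sum>a\<in>Basis. \<Sum>b\<in>Basis. (b \<bullet> a) *\<^sub>R (X a *\<^sub>R p b)) + (\<Sum>a\<in>Basis. \<Sum>b\<in>Basis. (X a * X a) *\<^sub>R q b b)
      - (\<Sum>a\<in>Basis. \<Sum>b\<in>(Basis::'a set). X a *\<^sub>R p a) - (\<Sum>a\<in>Basis. \<Sum>b\<in>Basis. (X a * X b) *\<^sub>R q b a)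
      - (\<Sum>a\<in>(Basis::'a set). \<Sum>b\<in>Basis. X b *\<^sub>R p b) - (\<Sum>a\<in>Basis. \<Sum>b\<in>Basis. (X a * X b) *\<^sub>R q a b)
      + (\<Sum>a\<in>Basis. \<Sum>b\<in>Basis. (b \<bullet> a) *\<^sub>R (X b *\<^sub>R p a)) + (\<Sum>a\<in>Basis. \<Sum>b\<in>Basis. (X b * X b) *\<^sub>R q a a)"
    by (simp add: sum.distrib sum_subtractf)
  also have "(\<Sum>a\<in>Basis. \<Sum>b\<in>Basis. (b \<bullet> a) *\<^sub>R (X a *\<^sub>R p b)) = euler_deriv f x"
    by (simp add: euler_deriv_def X_def p_def inner_Basis if_distrib [of "\<lambda>t. t *\<^sub>R _"]
        del: scaleR_scaleR cong: if_cong)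
  also have "(\<Sum>a\<in>Basis. \<Sum>b\<in>Basis. (b \<bullet> a) *\<^sub>R (X b *\<^sub>R p a)) = euler_deriv f x"
    by (simp add: euler_deriv_def X_def p_def inner_Basis if_distrib [of "\<lambda>t. t *\<^sub>R _"]
        del: scaleR_scaleR cong: if_cong)
  also have "(\<Sum>a\<in>Basis. \<Sum>b\<in>Basis. (X a * X a) *\<^sub>R q b b) = (norm x)\<^sup>2 *\<^sub>R laplacian f x"
    by (simp add: laplacian_def X_def q_def scaleR_sum_right [symmetric] scaleR_sum_left [symmetric]
        euclidean_inner [of x x, symmetric] power2_norm_eq_inner)
  also have "(\<Sum>a\<in>Basis. \<Sum>b\<in>Basis. (X b * X b) *\<^sub>R q a a) = (norm x)\<^sup>2 *\<^sub>R laplacian f x"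
    by (simp add: laplacian_def X_def q_def scaleR_sum_right [symmetric] scaleR_sum_left [symmetric]
        euclidean_inner [of x x, symmetric] power2_norm_eq_inner)
  \<comment> \<open>The two sums without Kronecker delta contribute -2d Euler terms and the two
    diagonal sums contribute +2, which gives the coefficient d - 1 of
    \<open>angular_laplacian\<close>.\<close>
  also have "(\<Sum>a\<in>Basis. \<Sum>b\<in>(Basis::'a set). X a *\<^sub>R p a) = real DIM('a) *\<^sub>R euler_deriv f x"
    by (simp add: euler_deriv_def X_def p_def sum_distrib_left scaleR_conv_of_real mult_ac)
  also have "(\<Sum>a\<in>(Basis::'a set). \<Sum>b\<in>Basis. X b *\<^sub>R p b) = real DIM('a) *\<^sub>R euler_deriv f x"
    by (simp add: euler_deriv_def X_def p_def scaleR_conv_of_real)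
  also have "(\<Sum>a\<in>Basis. \<Sum>b\<in>Basis. (X a * X b) *\<^sub>R q a b) = radial_hessian f x"
    by (simp add: radial_hessian_def X_def q_def)
  \<comment> \<open>The weights are symmetric in \<open>a\<close> and \<open>b\<close>, so
    exchanging the summation indices identifies both orders of differentiation.\<close>
  also have "(\<Sum>a\<in>Basis. \<Sum>b\<in>Basis. (X a * X b) *\<^sub>R q b a) = radial_hessian f x"
    by (subst sum.swap) (simp add: radial_hessian_def X_def q_def mult.commute)
  finally show ?thesis
    by (simp add: angular_laplacian_def algebra_simps scaleR_conv_of_real)
qed

text \<open>Each summand is the square of an antisymmetric operator: integrating by parts twice
  yields two minus signs.\<close>

lemma angular_laplacian_self_adjoint:
  fixes f g :: "'a::euclidean_space \<Rightarrow> complex"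
  assumes S: "open S" and r: "0 \<le> r" "sphere 0 r \<subseteq> S" and f: "Ck_on 2 S f" and g: "Ck_on 2 S g"
  shows "(SINT \<theta>. angular_laplacian f (r *\<^sub>R \<theta>) * g (r *\<^sub>R \<theta>)) =
    (SINT \<theta>. f (r *\<^sub>R \<theta>) * angular_laplacian g (r *\<^sub>R \<theta>))"
proof -
  have [simp]: "r *\<^sub>R \<theta> \<in> S" if "\<theta> \<in> sphere 0 1" for \<theta>
    using that r by auto
  have cont: "continuous_on (sphere 0 1) (\<lambda>\<theta>. h (r *\<^sub>R \<theta>))" if "Ck_on 0 S h" for h :: "'a \<Rightarrow> complex"
    using that by (auto intro!: continuous_intros continuous_on_compose2 [of S h])
  have *: "Ck_on (Suc 0) S (rotation_deriv a b f)" "Ck_on (Suc 0) S (rotation_deriv a b g)"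
    "Ck_on 0 S (rotation_deriv a b (rotation_deriv a b f))"
    "Ck_on 0 S (rotation_deriv a b (rotation_deriv a b g))"
    "Ck_on (Suc 0) S f" "Ck_on (Suc 0) S g" "Ck_on 0 S f" "Ck_on 0 S g"
    if "a \<in> Basis" "b \<in> Basis" for a b
    using that f g by (auto intro!: Ck_on_rotation_deriv S intro: Ck_on_mono simp: numeral_2_eq_2
        simp del: Ck_on.simps)
  have prod: "integrable sphere_measure
      (\<lambda>\<theta>. rotation_deriv a b (rotation_deriv a b f) (r *\<^sub>R \<theta>) * g (r *\<^sub>R \<theta>))"
    "integrable sphere_measure
      (\<lambda>\<theta>. f (r *\<^sub>R \<theta>) * rotation_deriv a b (rotation_deriv a b g) (r *\<^sub>R \<theta>))"
    if "a \<in> Basis" "b \<in> Basis" for a b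
    using * [OF that] by (auto intro!: integrable_sphere_measure continuous_on_mult [OF cont cont] simp del: Ck_on.simps)
  have ang: "angular_laplacian h (r *\<^sub>R \<theta>) =
      (1 / 2) *\<^sub>R (\<Sum>a\<in>Basis. \<Sum>b\<in>Basis. rotation_deriv a b (rotation_deriv a b h) (r *\<^sub>R \<theta>))"
    if "\<theta> \<in> sphere 0 1" "Ck_on 2 S h" for h \<theta>
    using that by (subst sum_rotation_deriv_rotation_deriv [OF S]) auto
  have "(SINT \<theta>. angular_laplacian f (r *\<^sub>R \<theta>) * g (r *\<^sub>R \<theta>)) =
    (SINT \<theta>. (1 / 2) *\<^sub>R (\<Sum>a\<in>Basis. \<Sum>b\<in>Basis.
      rotation_deriv a b (rotation_deriv a b f) (r *\<^sub>R \<theta>) * g (r *\<^sub>R \<theta>)))"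
    by (intro Bochner_Integration.integral_cong refl)
       (simp add: ang f space_sphere_measure sum_distrib_right)
  also have "\<dots> = (1 / 2) *\<^sub>R (\<Sum>a\<in>Basis. \<Sum>b\<in>Basis. SINT \<theta>.
      rotation_deriv a b (rotation_deriv a b f) (r *\<^sub>R \<theta>) * g (r *\<^sub>R \<theta>))"
    by (subst integral_scaleR_right, subst Bochner_Integration.integral_sum)
      (auto intro!: sum.cong Bochner_Integration.integral_sum Bochner_Integration.integrable_sum prod)
  \<comment> \<open>Both integrations by parts: first with \<open>rotation_deriv a b f\<close> in
    the role of the differentiated function, then with \<open>f\<close> itself.\<close>
  also have "\<dots> = (1 / 2) *\<^sub>R (\<Sum>a\<in>Basis. \<Sum>b\<in>Basis. SINT \<theta>.
      f (r *\<^sub>R \<theta>) * rotation_deriv a b (rotation_deriv a b g) (r *\<^sub>R \<theta>))"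
    using * by (intro arg_cong [where f = "(*\<^sub>R) (1/2)"] sum.cong refl)
      (simp add: rotation_deriv_integral_by_parts [OF _ _ r] del: Ck_on.simps)
  also have "\<dots> = (SINT \<theta>. (1 / 2) *\<^sub>R (\<Sum>a\<in>Basis. \<Sum>b\<in>Basis.
      f (r *\<^sub>R \<theta>) * rotation_deriv a b (rotation_deriv a b g) (r *\<^sub>R \<theta>)))"
    by (subst integral_scaleR_right, subst Bochner_Integration.integral_sum)
      (auto intro!: sum.cong Bochner_Integration.integral_sum [symmetric]
        Bochner_Integration.integrable_sum prod)
  also have "\<dots> = (SINT \<theta>. f (r *\<^sub>R \<theta>) * angular_laplacian g (r *\<^sub>R \<theta>))"
    by (intro Bochner_Integration.integral_cong refl)
       (simp add: ang g space_sphere_measure sum_distrib_left)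
  finally show ?thesis .
qed

section \<open>Radial differential equations\<close>

text \<open>Derivatives along the ray through \<open>x\<close>, kept as sums over the basis so that
  they can be integrated and differentiated term by term.\<close>

abbreviation radial_deriv :: "('a::euclidean_space \<Rightarrow> 'b::real_normed_vector) \<Rightarrow> real \<Rightarrow> 'a \<Rightarrow> 'b" where
  "radial_deriv f t x \<equiv> \<Sum>b\<in>Basis. (x \<bullet> b) *\<^sub>R partial_deriv b f (t *\<^sub>R x)"

abbreviation radial_deriv2 :: "('a::euclidean_space \<Rightarrow> 'b::real_normed_vector) \<Rightarrow> real \<Rightarrow> 'a \<Rightarrow> 'b" where
  "radial_deriv2 f t x \<equiv> \<Sum>b\<in>Basis. (x \<bullet> b) *\<^sub>R
    (\<Sum>a\<in>Basis. (x \<bullet> a) *\<^sub>R partial_deriv a (partial_deriv b f) (t *\<^sub>R x))"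

lemma has_vector_derivative_radial:
  fixes f :: "'a::euclidean_space \<Rightarrow> 'b::real_normed_vector"
  assumes "f differentiable at (t *\<^sub>R x)"
  shows "((\<lambda>t. f (t *\<^sub>R x)) has_vector_derivative
    radial_deriv f t x) (at t)"
proof -
  have "((\<lambda>t. t *\<^sub>R x) has_vector_derivative x) (at t)"
    by (auto intro!: derivative_eq_intros)
  moreover have "(f has_derivative (\<lambda>h. \<Sum>b\<in>Basis. (h \<bullet> b) *\<^sub>R partial_deriv b f (t *\<^sub>R x)))
      (at (t *\<^sub>R x) within range (\<lambda>t. t *\<^sub>R x))"
    by (rule has_derivative_at_withinI [OF has_derivative_partial_deriv [OF assms]])
  ultimately show ?thesis
    using vector_derivative_diff_chain_within [of "\<lambda>t. t *\<^sub>R x" x t UNIV f] by (simp add: o_def)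
qed

lemma has_vector_derivative_of_real_power:
  "((\<lambda>t. complex_of_real t ^ n) has_vector_derivative of_nat n * of_real t ^ (n - 1)) (at t)"
  by (rule has_vector_derivative_real_field [where f = "\<lambda>z. z ^ n"]) (auto intro!: derivative_eq_intros)

lemma has_vector_derivative_radial_twice:
  fixes f :: "'a::euclidean_space \<Rightarrow> complex"
  assumes "Ck_on 2 S f" "t *\<^sub>R x \<in> S"
  shows "((\<lambda>t. \<Sum>b\<in>Basis. (x \<bullet> b) *\<^sub>R partial_deriv b f (t *\<^sub>R x)) has_vector_derivative
    radial_deriv2 f t x) (at t)"
  using assms
  by (intro has_vector_derivative_sum has_vector_derivative_scaleR [OF DERIV_const, simplified]
        has_vector_derivative_radial) (auto simp: numeral_2_eq_2)

lemma harmonic_polysD: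
  fixes p :: "'a::euclidean_space \<Rightarrow> complex" and t :: real
  assumes "p \<in> harmonic_polys k"
  shows "polynomial_function p" "p (t *\<^sub>R x) = of_real t ^ k * p x" "laplacian p x = 0"
  using assms by (auto simp: harmonic_polys_def)

text \<open>Differentiating p(tx) = t^k p(x) once and twice at t = 1 gives Euler derivative k p and
  radial Hessian k(k - 1) p. Since the Laplacian of p vanishes, the eigenvalue is -(d - 1)k - k(k -
  1).\<close>

lemma angular_laplacian_harmonic:
  fixes p :: "'a::euclidean_space \<Rightarrow> complex"
  assumes p: "p \<in> harmonic_polys k"
  shows "angular_laplacian p x = - of_real (real k * (real k + DIM('a) - 2)) * p x"
proof -
  note hom = harmonic_polysD(2) [OF p]
  have C2: "Ck_on 2 UNIV p"
    by (intro Ck_on_polynomial_function harmonic_polysD(1) [OF p])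
  have d1: "((\<lambda>t. p (t *\<^sub>R x)) has_vector_derivative radial_deriv p t x) (at t)" for t
    using C2 by (intro has_vector_derivative_radial) (auto simp: numeral_2_eq_2)
  have power: "((\<lambda>t. c * of_real t ^ n) has_vector_derivative of_nat n * of_real t ^ (n - 1) * c) (at t)"
    for c :: complex and n and t :: real
    using has_vector_derivative_mult_left [OF has_vector_derivative_of_real_power] by (simp add: mult_ac)
  have e1: "radial_deriv p t x = of_nat k * of_real t ^ (k - 1) * p x" for t
    using vector_derivative_unique_at [OF d1 [of t]] power [of "p x" k t] by (simp add: hom mult.commute)
  have e2: "radial_deriv2 p t x
     = of_nat (k - 1) * of_real t ^ (k - 1 - 1) * (of_nat k * p x)" for t
    using vector_derivative_unique_at [OF has_vector_derivative_radial_twice [OF C2 UNIV_I, of x t]]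
      power [of "of_nat k * p x" "k - 1" t] by (simp add: e1 mult_ac)
  have eu: "euler_deriv p x = of_nat k * p x"
    using e1 [of 1] by (simp add: euler_deriv_def)
  have "radial_hessian p x = of_nat (k - 1) * of_nat k * p x"
    using e2 [of 1] unfolding radial_hessian_def
    by (subst sum.swap) (simp add: scaleR_sum_right mult_ac)
  \<comment> \<open>For k = 0 the truncated difference \<open>k - 1\<close> is wrong as a number,
    but it is multiplied by k.\<close>
  also have "\<dots> = (of_nat k - 1) * of_nat k * p x"
    by (cases k) auto
  finally show ?thesis
    by (simp add: angular_laplacian_def harmonic_polysD(3) [OF p] eu scaleR_conv_of_real algebra_simps)
qed

lemma sphere_integral_has_vector_derivative:
  fixes f :: "'a::euclidean_space \<Rightarrow> complex"
  assumes f: "Ck_on (Suc 0) (ball 0 1) f" and g: "continuous_on (sphere 0 1) g" and t: "\<bar>t\<bar> < 1"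
  shows "((\<lambda>t. SINT \<theta>. f (t *\<^sub>R \<theta>) * g \<theta>) has_vector_derivative
    (SINT \<theta>. radial_deriv f t \<theta> * g \<theta>)) (at t)"
proof -
  \<comment> \<open>The radius \<open>\<rho>\<close> is kept below 1 so that the derivatives are
    bounded on a compact set of parameters and directions.\<close>
  obtain \<rho> where \<rho>: "\<bar>t\<bar> < \<rho>" "\<rho> < 1"
    using t dense by blast
  define f' where "f' = (\<lambda>t \<theta>. radial_deriv f t \<theta> * g \<theta>)"
  have inb: "s *\<^sub>R \<theta> \<in> ball 0 1" if "\<bar>s\<bar> \<le> \<rho>" "\<theta> \<in> sphere 0 1" for s and \<theta> :: 'a
    using that \<rho> by simp
  have pc: "continuous_on (ball 0 1) (partial_deriv b f)" if "b \<in> Basis" for b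
    using f that by simp
  have fc: "continuous_on (ball 0 1) f"
    using Ck_on_SucD [OF f] by simp
  have gc: "continuous_on ({- \<rho>..\<rho>} \<times> sphere 0 1) (\<lambda>z. g (snd z))"
    by (rule continuous_on_compose2 [OF g]) (auto intro!: continuous_intros)
  have cont2: "continuous_on ({- \<rho>..\<rho>} \<times> sphere 0 1) (\<lambda>(s, \<theta>). f' s \<theta>)"
    unfolding f'_def case_prod_unfold
    by (intro continuous_intros continuous_on_compose2 [OF pc] gc) (use \<rho> in auto)
  have "bounded ((\<lambda>(s, \<theta>). f' s \<theta>) ` ({- \<rho>..\<rho>} \<times> sphere 0 1))"
    by (intro compact_imp_bounded compact_continuous_image cont2 compact_Times) auto
  then obtain B where B: "norm (f' s \<theta>) \<le> B" if "s \<in> {- \<rho>..\<rho>}" "\<theta> \<in> sphere 0 1" for s \<theta>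
    unfolding bounded_iff by fast
  have "((\<lambda>t. SINT \<theta>. f (t *\<^sub>R \<theta>) * g \<theta>) has_vector_derivative
    (SINT \<theta>. f' t \<theta>)) (at t)"
  proof (rule has_vector_derivative_integral [OF finite_measure_sphere_measure, where f' = f' and T = "{- \<rho><..<\<rho>}" and B = B])
    show "integrable sphere_measure (\<lambda>\<theta>. f (s *\<^sub>R \<theta>) * g \<theta>)" if "s \<in> {- \<rho><..<\<rho>}" for s
      using that by (intro integrable_sphere_measure continuous_intros g continuous_on_compose2 [OF fc])
        (auto simp del: mem_sphere intro!: inb)
    show "f' t \<in> borel_measurable sphere_measure"
      using \<rho> by (intro borel_measurable_sphere_measure continuous_on_compose2 [OF cont2, of _ "\<lambda>x. (t, x)", simplified])
        (auto intro!: continuous_intros)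
    show "((\<lambda>s. f (s *\<^sub>R \<theta>) * g \<theta>) has_vector_derivative f' s \<theta>) (at s)"
      if "s \<in> {- \<rho><..<\<rho>}" "\<theta> \<in> space sphere_measure" for s \<theta>
      using that f inb [of s \<theta>] unfolding f'_def space_sphere_measure
      by (intro has_vector_derivative_mult_left has_vector_derivative_radial) auto
  qed (use B \<rho> in \<open>auto simp: space_sphere_measure\<close>)
  then show ?thesis
    by (simp only: f'_def)
qed

text \<open>Symmetry moves the angular Laplacian from \<open>f\<close> to the eigenfunction
  \<open>Y\<close>. The test function has to be evaluated at radius r as well, which brings in the
  factor r^k; it cancels for r > 0.\<close>

lemma radial_ode:
  fixes f :: "'a::euclidean_space \<Rightarrow> complex" and r :: real
  assumes f: "Ck_on 2 (ball 0 1) f" and Y: "Y \<in> harmonic_polys k" and r: "0 < r" "r < 1"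
  shows "of_real (r * (real DIM('a) - 1)) *
        (SINT \<theta>. radial_deriv f r \<theta> * Y \<theta>)
    + of_real (r\<^sup>2) * (SINT \<theta>. radial_deriv2 f r \<theta> * Y \<theta>)
    = of_real (real k * (real k + DIM('a) - 2)) * (SINT \<theta>. f (r *\<^sub>R \<theta>) * Y \<theta>)
      + of_real (r\<^sup>2) * (SINT \<theta>. laplacian f (r *\<^sub>R \<theta>) * Y \<theta>)"
    (is "?c1 * ?I1 + ?c2 * ?I2 = ?c3 * ?I3 + ?c2 * ?I4")
proof -
  note hom = harmonic_polysD(2) [OF Y]
  have Yp: "polynomial_function Y" by (rule harmonic_polysD [OF Y])
  have Yc: "continuous_on S Y" for S
    by (rule continuous_on_polymonial_function [OF Yp])
  have c: "continuous_on (sphere 0 1) (\<lambda>\<theta>. h (r *\<^sub>R \<theta>))" if "continuous_on (ball 0 1) h"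
    for h :: "'a \<Rightarrow> complex"
    by (rule continuous_on_compose2 [OF that]) (use r in \<open>auto intro!: continuous_intros\<close>)
  have fc: "continuous_on (ball 0 1) f" "continuous_on (ball 0 1) (laplacian f)"
    using Ck_on_mono [OF f, of 0] Ck_on_laplacian [of _ 0] f by (auto simp: numeral_2_eq_2)
  have pc: "continuous_on (ball 0 1) (partial_deriv b f)" if "b \<in> Basis" for b
    using Ck_on_mono [OF f, of "Suc 0"] that by simp
  have ppc: "continuous_on (ball 0 1) (partial_deriv a (partial_deriv b f))" if "a \<in> Basis" "b \<in> Basis" for a b
    using f that by (simp add: numeral_2_eq_2)
  have i: "integrable sphere_measure (\<lambda>\<theta>. radial_deriv f r \<theta> * Y \<theta>)"
    "integrable sphere_measure (\<lambda>\<theta>. radial_deriv2 f r \<theta> * Y \<theta>)"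
    "integrable sphere_measure (\<lambda>\<theta>. laplacian f (r *\<^sub>R \<theta>) * Y \<theta>)"
    by (auto intro!: integrable_sphere_measure continuous_intros Yc c fc pc ppc)
  have "angular_laplacian f (r *\<^sub>R \<theta>) * Y (r *\<^sub>R \<theta>) = of_real (r ^ k) *
    (?c2 * (laplacian f (r *\<^sub>R \<theta>) * Y \<theta>)
      - ?c1 * (radial_deriv f r \<theta> * Y \<theta>)
      - ?c2 * (radial_deriv2 f r \<theta> * Y \<theta>))"
    if "\<theta> \<in> sphere 0 1" for \<theta>
  proof -
    have "euler_deriv f (r *\<^sub>R \<theta>) = of_real r * radial_deriv f r \<theta>"
      by (simp add: euler_deriv_def sum_distrib_left scaleR_conv_of_real mult_ac)
    moreover have "radial_hessian f (r *\<^sub>R \<theta>) = ?c2 * radial_deriv2 f r \<theta>"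
      unfolding radial_hessian_def
      by (subst sum.swap) (simp add: sum_distrib_left scaleR_conv_of_real mult_ac power2_eq_square)
    ultimately show ?thesis
      using that by (simp add: angular_laplacian_def hom scaleR_conv_of_real algebra_simps)
  qed
  then have "(SINT \<theta>. angular_laplacian f (r *\<^sub>R \<theta>) * Y (r *\<^sub>R \<theta>)) =
    (SINT \<theta>. of_real (r ^ k) *
    (?c2 * (laplacian f (r *\<^sub>R \<theta>) * Y \<theta>)
      - ?c1 * (radial_deriv f r \<theta> * Y \<theta>)
      - ?c2 * (radial_deriv2 f r \<theta> * Y \<theta>)))"
    by (intro Bochner_Integration.integral_cong refl) (simp add: space_sphere_measure)
  also have "\<dots> = of_real (r ^ k) * (?c2 * ?I4 - ?c1 * ?I1 - ?c2 * ?I2)"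
    by (simp only: integral_mult_right_zero)
       (simp add: i Bochner_Integration.integral_diff Bochner_Integration.integrable_diff)
  finally have 1: "(SINT \<theta>. angular_laplacian f (r *\<^sub>R \<theta>) * Y (r *\<^sub>R \<theta>)) = \<dots>" .
  have "(SINT \<theta>. f (r *\<^sub>R \<theta>) * angular_laplacian Y (r *\<^sub>R \<theta>)) =
    (SINT \<theta>. of_real (r ^ k) * (- ?c3 * (f (r *\<^sub>R \<theta>) * Y \<theta>)))"
    unfolding angular_laplacian_harmonic [OF Y] hom
    by (intro Bochner_Integration.integral_cong refl) (simp add: mult_ac)
  also have "\<dots> = of_real (r ^ k) * (- ?c3 * ?I3)"
    by (simp only: integral_mult_right_zero)
  finally have 2: "(SINT \<theta>. f (r *\<^sub>R \<theta>) * angular_laplacian Y (r *\<^sub>R \<theta>)) = \<dots>" .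
  have "of_real (r ^ k) * (?c2 * ?I4 - ?c1 * ?I1 - ?c2 * ?I2) = of_real (r ^ k) * (- ?c3 * ?I3)"
    unfolding 1 [symmetric] 2 [symmetric] using r
    by (intro angular_laplacian_self_adjoint [OF open_ball _ _ f Ck_on_polynomial_function [OF Yp]]) auto
  then have "?c2 * ?I4 - ?c1 * ?I1 - ?c2 * ?I2 = - ?c3 * ?I3"
    by (rule mult_left_cancel [THEN iffD1, rotated]) (use r in simp)
  then show ?thesis
    by (simp add: algebra_simps)
qed

section \<open>The inhomogeneous Euler equation on the unit interval\<close>

text \<open>The equation is available only for r > 0; continuity alone includes the endpoint 0,
  where the constant can be read off.\<close>

lemma constant_from_0:
  fixes W :: "real \<Rightarrow> 'b::banach"
  assumes "continuous_on {0..<1} W"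
    and "\<And>r. 0 < r \<Longrightarrow> r < 1 \<Longrightarrow> (W has_vector_derivative 0) (at r)" and "0 \<le> r" "r < 1"
  shows "W r = W 0"
proof (cases "r = 0")
  case False
  show ?thesis
  proof (rule has_derivative_zero_unique_strong_interval [of "{0,r}" 0 r W])
    show "continuous_on {0..r} W"
      by (rule continuous_on_subset [OF assms(1)]) (use assms in auto)
    show "(W has_derivative (\<lambda>h. 0)) (at x within {0..r})" if "x \<in> {0..r} - {0, r}" for x
      using assms(2) [of x] that assms(4) by (auto simp: has_vector_derivative_def intro: has_derivative_at_withinI)
  qed (use assms in auto)
qed simp

text \<open>The equation says that the derivative of r^(2k+d-1) (r^(-k) F)' is r^(k+d-1) G, so it is
  solved by two integrations. \<open>W\<close> is the first primitive minus the expected one. It is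
  continuous at 0 with value 0, which excludes the singular homogeneous solution. \<open>V\<close>
  is the same device for the second integration, which leaves the free constant c.\<close>

lemma euler_ode_solution:
  fixes F F1 F2 G :: "real \<Rightarrow> complex" and k d n :: nat
  assumes d: "2 \<le> d"
    and F: "\<And>r. \<bar>r\<bar> < 1 \<Longrightarrow> (F has_vector_derivative F1 r) (at r)"
    and F1: "\<And>r. \<bar>r\<bar> < 1 \<Longrightarrow> (F1 has_vector_derivative F2 r) (at r)"
    and ode: "\<And>r. 0 < r \<Longrightarrow> r < 1 \<Longrightarrow> of_real (r * (real d - 1)) * F1 r + of_real (r\<^sup>2) * F2 r =
       of_real (real k * (real k + d - 2)) * F r + of_real (r\<^sup>2) * G r"
    and G: "\<And>r. 0 < r \<Longrightarrow> r < 1 \<Longrightarrow> G r = (\<Sum>i<n. b i * of_real r ^ (k + 2 * i))"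
  shows "\<exists>c. \<forall>r. 0 < r \<longrightarrow> r < 1 \<longrightarrow> F r = c * of_real r ^ k +
    (\<Sum>i<n. b i / (of_nat (2 * Suc i) * of_nat (2 * k + d + 2 * i)) * of_real r ^ (k + 2 * Suc i))"
proof -
  obtain m where m: "d = m + 2" using d by (metis add.commute le_Suc_ex)
  define W where "W = (\<lambda>r. of_real r ^ (k + m + 1) * F1 r - of_nat k * of_real r ^ (k + m) * F r
    - (\<Sum>i<n. b i / of_nat (2 * k + d + 2 * i) * of_real r ^ (2 * k + d + 2 * i)))"
  note power = has_vector_derivative_of_real_power
  have W0: "W r = 0" if "0 \<le> r" "r < 1" for r
  proof -
    have "W r = W 0"
    proof (rule constant_from_0)
      have "continuous_on {0..<1} F" "continuous_on {0..<1} F1"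
        by (intro continuous_at_imp_continuous_on ballI has_vector_derivative_continuous [OF F]
            has_vector_derivative_continuous [OF F1]; simp)+
      then show "continuous_on {0..<1} W"
        unfolding W_def by (intro continuous_intros)
      fix r :: real assume r: "0 < r" "r < 1"
      define z where "z = complex_of_real r"
      have z: "z \<noteq> 0" using r by (simp add: z_def)
      have Fr: "(F has_vector_derivative F1 r) (at r)" "(F1 has_vector_derivative F2 r) (at r)"
        using F F1 r by auto
      have "(W has_vector_derivative
        (z ^ (k + m + 1) * F2 r + (of_nat (k + m + 1) * z ^ (k + m + 1 - 1)) * F1 r)
        - (of_nat k * z ^ (k + m) * F1 r + (of_nat k * (of_nat (k + m) * z ^ (k + m - 1))) * F r)
        - (\<Sum>i<n. b i / of_nat (2 * k + d + 2 * i) * (of_nat (2 * k + d + 2 * i) * z ^ (2 * k + d + 2 * i - 1)))) (at r)"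
        unfolding W_def z_def
        by (rule has_vector_derivative_diff has_vector_derivative_sum power
            has_vector_derivative_mult_right has_vector_derivative_mult Fr)+
      also have "(\<Sum>i<n. b i / of_nat (2 * k + d + 2 * i) * (of_nat (2 * k + d + 2 * i) * z ^ (2 * k + d + 2 * i - 1)))
          = z ^ (k + m + 1) * (\<Sum>i<n. b i * z ^ (k + 2 * i))"
        unfolding sum_distrib_left
      proof (rule sum.cong [OF refl])
        fix i
        have "2 * k + d + 2 * i - 1 = (k + m + 1) + (k + 2 * i)"
          using m by simp
        moreover have "(of_nat (2 * k + d + 2 * i) :: complex) \<noteq> 0"
          unfolding of_nat_eq_0_iff using m by simp
        ultimately show "b i / of_nat (2 * k + d + 2 * i) * (of_nat (2 * k + d + 2 * i) * z ^ (2 * k + d + 2 * i - 1)) =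
          z ^ (k + m + 1) * (b i * z ^ (k + 2 * i))"
          by (simp only: power_add) (simp add: mult_ac del: of_nat_add of_nat_mult)
      qed
      also have "(\<Sum>i<n. b i * z ^ (k + 2 * i)) = G r"
        using G r by (simp add: z_def)
      also have "(z ^ (k + m + 1) * F2 r + (of_nat (k + m + 1) * z ^ (k + m + 1 - 1)) * F1 r)
        - (of_nat k * z ^ (k + m) * F1 r + (of_nat k * (of_nat (k + m) * z ^ (k + m - 1))) * F r)
        - z ^ (k + m + 1) * G r = 0"
      proof -
        have o: "z * (of_nat m + 1) * F1 r + z\<^sup>2 * F2 r = of_nat k * (of_nat k + of_nat m) * F r + z\<^sup>2 * G r"
          using ode [OF r] by (simp add: m z_def algebra_simps)
        have zz: "of_nat (k + m) * z ^ (k + m - 1) * z = of_nat (k + m) * z ^ (k + m)"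
          by (cases "k + m") auto
        \<comment> \<open>The factor \<open>z\<close> repairs the truncated exponent
          \<open>k + m - 1\<close> in the case k + m = 0.\<close>
        have "z * ((z ^ (k + m + 1) * F2 r + (of_nat (k + m + 1) * z ^ (k + m + 1 - 1)) * F1 r)
        - (of_nat k * z ^ (k + m) * F1 r + (of_nat k * (of_nat (k + m) * z ^ (k + m - 1))) * F r)
        - z ^ (k + m + 1) * G r) =
         z ^ (k + m) * (z * (of_nat m + 1) * F1 r + z\<^sup>2 * F2 r - z\<^sup>2 * G r)
         - of_nat k * (of_nat (k + m) * z ^ (k + m - 1) * z) * F r"
          by (simp add: algebra_simps power2_eq_square power_add)
        also have "\<dots> = 0"
          unfolding zz o by (simp add: algebra_simps)
        finally show ?thesis using z by simp
      qed
      finally show "(W has_vector_derivative 0) (at r)" .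
    qed (use that in auto)
    \<comment> \<open>For k = 0 in dimension 2 the power \<open>0 ^ (k + m)\<close> is 1, but its
      coefficient k vanishes; this is the case in which the singular solution would be
      logarithmic.\<close>
    also have "W 0 = 0"
      using m by (cases "k = 0") (auto simp: W_def power_0_left)
    finally show ?thesis .
  qed
  define V where "V = (\<lambda>r. F r / of_real r ^ k -
    (\<Sum>i<n. b i / (of_nat (2 * Suc i) * of_nat (2 * k + d + 2 * i)) * of_real r ^ (2 * Suc i)))"
  have V': "(V has_vector_derivative 0) (at r)" if r: "0 < r" "r < 1" for r
  proof -
    define z where "z = complex_of_real r"
    have z: "z \<noteq> 0" using r by (simp add: z_def)
    have Fr: "(F has_vector_derivative F1 r) (at r)"
      using F r by auto
    have "((\<lambda>z. inverse z ^ k) has_field_derivative - of_nat k * inverse z ^ (k + 1)) (at z)"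
    proof (rule DERIV_cong)
      show "((\<lambda>z. inverse z ^ k) has_field_derivative of_nat k * (- (inverse z ^ Suc (Suc 0)) * inverse z ^ (k - Suc 0))) (at z)"
        by (rule DERIV_power [OF DERIV_inverse [OF z]])
    qed (cases k; simp add: algebra_simps)
    from has_vector_derivative_real_field [OF this [unfolded z_def]]
    have inv: "((\<lambda>t. inverse (complex_of_real t ^ k)) has_vector_derivative - of_nat k * inverse z ^ (k + 1)) (at r)"
      by (simp only: power_inverse z_def)
    have "(V has_vector_derivative (F r * (- of_nat k * inverse z ^ (k + 1)) + F1 r * inverse (z ^ k))
       - (\<Sum>i<n. b i / (of_nat (2 * Suc i) * of_nat (2 * k + d + 2 * i)) * (of_nat (2 * Suc i) * z ^ (2 * Suc i - 1)))) (at r)"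
      unfolding V_def divide_inverse [of "F _"] z_def
      by (rule has_vector_derivative_diff has_vector_derivative_sum power inv [unfolded z_def]
            has_vector_derivative_mult_right has_vector_derivative_mult Fr)+
    also have "(\<Sum>i<n. b i / (of_nat (2 * Suc i) * of_nat (2 * k + d + 2 * i)) * (of_nat (2 * Suc i) * z ^ (2 * Suc i - 1)))
      = inverse z ^ (2 * k + m + 1) * (\<Sum>i<n. b i / of_nat (2 * k + d + 2 * i) * z ^ (2 * k + d + 2 * i))"
      unfolding sum_distrib_left
    proof (rule sum.cong [OF refl])
      fix i
      \<comment> \<open>The exponent 2k + d + 2i splits as (2k + m + 1) + (2i + 1): the power of z
        that is divided out, and the one left for the second integration.\<close>
      define A B e M where "A = (of_nat (2 * Suc i) :: complex)" and "B = (of_nat (2 * k + d + 2 * i) :: complex)"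
        and "e = 2 * Suc i - 1" and "M = 2 * k + m + 1"
      have e: "2 * k + d + 2 * i = M + e"
        using m by (simp add: M_def e_def)
      have A: "A \<noteq> 0"
        unfolding A_def of_nat_eq_0_iff by simp
      have M: "inverse z ^ M * z ^ M = 1"
        by (simp only: power_mult_distrib [symmetric] left_inverse [OF z] power_one)
      have "b i / (A * B) * (A * z ^ e) = b i / B * z ^ e"
        using A by simp
      also have "\<dots> = (inverse z ^ M * z ^ M) * (b i / B * z ^ e)"
        by (simp only: M mult_1)
      also have "\<dots> = inverse z ^ M * (b i / B * z ^ (M + e))"
        by (simp only: power_add mult_ac)
      finally have "b i / (A * B) * (A * z ^ e) = inverse z ^ M * (b i / B * z ^ (2 * k + d + 2 * i))"
        unfolding e .
      then show "b i / (of_nat (2 * Suc i) * of_nat (2 * k + d + 2 * i)) * (of_nat (2 * Suc i) * z ^ (2 * Suc i - 1)) =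
        inverse z ^ (2 * k + m + 1) * (b i / of_nat (2 * k + d + 2 * i) * z ^ (2 * k + d + 2 * i))"
        unfolding A_def B_def e_def M_def .
    qed
    \<comment> \<open>Here the first integration, \<open>W r = 0\<close>, is substituted.\<close>
    also have "(\<Sum>i<n. b i / of_nat (2 * k + d + 2 * i) * z ^ (2 * k + d + 2 * i)) =
      z ^ (k + m + 1) * F1 r - of_nat k * z ^ (k + m) * F r"
      using W0 [of r] r by (simp add: W_def z_def)
    also have "(F r * (- of_nat k * inverse z ^ (k + 1)) + F1 r * inverse (z ^ k))
       - inverse z ^ (2 * k + m + 1) * (z ^ (k + m + 1) * F1 r - of_nat k * z ^ (k + m) * F r) = 0"
      using z by (simp add: field_simps power_add mult_2 mult_2_right)
    finally show ?thesis .
  qed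
  obtain c where c: "\<And>r. r \<in> {0<..<1} \<Longrightarrow> V r = c"
    by (rule has_vector_derivative_zero_constant [of "{0<..<1}" V])
       (use V' in \<open>auto intro: has_vector_derivative_at_within\<close>)
  have "F r = c * of_real r ^ k +
    (\<Sum>i<n. b i / (of_nat (2 * Suc i) * of_nat (2 * k + d + 2 * i)) * of_real r ^ (k + 2 * Suc i))"
    if "0 < r" "r < 1" for r
  proof -
    define D where "D = (\<lambda>i. of_nat (2 * Suc i) * (of_nat (2 * k + d + 2 * i) :: complex))"
    have "V r = F r / of_real r ^ k - (\<Sum>i<n. b i / D i * of_real r ^ (2 * Suc i))"
      by (simp only: V_def D_def)
    moreover have "V r = c" "complex_of_real r ^ k \<noteq> 0"
      using c that by auto
    ultimately have "F r = (c + (\<Sum>i<n. b i / D i * of_real r ^ (2 * Suc i))) * of_real r ^ k"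
      by (simp add: field_simps del: mult_Suc_right power_Suc)
    also have "\<dots> = c * of_real r ^ k + (\<Sum>i<n. b i / D i * of_real r ^ (k + 2 * Suc i))"
      by (simp only: distrib_right sum_distrib_right add.commute [of k] power_add mult.assoc)
    finally show ?thesis
      by (simp only: D_def)
  qed
  then show ?thesis by blast
qed

section \<open>Iterated Laplacians and the radial coefficients\<close>

text \<open>For Y harmonic of degree k, the Laplacian sends r^(k+2m) Y to 2m(2m + 2k + d - 2)
  r^(k+2m-2) Y. The product is the factor that the j-th power of the Laplacian produces on the way
  from m = i + j down to m = i.\<close>

definition laplacian_factor :: "nat \<Rightarrow> nat \<Rightarrow> nat \<Rightarrow> nat \<Rightarrow> real" where
  "laplacian_factor d k j i = (\<Prod>m=Suc i..i + j. real (2 * m) * (2 * real m + 2 * real k + real d - 2))"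

lemma laplacian_factor_0 [simp]: "laplacian_factor d k 0 i = 1"
  by (simp add: laplacian_factor_def)

lemma laplacian_factor_Suc:
  "laplacian_factor d k (Suc j) i = laplacian_factor d k j i *
    (real (2 * Suc (i + j)) * (2 * real (Suc (i + j)) + 2 * real k + real d - 2))"
  unfolding laplacian_factor_def by (simp del: of_nat_mult of_nat_Suc)

text \<open>One step of the descent: the moments of the Laplacian of \<open>f\<close> determine
  those of \<open>f\<close> up to the coefficient of r^k, the part that the Laplacian
  annihilates.\<close>

lemma radial_coeffs_laplacian:
  fixes f :: "'a::euclidean_space \<Rightarrow> complex"
  assumes d: "2 \<le> DIM('a)" and f: "Ck_on 2 (ball 0 1) f" and Y: "Y \<in> harmonic_polys k"
    and G: "\<And>r. 0 < r \<Longrightarrow> r < 1 \<Longrightarrow>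
      (SINT \<theta>. laplacian f (r *\<^sub>R \<theta>) * Y \<theta>) = (\<Sum>i<n. b i * of_real r ^ (k + 2 * i))"
  obtains c where "\<And>r. 0 \<le> r \<Longrightarrow> r < 1 \<Longrightarrow>
      (SINT \<theta>. f (r *\<^sub>R \<theta>) * Y \<theta>) = (\<Sum>i<Suc n. c i * of_real r ^ (k + 2 * i))"
    "\<And>i. i < n \<Longrightarrow> b i = of_real (real (2 * Suc i) * (2 * real (Suc i) + 2 * real k + DIM('a) - 2)) * c (Suc i)"
proof -
  have Yc: "continuous_on S Y" for S
    by (rule continuous_on_polymonial_function [OF harmonic_polysD(1) [OF Y]])
  define F where "F = (\<lambda>r. SINT \<theta>. f (r *\<^sub>R \<theta>) * Y \<theta>)"
  define F1 where "F1 = (\<lambda>r. SINT \<theta>. radial_deriv f r \<theta> * Y \<theta>)"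
  define F2 where "F2 = (\<lambda>r. SINT \<theta>. radial_deriv2 f r \<theta> * Y \<theta>)"
  have F': "(F has_vector_derivative F1 r) (at r)" if "\<bar>r\<bar> < 1" for r
    unfolding F_def F1_def
    by (intro sphere_integral_has_vector_derivative Yc that) (use Ck_on_mono [OF f, of "Suc 0"] in auto)
  have F1': "(F1 has_vector_derivative F2 r) (at r)" if r: "\<bar>r\<bar> < 1" for r
  proof -
    have pC: "Ck_on (Suc 0) (ball 0 1) (partial_deriv b f)" if "b \<in> Basis" for b
      using f that by (simp add: numeral_2_eq_2)
    have c: "continuous_on (sphere 0 1) (\<lambda>\<theta>. h (t *\<^sub>R \<theta>))" if "Ck_on (Suc 0) (ball 0 1) h" "\<bar>t\<bar> < 1"
      for h :: "'a \<Rightarrow> complex" and t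
    proof -
      have "continuous_on (ball 0 1) h" using Ck_on_SucD [OF that(1)] by simp
      then show ?thesis
        by (rule continuous_on_compose2) (use that(2) in \<open>auto intro!: continuous_intros\<close>)
    qed
    have c2: "continuous_on (sphere 0 1) (\<lambda>\<theta>. partial_deriv a (partial_deriv b f) (t *\<^sub>R \<theta>))"
      if "\<bar>t\<bar> < 1" "a \<in> Basis" "b \<in> Basis" for t a b
    proof -
      have "continuous_on (ball 0 1) (partial_deriv a (partial_deriv b f))" using pC that by simp
      then show ?thesis
        by (rule continuous_on_compose2) (use that(1) in \<open>auto intro!: continuous_intros\<close>)
    qed
    \<comment> \<open>To differentiate a second time, \<open>F1\<close> is written through moments
      of the first partial derivatives against the weights
      \<open>(\<theta> \<bullet> b) *\<^sub>R Y \<theta>\<close>, which do not depend on t.\<close>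
    have e1: "F1 t = (\<Sum>b\<in>Basis. (SINT \<theta>. partial_deriv b f (t *\<^sub>R \<theta>) * ((\<theta> \<bullet> b) *\<^sub>R Y \<theta>)))"
      if "\<bar>t\<bar> < 1" for t
    proof -
      have "F1 t = (SINT \<theta>. (\<Sum>b\<in>Basis. partial_deriv b f (t *\<^sub>R \<theta>) * ((\<theta> \<bullet> b) *\<^sub>R Y \<theta>)))"
        unfolding F1_def by (simp add: sum_distrib_right)
      also have "\<dots> = (\<Sum>b\<in>Basis. (SINT \<theta>. partial_deriv b f (t *\<^sub>R \<theta>) * ((\<theta> \<bullet> b) *\<^sub>R Y \<theta>)))"
        by (intro Bochner_Integration.integral_sum integrable_sphere_measure continuous_intros Yc c [OF pC that])
      finally show ?thesis .
    qed
    have "F2 r = (SINT \<theta>. (\<Sum>b\<in>Basis. (\<Sum>a\<in>Basis. (\<theta> \<bullet> a) *\<^sub>R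
        partial_deriv a (partial_deriv b f) (r *\<^sub>R \<theta>)) * ((\<theta> \<bullet> b) *\<^sub>R Y \<theta>)))"
      unfolding F2_def by (simp add: sum_distrib_right)
    also have "\<dots> = (\<Sum>b\<in>Basis. (SINT \<theta>. (\<Sum>a\<in>Basis. (\<theta> \<bullet> a) *\<^sub>R
        partial_deriv a (partial_deriv b f) (r *\<^sub>R \<theta>)) * ((\<theta> \<bullet> b) *\<^sub>R Y \<theta>)))"
      by (intro Bochner_Integration.integral_sum integrable_sphere_measure continuous_intros Yc c2 r)
    finally have e2: "F2 r = \<dots>" .
    have "((\<lambda>t. \<Sum>b\<in>Basis. (SINT \<theta>. partial_deriv b f (t *\<^sub>R \<theta>) * ((\<theta> \<bullet> b) *\<^sub>R Y \<theta>)))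
        has_vector_derivative F2 r) (at r)"
      unfolding e2
      by (intro has_vector_derivative_sum sphere_integral_has_vector_derivative continuous_intros Yc pC r)
    then show ?thesis
      by (rule has_vector_derivative_transform_within_open [of _ _ _ "{-1<..<1}"]) (use r e1 in auto)
  qed
  define L where "L = (\<lambda>r. SINT \<theta>. laplacian f (r *\<^sub>R \<theta>) * Y \<theta>)"
  have ode: "of_real (r * (real DIM('a) - 1)) * F1 r + of_real (r\<^sup>2) * F2 r =
       of_real (real k * (real k + real DIM('a) - 2)) * F r + of_real (r\<^sup>2) * L r"
    and L: "L r = (\<Sum>i<n. b i * of_real r ^ (k + 2 * i))" if "0 < r" "r < 1" for r
    using radial_ode [OF f Y that] G [OF that] by (simp_all only: F_def F1_def F2_def L_def)
  obtain c0 where c0: "\<And>r. 0 < r \<Longrightarrow> r < 1 \<Longrightarrow> F r = c0 * of_real r ^ k +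
    (\<Sum>i<n. b i / (of_nat (2 * Suc i) * of_nat (2 * k + DIM('a) + 2 * i)) * of_real r ^ (k + 2 * Suc i))"
    using euler_ode_solution [OF d F' F1' ode L] by blast
  \<comment> \<open>The entry at 0 is the constant of integration; the others are forced by the
    equation.\<close>
  define c where "c = (\<lambda>i. case i of 0 \<Rightarrow> c0
    | Suc i \<Rightarrow> b i / (of_nat (2 * Suc i) * of_nat (2 * k + DIM('a) + 2 * i)))"
  define P where "P = (\<lambda>r. \<Sum>i<Suc n. c i * complex_of_real r ^ (k + 2 * i))"
  have FP: "F r = P r" if "0 < r" "r < 1" for r
    unfolding P_def by (subst sum.lessThan_Suc_shift) (use c0 [OF that] in \<open>simp add: c_def\<close>)
  \<comment> \<open>So far the formula excludes r = 0. That radius occurs in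
    \<open>almansi_expansion\<close> and yields the central value in the mean value
    property.\<close>
  have const: "F r - P r = F 0 - P 0" if "0 \<le> r" "r < 1" for r
  proof (rule constant_from_0 [OF _ _ that])
    show "continuous_on {0..<1} (\<lambda>r. F r - P r)"
      unfolding P_def
      by (intro continuous_on_diff continuous_at_imp_continuous_on [of _ F] ballI
          has_vector_derivative_continuous [OF F'] continuous_intros) auto
    show "((\<lambda>r. F r - P r) has_vector_derivative 0) (at r)" if "0 < r" "r < 1" for r
      by (rule has_vector_derivative_transform_within_open [where S = "{0<..<1}", OF has_vector_derivative_const [of 0]])
         (use that FP in auto)
  qed
  have "F 0 - P 0 = 0"
    using const [of "1/2"] FP [of "1/2"] by simp
  then have FP: "F r = P r" if "0 \<le> r" "r < 1" for r
    using const [OF that] by simp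
  show thesis
  proof (rule that)
    show "(SINT \<theta>. f (r *\<^sub>R \<theta>) * Y \<theta>) = (\<Sum>i<Suc n. c i * of_real r ^ (k + 2 * i))"
      if "0 \<le> r" "r < 1" for r
      using FP [OF that] by (simp add: F_def P_def)
    show "b i = of_real (real (2 * Suc i) * (2 * real (Suc i) + 2 * real k + DIM('a) - 2)) * c (Suc i)" for i
    proof -
      have "complex_of_real (real (2 * Suc i) * (2 * real (Suc i) + 2 * real k + DIM('a) - 2)) =
          of_nat (2 * Suc i) * of_nat (2 * k + DIM('a) + 2 * i)"
        by (simp add: algebra_simps)
      moreover have "(of_nat (2 * Suc i) :: complex) \<noteq> 0" "(of_nat (2 * k + DIM('a) + 2 * i) :: complex) \<noteq> 0"
        unfolding of_nat_eq_0_iff using d by simp_all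
      ultimately show ?thesis
        unfolding c_def nat.case by (metis mult_eq_0_iff nonzero_mult_div_cancel_left times_divide_eq_right)
    qed
  qed
qed

text \<open>Induction on the order, applied to the Laplacian of \<open>f\<close>; the available
  derivatives \<open>2 * n\<close> decrease by two in step with it. A single family \<open>c\<close>
  serves all j, because the factors of consecutive steps multiply up to
  \<open>laplacian_factor\<close>.\<close>

lemma polyharmonic_radial_coeffs:
  fixes f :: "'a::euclidean_space \<Rightarrow> complex"
  assumes d: "2 \<le> DIM('a)" and Y: "Y \<in> harmonic_polys k" and f: "polyharmonic_on n (ball 0 1) f"
  shows "\<exists>c. \<forall>j\<le>n. \<forall>r. 0 \<le> r \<longrightarrow> r < 1 \<longrightarrow>
    (SINT \<theta>. (laplacian ^^ j) f (r *\<^sub>R \<theta>) * Y \<theta>) =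
    (\<Sum>i<n - j. of_real (laplacian_factor DIM('a) k j i) * c (i + j) * of_real r ^ (k + 2 * i))"
  using f
proof (induction n arbitrary: f)
  case 0
  have "(SINT \<theta>. f (r *\<^sub>R \<theta>) * Y \<theta>) = (SINT \<theta>. (0 :: 'a \<Rightarrow> complex) \<theta>)"
    if "0 \<le> r" "r < 1" for r
    using 0 that by (intro Bochner_Integration.integral_cong)
      (auto simp: polyharmonic_on_def space_sphere_measure)
  then show ?case by auto
next
  case (Suc n)
  have C: "Ck_on (Suc (Suc (2 * n))) (ball 0 1) f" and 0: "\<And>x. x \<in> ball 0 1 \<Longrightarrow> (laplacian ^^ Suc n) f x = 0"
    using Suc.prems by (auto simp: polyharmonic_on_def simp del: Ck_on.simps)
  have f2: "Ck_on 2 (ball 0 1) f"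
    by (rule Ck_on_mono [OF C]) simp
  have "polyharmonic_on n (ball 0 1) (laplacian f)"
    using Ck_on_laplacian [OF open_ball C] 0 by (auto simp: polyharmonic_on_def funpow_swap1)
  from Suc.IH [OF this] obtain c' where c': "\<And>j r. j \<le> n \<Longrightarrow> 0 \<le> r \<Longrightarrow> r < 1 \<Longrightarrow>
    (SINT \<theta>. (laplacian ^^ j) (laplacian f) (r *\<^sub>R \<theta>) * Y \<theta>) =
    (\<Sum>i<n - j. of_real (laplacian_factor DIM('a) k j i) * c' (i + j) * of_real r ^ (k + 2 * i))"
    by blast
  have "(SINT \<theta>. laplacian f (r *\<^sub>R \<theta>) * Y \<theta>) = (\<Sum>i<n. c' i * of_real r ^ (k + 2 * i))"
    if "0 < r" "r < 1" for r
    using c' [of 0 r] that by simp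
  from radial_coeffs_laplacian [OF d f2 Y this] obtain c
    where c: "\<And>r. 0 \<le> r \<Longrightarrow> r < 1 \<Longrightarrow>
      (SINT \<theta>. f (r *\<^sub>R \<theta>) * Y \<theta>) = (\<Sum>i<Suc n. c i * of_real r ^ (k + 2 * i))"
    and cc': "\<And>i. i < n \<Longrightarrow> c' i = of_real (real (2 * Suc i) * (2 * real (Suc i) + 2 * real k + DIM('a) - 2)) * c (Suc i)"
    by blast
  have "(SINT \<theta>. (laplacian ^^ j) f (r *\<^sub>R \<theta>) * Y \<theta>) =
    (\<Sum>i<Suc n - j. of_real (laplacian_factor DIM('a) k j i) * c (i + j) * of_real r ^ (k + 2 * i))"
    if "j \<le> Suc n" "0 \<le> r" "r < 1" for j r
  proof (cases j)
    case 0
    then show ?thesis using c that by simp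
  next
    case (Suc j')
    have "(SINT \<theta>. (laplacian ^^ j) f (r *\<^sub>R \<theta>) * Y \<theta>) =
      (SINT \<theta>. (laplacian ^^ j') (laplacian f) (r *\<^sub>R \<theta>) * Y \<theta>)"
      by (simp add: Suc funpow_swap1)
    also have "\<dots> = (\<Sum>i<n - j'. of_real (laplacian_factor DIM('a) k j' i) * c' (i + j') * of_real r ^ (k + 2 * i))"
      using c' [of j' r] that Suc by simp
    \<comment> \<open>The relation between \<open>c'\<close> and \<open>c\<close> at index i + j'
      contributes the last factor of \<open>laplacian_factor\<close> for j = j' + 1.\<close>
    also have "\<dots> = (\<Sum>i<Suc n - j. of_real (laplacian_factor DIM('a) k j i) * c (i + j) * of_real r ^ (k + 2 * i))"
      using Suc cc' by (intro sum.cong) (auto simp: laplacian_factor_Suc mult_ac)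
    finally show ?thesis .
  qed
  then show ?case by blast
qed

section \<open>Completeness of the spherical harmonics\<close>

definition homogeneous_polys :: "nat \<Rightarrow> ('a::euclidean_space \<Rightarrow> complex) set" where
  "homogeneous_polys n = {p. polynomial_function p \<and> (\<forall>t x. p (t *\<^sub>R x) = of_real t ^ n * p x)}"

lemma homogeneous_polysD:
  fixes p :: "'a::euclidean_space \<Rightarrow> complex" and t :: real
  assumes "p \<in> homogeneous_polys n"
  shows "polynomial_function p" "p (t *\<^sub>R x) = of_real t ^ n * p x"
  using assms by (auto simp: homogeneous_polys_def)

lemma harmonic_polys_eq: "harmonic_polys k = {p \<in> homogeneous_polys k. \<forall>x. laplacian p x = 0}"
  by (auto simp: harmonic_polys_def homogeneous_polys_def)

lemma homogeneous_polys_mult: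
  assumes "p \<in> homogeneous_polys m" "q \<in> homogeneous_polys n"
  shows "(\<lambda>x. p x * q x) \<in> homogeneous_polys (m + n)"
proof -
  have P: "polynomial_function p" "polynomial_function q"
    using assms by (auto simp: homogeneous_polys_def)
  have R: "real_polynomial_function (\<lambda>x. Re (f x))" "real_polynomial_function (\<lambda>x. Im (f x))"
    if "polynomial_function f" for f :: "'a \<Rightarrow> complex"
    using that bounded_linear_Re bounded_linear_Im unfolding polynomial_function_def o_def by blast+
  have "polynomial_function (\<lambda>x. p x * q x)"
    unfolding polynomial_function_iff_Basis_inner
    using R [OF P(1)] R [OF P(2)]
    by (auto simp: Basis_complex_def inner_complex_def simp flip: real_polynomial_function_eq)
  then show ?thesis
    using assms by (auto simp: homogeneous_polys_def power_add mult_ac)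
qed

lemma homogeneous_polys_lincomb:
  assumes "p \<in> homogeneous_polys n" "q \<in> homogeneous_polys n"
  shows "(\<lambda>x. p x + c * q x) \<in> homogeneous_polys n"
proof -
  have "bounded_linear ((*) c)" by (rule bounded_linear_mult_right)
  then have "polynomial_function ((*) c \<circ> q)"
    using assms by (intro polynomial_function_compose [OF _ polynomial_function_bounded_linear])
      (auto simp: homogeneous_polys_def)
  then have "polynomial_function (\<lambda>x. p x + c * q x)"
    using assms by (intro polynomial_function_add) (auto simp: homogeneous_polys_def o_def)
  then show ?thesis
    using assms by (auto simp: homogeneous_polys_def algebra_simps)
qed

lemma homogeneous_polys_const: "(\<lambda>x. c) \<in> homogeneous_polys 0"
  by (auto simp: homogeneous_polys_def)

lemma homogeneous_polys_bounded_linear: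
  assumes "bounded_linear (f :: 'a::euclidean_space \<Rightarrow> real)"
  shows "(\<lambda>x. of_real (f x)) \<in> homogeneous_polys 1"
proof -
  have "bounded_linear (\<lambda>x. complex_of_real (f x))"
    using assms by (rule bounded_linear_compose [OF bounded_linear_of_real])
  then show ?thesis
    using assms by (auto simp: homogeneous_polys_def polynomial_function_bounded_linear linear_simps)
qed

lemma homogeneous_polys_zero: "(\<lambda>x. 0) \<in> homogeneous_polys n"
  by (auto simp: homogeneous_polys_def)

lemma homogeneous_polys_sum:
  "(\<And>i. i \<in> I \<Longrightarrow> f i \<in> homogeneous_polys n) \<Longrightarrow> (\<lambda>x. \<Sum>i\<in>I. f i x) \<in> homogeneous_polys n"
proof (induction I rule: infinite_finite_induct)
  case (insert i I)
  then show ?case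
    using homogeneous_polys_lincomb [of "f i" n "\<lambda>x. \<Sum>i\<in>I. f i x" 1] by simp
qed (auto simp: homogeneous_polys_zero)

lemma homogeneous_polys_inner_self: "(\<lambda>x. of_real (x \<bullet> x)) \<in> homogeneous_polys 2"
proof -
  have "(\<lambda>x. complex_of_real (x \<bullet> x)) = (\<lambda>x. \<Sum>b\<in>Basis. of_real (x \<bullet> b) * of_real (x \<bullet> b))"
    by (rule ext, subst euclidean_inner) simp
  also have "\<dots> \<in> homogeneous_polys (1 + 1)"
    by (intro homogeneous_polys_sum homogeneous_polys_mult homogeneous_polys_bounded_linear bounded_linear_inner_left)
  finally show ?thesis
    by (simp only: one_add_one)
qed

lemma homogeneous_polys_0D: "p \<in> homogeneous_polys 0 \<Longrightarrow> p = (\<lambda>x. p 0)"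
  using homogeneous_polysD(2) [of p 0 0] by (metis (no_types) mult_1 power_0 scaleR_zero_left)

text \<open>The chain rule gives the homogeneity relation multiplied by t, so t can be cancelled
  only when it is nonzero; both sides are continuous in t. Degree 0 is separate, as
  \<open>n - 1\<close> is truncated there and p is constant.\<close>

lemma homogeneous_polys_partial_deriv:
  assumes p: "p \<in> homogeneous_polys n"
  shows "partial_deriv b p \<in> homogeneous_polys (n - 1)"
proof (cases n)
  case 0
  then have "p = (\<lambda>x. p 0)"
    using p homogeneous_polys_0D by blast
  then have "partial_deriv b p = (\<lambda>x. 0)"
    using partial_deriv_const by metis
  then show ?thesis
    using 0 by (simp add: homogeneous_polys_zero)
next
  case (Suc m)
  note P = homogeneous_polysD(1) [OF p]
  note P' = polynomial_function_partial_deriv [OF P]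
  have nz: "partial_deriv b p (t *\<^sub>R x) = of_real t ^ m * partial_deriv b p x" if "t \<noteq> 0" for t x
  proof -
    have d: "(p has_derivative (\<lambda>h. \<Sum>b\<in>Basis. (h \<bullet> b) *\<^sub>R partial_deriv b p y)) (at y)" for y
      by (intro has_derivative_partial_deriv differentiable_at_polynomial_function P)
    have lin: "bounded_linear (\<lambda>h. \<Sum>b\<in>Basis. (h \<bullet> b) *\<^sub>R partial_deriv b p y)" for y
      using d by (rule has_derivative_bounded_linear)
    have e: "partial_deriv b p y = (\<Sum>a\<in>Basis. (b \<bullet> a) *\<^sub>R partial_deriv a p y)" for y
      by (rule partial_deriv_eqI [OF d])
    have "((\<lambda>x. p (t *\<^sub>R x)) has_derivative (\<lambda>h. \<Sum>b\<in>Basis. ((t *\<^sub>R h) \<bullet> b) *\<^sub>R partial_deriv b p (t *\<^sub>R x))) (at x)"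
      by (rule has_derivative_compose [OF _ d]) (auto intro!: derivative_eq_intros)
    then have "partial_deriv b (\<lambda>x. p (t *\<^sub>R x)) x = (\<Sum>a\<in>Basis. ((t *\<^sub>R b) \<bullet> a) *\<^sub>R partial_deriv a p (t *\<^sub>R x))"
      by (rule partial_deriv_eqI)
    also have "\<dots> = of_real t * partial_deriv b p (t *\<^sub>R x)"
      by (subst e) (simp add: sum_distrib_left scaleR_conv_of_real mult_ac)
    finally have "of_real t * partial_deriv b p (t *\<^sub>R x) = partial_deriv b (\<lambda>x. of_real t ^ n * p x) x"
      using homogeneous_polysD(2) [OF p] by simp
    also have "\<dots> = of_real t ^ n * partial_deriv b p x"
      by (rule partial_deriv_bounded_linear [OF bounded_linear_mult_right differentiable_at_polynomial_function [OF P]])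
    finally show ?thesis
      using that Suc by simp
  qed
  have "partial_deriv b p (t *\<^sub>R x) = of_real t ^ m * partial_deriv b p x" for t x
  proof (cases "t = 0")
    case True
    define g where "g = (\<lambda>t. partial_deriv b p (t *\<^sub>R x) - of_real t ^ m * partial_deriv b p x)"
    have "continuous_on UNIV g"
      unfolding g_def
      by (intro continuous_intros continuous_on_compose2 [OF continuous_on_polymonial_function [OF P']]) auto
    then have "(g \<longlongrightarrow> g 0) (at 0)"
      by (simp add: continuous_on_eq_continuous_at isCont_def)
    moreover have "(g \<longlongrightarrow> 0) (at 0)"
      by (intro tendsto_eventually eventually_mono [OF eventually_neq_at_within [of 0]]) (simp add: g_def nz)
    ultimately have "g 0 = 0"
      using tendsto_unique trivial_limit_at by blast
    then show ?thesis using True by (simp add: g_def)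
  qed (rule nz)
  then show ?thesis
    using P' Suc by (simp add: homogeneous_polys_def)
qed

lemma homogeneous_polys_laplacian:
  assumes "p \<in> homogeneous_polys n"
  shows "laplacian p \<in> homogeneous_polys (n - 2)"
  unfolding laplacian_def [abs_def]
  using homogeneous_polys_partial_deriv [OF homogeneous_polys_partial_deriv [OF assms]]
  by (intro homogeneous_polys_sum) (simp add: numeral_2_eq_2)

lemma homogeneous_polys_funpow_laplacian:
  assumes "p \<in> homogeneous_polys n"
  shows "(laplacian ^^ i) p \<in> homogeneous_polys (n - 2 * i)"
proof (induction i)
  case (Suc i)
  have "n - 2 * Suc i = n - 2 * i - 2" by simp
  then show ?case
    using homogeneous_polys_laplacian [OF Suc] by simp
qed (use assms in simp)

lemma laplacian_homogeneous_small:
  assumes "p \<in> homogeneous_polys n" "n < 2"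
  shows "laplacian p = (\<lambda>x. 0)"
proof -
  have "partial_deriv b p \<in> homogeneous_polys 0" for b
    using homogeneous_polys_partial_deriv [OF assms(1), of b] assms(2) by simp
  then have "partial_deriv b p = (\<lambda>x. partial_deriv b p 0)" for b
    by (rule homogeneous_polys_0D)
  then have "partial_deriv a (partial_deriv b p) = (\<lambda>x. 0)" for a b
    using partial_deriv_const [of a "partial_deriv b p 0"] by metis
  then show ?thesis
    by (simp add: laplacian_def fun_eq_iff)
qed

section \<open>Laplacians of powers of |x|^2 times harmonic polynomials\<close>

lemma euler_deriv_homogeneous:
  assumes p: "p \<in> homogeneous_polys n"
  shows "euler_deriv p x = of_nat n * p x"
proof -
  have "((\<lambda>t. p (t *\<^sub>R x)) has_vector_derivative radial_deriv p 1 x) (at 1)"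
    by (intro has_vector_derivative_radial differentiable_at_polynomial_function homogeneous_polysD [OF p])
  moreover have "((\<lambda>t. p (t *\<^sub>R x)) has_vector_derivative of_nat n * of_real 1 ^ (n - 1) * p x) (at 1)"
    unfolding homogeneous_polysD(2) [OF p]
    by (intro has_vector_derivative_mult_left has_vector_derivative_of_real_power)
  ultimately show ?thesis
    using vector_derivative_unique_at by (fastforce simp: euler_deriv_def)
qed

text \<open>The product rule with gradient 2x and Laplacian 2d of |x|^2; the cross term is four
  times the Euler derivative.\<close>

lemma laplacian_inner_self_mult:
  fixes f :: "'a::euclidean_space \<Rightarrow> complex"
  assumes f: "polynomial_function f"
  shows "laplacian (\<lambda>x. of_real (x \<bullet> x) * f x) x =
    of_nat (2 * DIM('a)) * f x + 4 * euler_deriv f x + of_real (x \<bullet> x) * laplacian f x"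
proof -
  have df: "f differentiable at x" "partial_deriv b f differentiable at x" for x b
    by (intro differentiable_at_polynomial_function polynomial_function_partial_deriv f)+
  have pd: "partial_deriv b (\<lambda>x. of_real (x \<bullet> x) * g x) x = of_real (2 * (x \<bullet> b)) * g x + of_real (x \<bullet> x) * partial_deriv b g x"
    if g: "g differentiable at x" for g :: "'a \<Rightarrow> complex" and b x
  proof -
    obtain D where D: "(g has_derivative D) (at x)"
      using g by (auto simp: differentiable_def)
    have "((\<lambda>x. of_real (x \<bullet> x) * g x) has_derivative
      (\<lambda>h. of_real (x \<bullet> x) * D h + of_real (2 * (x \<bullet> h)) * g x)) (at x)"
      by (rule derivative_eq_intros D refl)+ (auto simp: inner_commute)
    then show ?thesis
      by (simp add: partial_deriv_eqI partial_deriv_eqI [OF D])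
  qed
  have d2: "(\<lambda>x. of_real (x \<bullet> b) * f x) differentiable at x" "(\<lambda>x. of_real (x \<bullet> x) * partial_deriv b f x) differentiable at x" for b x
  proof -
    obtain D where D: "(f has_derivative D) (at x)"
      using df(1) [of x] unfolding differentiable_def by blast
    obtain D' where D': "(partial_deriv b f has_derivative D') (at x)"
      using df(2) [of b x] unfolding differentiable_def by blast
    have "((\<lambda>x. of_real (x \<bullet> b) * f x) has_derivative (\<lambda>h. of_real (x \<bullet> b) * D h + of_real (h \<bullet> b) * f x)) (at x)"
      by (rule derivative_eq_intros D refl)+ simp
    then show "(\<lambda>x. of_real (x \<bullet> b) * f x) differentiable at x"
      by (rule differentiableI)
    have "((\<lambda>x. of_real (x \<bullet> x) * partial_deriv b f x) has_derivative
      (\<lambda>h. of_real (x \<bullet> x) * D' h + of_real (2 * (x \<bullet> h)) * partial_deriv b f x)) (at x)"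
      by (rule derivative_eq_intros D' refl)+ (auto simp: inner_commute)
    then show "(\<lambda>x. of_real (x \<bullet> x) * partial_deriv b f x) differentiable at x"
      by (rule differentiableI)
  qed
  have "partial_deriv b (partial_deriv b (\<lambda>x. of_real (x \<bullet> x) * f x)) x =
     2 * f x + 4 * (of_real (x \<bullet> b) * partial_deriv b f x) + of_real (x \<bullet> x) * partial_deriv b (partial_deriv b f) x"
    if "b \<in> Basis" for b
  proof -
    have "partial_deriv b (\<lambda>x. of_real (x \<bullet> x) * f x) =
      (\<lambda>x. 2 *\<^sub>R (of_real (x \<bullet> b) * f x) + of_real (x \<bullet> x) * partial_deriv b f x)"
      using pd [OF df(1)] by (simp add: fun_eq_iff scaleR_conv_of_real)
    then have "partial_deriv b (partial_deriv b (\<lambda>x. of_real (x \<bullet> x) * f x)) x =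
      2 *\<^sub>R partial_deriv b (\<lambda>x. of_real (x \<bullet> b) * f x) x + partial_deriv b (\<lambda>x. of_real (x \<bullet> x) * partial_deriv b f x) x"
      using d2 by (simp add: partial_deriv_add partial_deriv_scaleR derivative_intros)
    moreover have "partial_deriv b (\<lambda>x. of_real (x \<bullet> b) * f x) x = f x + of_real (x \<bullet> b) * partial_deriv b f x"
      using partial_deriv_scaleR_inner [OF df(1), of b b x] that by (simp add: scaleR_conv_of_real)
    ultimately show ?thesis
      using pd [OF df(2)] by (simp add: scaleR_conv_of_real algebra_simps)
  qed
  then show ?thesis
    by (simp add: laplacian_def euler_deriv_def sum.distrib sum_distrib_left scaleR_conv_of_real)
qed

text \<open>The polynomial counterpart of a single factor of \<open>laplacian_factor\<close>, with m
  = i + 1. Induction on i through multiplication by |x|^2.\<close>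

lemma laplacian_power_mult_harmonic:
  fixes g :: "'a::euclidean_space \<Rightarrow> complex"
  assumes g: "g \<in> harmonic_polys e"
  shows "(\<lambda>x. of_real (x \<bullet> x) ^ i * g x) \<in> homogeneous_polys (2 * i + e)"
    and "laplacian (\<lambda>x. of_real (x \<bullet> x) ^ Suc i * g x) =
     (\<lambda>x. of_nat (2 * Suc i * (2 * i + 2 * e + DIM('a))) * (of_real (x \<bullet> x) ^ i * g x))"
proof -
  have hom: "(\<lambda>x. of_real (x \<bullet> x) ^ i * g x) \<in> homogeneous_polys (2 * i + e)" for i
  proof (induction i)
    case 0
    then show ?case using g by (simp add: harmonic_polys_eq)
  next
    case (Suc i)
    then show ?case
      using homogeneous_polys_mult [OF homogeneous_polys_inner_self Suc] by (simp add: mult_ac add_ac)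
  qed
  then show "(\<lambda>x. of_real (x \<bullet> x) ^ i * g x) \<in> homogeneous_polys (2 * i + e)" .
  show "laplacian (\<lambda>x. of_real (x \<bullet> x) ^ Suc i * g x) =
     (\<lambda>x. of_nat (2 * Suc i * (2 * i + 2 * e + DIM('a))) * (of_real (x \<bullet> x) ^ i * g x))"
  proof (induction i)
    case 0
    show ?case
      using laplacian_inner_self_mult [OF homogeneous_polysD(1) [OF hom [of 0]]]
        euler_deriv_homogeneous [OF hom [of 0]] harmonic_polysD(3) [OF g]
      by (simp add: fun_eq_iff algebra_simps)
  next
    case (Suc i)
    have "laplacian (\<lambda>x. of_real (x \<bullet> x) * (of_real (x \<bullet> x) ^ Suc i * g x)) x =
      of_nat (2 * DIM('a)) * (of_real (x \<bullet> x) ^ Suc i * g x) + 4 * (of_nat (2 * Suc i + e) * (of_real (x \<bullet> x) ^ Suc i * g x))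
      + of_real (x \<bullet> x) * (of_nat (2 * Suc i * (2 * i + 2 * e + DIM('a))) * (of_real (x \<bullet> x) ^ i * g x))" for x
      unfolding laplacian_inner_self_mult [OF homogeneous_polysD(1) [OF hom [of "Suc i"]]]
        euler_deriv_homogeneous [OF hom [of "Suc i"]] Suc.IH ..
    then show ?case
      by (simp add: fun_eq_iff algebra_simps)
  qed
qed

lemma polynomial_function_funpow_laplacian:
  fixes f :: "'a::euclidean_space \<Rightarrow> complex"
  shows "polynomial_function f \<Longrightarrow> polynomial_function ((laplacian ^^ m) f)"
  by (induction m) (auto intro: polynomial_function_laplacian)

lemma funpow_laplacian_lincomb:
  fixes f g :: "'a::euclidean_space \<Rightarrow> complex"
  assumes "polynomial_function f" "polynomial_function g"
  shows "(laplacian ^^ m) (\<lambda>x. f x + c * g x) = (\<lambda>x. (laplacian ^^ m) f x + c * (laplacian ^^ m) g x)"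
  by (induction m)
     (use assms in \<open>simp_all add: laplacian_lincomb polynomial_function_funpow_laplacian\<close>)

lemma laplacian_zero: "laplacian (\<lambda>x. 0) = (\<lambda>x. 0)"
  by (simp add: laplacian_def partial_deriv_const fun_eq_iff)

lemma funpow_laplacian_zero: "(laplacian ^^ m) (\<lambda>x. 0) = (\<lambda>x. 0)"
  by (induction m) (auto simp: laplacian_zero)

text \<open>All factors met in the iteration are positive natural numbers, so the constant can be
  divided out when powers of |x|^2 are split off.\<close>

lemma funpow_laplacian_power_mult_harmonic:
  fixes g :: "'a::euclidean_space \<Rightarrow> complex"
  assumes g: "g \<in> harmonic_polys e"
  shows "\<exists>c. c \<noteq> 0 \<and> (laplacian ^^ m) (\<lambda>x. of_real (x \<bullet> x) ^ m * g x) = (\<lambda>x. c * g x)"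
proof (induction m)
  case 0
  then show ?case by (intro exI [of _ 1]) auto
next
  case (Suc m)
  then obtain c where c: "c \<noteq> 0" "(laplacian ^^ m) (\<lambda>x. of_real (x \<bullet> x) ^ m * g x) = (\<lambda>x. c * g x)"
    by blast
  define a where "a = complex_of_nat (2 * Suc m * (2 * m + 2 * e + DIM('a)))"
  have "a \<noteq> 0" unfolding a_def of_nat_eq_0_iff by simp
  have "(laplacian ^^ Suc m) (\<lambda>x. of_real (x \<bullet> x) ^ Suc m * g x) =
    (laplacian ^^ m) (\<lambda>x. 0 + a * (of_real (x \<bullet> x) ^ m * g x))"
    by (simp only: funpow_Suc_right o_def laplacian_power_mult_harmonic(2) [OF g] a_def add_0)
  also have "\<dots> = (\<lambda>x. 0 + a * (c * g x))"
    using homogeneous_polysD(1) [OF laplacian_power_mult_harmonic(1) [OF g]]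
    by (subst funpow_laplacian_lincomb) (auto simp: c funpow_laplacian_zero)
  finally show ?case
    using \<open>a \<noteq> 0\<close> \<open>c \<noteq> 0\<close> by (intro exI [of _ "a * c"]) (auto simp: mult_ac)
qed

text \<open>On the sphere, \<open>p - |x|\<^sup>2\<^sup>m \<Delta>\<^sup>m p / c\<close> is polyharmonic of lower order and
  \<open>|x|\<^sup>2\<^sup>m \<Delta>\<^sup>m p\<close> agrees with a harmonic polynomial, so \<open>p\<close> can be decomposed by
  induction on its polyharmonic order.\<close>

lemma integral_homogeneous_eq_0:
  fixes f :: "'a::euclidean_space \<Rightarrow> complex"
  assumes f: "continuous_on (sphere 0 1) f"
    and harm: "\<And>k h. h \<in> harmonic_polys k \<Longrightarrow> (SINT \<theta>. f \<theta> * h \<theta>) = 0"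
    and p: "p \<in> homogeneous_polys n"
  shows "(SINT \<theta>. f \<theta> * p \<theta>) = 0"
proof -
  have int: "integrable sphere_measure (\<lambda>\<theta>. f \<theta> * q \<theta>)" if "polynomial_function q" for q
    by (intro integrable_sphere_measure continuous_intros f continuous_on_polymonial_function that)
  \<comment> \<open>The bound on m becomes 2m <= n in the induction step for m + 1, so
    \<open>n - 2 * m\<close> is a true difference there and |x|^(2m) g has degree n again.\<close>
  have "(SINT \<theta>. f \<theta> * p \<theta>) = 0"
    if "p \<in> homogeneous_polys n" "2 * m \<le> n + 2" "(laplacian ^^ m) p = (\<lambda>x. 0)" for m p
    using that
  proof (induction m arbitrary: p)
    case 0
    then show ?case by simp
  next
    case (Suc m)
    define g where "g = (laplacian ^^ m) p"
    have g: "g \<in> harmonic_polys (n - 2 * m)"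
      using homogeneous_polys_funpow_laplacian [OF Suc.prems(1)] Suc.prems(3)
      by (auto simp: harmonic_polys_eq g_def)
    obtain c where c: "c \<noteq> 0" "(laplacian ^^ m) (\<lambda>x. of_real (x \<bullet> x) ^ m * g x) = (\<lambda>x. c * g x)"
      using funpow_laplacian_power_mult_harmonic [OF g] by blast
    have q: "(\<lambda>x. of_real (x \<bullet> x) ^ m * g x) \<in> homogeneous_polys n"
      using laplacian_power_mult_harmonic(1) [OF g, of m] Suc.prems(2) by simp
    define p' where "p' = (\<lambda>x. p x + (- 1 / c) * (of_real (x \<bullet> x) ^ m * g x))"
    have p': "p' \<in> homogeneous_polys n"
      unfolding p'_def by (intro homogeneous_polys_lincomb Suc.prems(1) q)
    have "(laplacian ^^ m) p' = (\<lambda>x. 0)"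
      unfolding p'_def funpow_laplacian_lincomb [OF homogeneous_polysD(1) [OF Suc.prems(1)] homogeneous_polysD(1) [OF q]] c
      using c(1) by (simp add: g_def)
    then have "(SINT \<theta>. f \<theta> * p' \<theta>) = 0"
      using Suc.IH [OF p'] Suc.prems(2) by simp
    \<comment> \<open>On the sphere |x|^2 = 1, so the part split off from p is the harmonic
      polynomial g / c.\<close>
    moreover have "(SINT \<theta>. f \<theta> * p \<theta>) =
      (SINT \<theta>. f \<theta> * p' \<theta> + (1 / c) * (f \<theta> * g \<theta>))"
      by (intro Bochner_Integration.integral_cong refl)
         (use c(1) in \<open>simp add: p'_def space_sphere_measure norm_eq_1 algebra_simps\<close>)
    moreover have "\<dots> = (SINT \<theta>. f \<theta> * p' \<theta>) + (1 / c) * (SINT \<theta>. f \<theta> * g \<theta>)"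
      using int [OF homogeneous_polysD(1) [OF p']] int [OF harmonic_polysD(1) [OF g]]
      by simp
    ultimately show ?case
      using harm [OF g] by simp
  qed
  \<comment> \<open>After n div 2 Laplacians the degree is 0 or 1, and one more gives zero.\<close>
  moreover have "(laplacian ^^ Suc (n div 2)) p = (\<lambda>x. 0)"
    using laplacian_homogeneous_small [OF homogeneous_polys_funpow_laplacian [OF p, of "n div 2"]]
    by simp
  ultimately show ?thesis
    using p by (metis add_le_mono1 mult_Suc_right add.commute times_div_less_eq_dividend)
qed

text \<open>Polynomials are handled through their inductive generation: if f is orthogonal to all
  homogeneous polynomials, so is f * r. Linear functions and constants are homogeneous and are
  absorbed into the test polynomial; for products, f is replaced by f * r1, so f is kept arbitrary
  in the induction.\<close>

lemma integral_polynomial_eq_0: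
  fixes f :: "'a::euclidean_space \<Rightarrow> complex"
  assumes f: "continuous_on (sphere 0 1) f"
    and harm: "\<And>k h. h \<in> harmonic_polys k \<Longrightarrow> (SINT \<theta>. f \<theta> * h \<theta>) = 0"
    and p: "polynomial_function p"
  shows "(SINT \<theta>. f \<theta> * p \<theta>) = 0"
proof -
  have rc: "continuous_on S (\<lambda>x. complex_of_real (r x))" if "real_polynomial_function r" for S and r :: "'a \<Rightarrow> real"
    using that by (intro continuous_intros continuous_on_polymonial_function) (simp add: real_polynomial_function_eq)
  have orth: "(SINT \<theta>. (f \<theta> * of_real (r \<theta>)) * q \<theta>) = 0"
    if "real_polynomial_function r" "continuous_on (sphere 0 1) f" "q \<in> homogeneous_polys n"
      "\<And>n q. q \<in> homogeneous_polys n \<Longrightarrow> (SINT \<theta>. f \<theta> * q \<theta>) = 0"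
    for r f n and q :: "'a \<Rightarrow> complex"
    using that
  proof (induction r arbitrary: f n q)
    case (linear r)
    then have "(SINT \<theta>. f \<theta> * (of_real (r \<theta>) * q \<theta>)) = 0"
      using homogeneous_polys_mult [OF homogeneous_polys_bounded_linear] by blast
    then show ?case by (simp add: mult_ac)
  next
    case (const c)
    then have "(SINT \<theta>. f \<theta> * (of_real c * q \<theta>)) = 0"
      using homogeneous_polys_mult [OF homogeneous_polys_const] by blast
    then show ?case by (simp add: mult_ac)
  next
    case (add r1 r2)
    have int: "integrable sphere_measure (\<lambda>\<theta>. (f \<theta> * of_real (r \<theta>)) * q \<theta>)"
      if "real_polynomial_function r" for r
      by (intro integrable_sphere_measure continuous_on_mult add.prems rc that
          continuous_on_polymonial_function homogeneous_polysD(1) [OF add.prems(2)])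
    have "integrable sphere_measure (\<lambda>\<theta>. (f \<theta> * of_real (r1 \<theta>)) * q \<theta>)"
      "integrable sphere_measure (\<lambda>\<theta>. (f \<theta> * of_real (r2 \<theta>)) * q \<theta>)"
      by (intro int add.hyps)+
    moreover have "(SINT \<theta>. (f \<theta> * of_real (r1 \<theta>)) * q \<theta>) = 0"
      "(SINT \<theta>. (f \<theta> * of_real (r2 \<theta>)) * q \<theta>) = 0"
      using add.IH add.prems by blast+
    ultimately show ?case
      by (simp add: algebra_simps)
  next
    case (mult r1 r2)
    have "(SINT \<theta>. ((f \<theta> * of_real (r1 \<theta>)) * of_real (r2 \<theta>)) * q \<theta>) = 0"
    proof (rule mult.IH(2))
      show "continuous_on (sphere 0 1) (\<lambda>x. f x * complex_of_real (r1 x))"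
        using mult.prems mult.hyps by (intro continuous_intros rc)
      show "(SINT \<theta>. (f \<theta> * of_real (r1 \<theta>)) * q \<theta>) = 0"
        if "q \<in> homogeneous_polys n" for n q
        using mult.IH(1) [OF mult.prems(1) that mult.prems(3)] .
    qed (use mult.prems in auto)
    then show ?case by (simp add: mult_ac)
  qed
  have R: "real_polynomial_function (\<lambda>x. Re (p x))" "real_polynomial_function (\<lambda>x. Im (p x))"
    using p bounded_linear_Re bounded_linear_Im unfolding polynomial_function_def o_def by blast+
  have 0: "(SINT \<theta>. f \<theta> * of_real (r \<theta>)) = 0" if "real_polynomial_function r" for r
    using orth [OF that f homogeneous_polys_const [of 1] integral_homogeneous_eq_0 [OF f harm]] by simp
  have "(SINT \<theta>. f \<theta> * p \<theta>) =
    (SINT \<theta>. f \<theta> * of_real (Re (p \<theta>)) + \<i> * (f \<theta> * of_real (Im (p \<theta>))))"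
    by (intro Bochner_Integration.integral_cong refl) (subst complex_eq, simp add: algebra_simps)
  also have "\<dots> = 0"
    using 0 [OF R(1)] 0 [OF R(2)]
    by (subst Bochner_Integration.integral_add)
       (auto intro!: integrable_sphere_measure continuous_on_mult f rc R continuous_on_const)
  finally show ?thesis .
qed

text \<open>If a polynomial p approximates the conjugate of f up to e, then orthogonality to p turns
  the integral of |f|^2 into that of f (cnj f - p), at most e times the integral of |f|.\<close>

lemma sphere_harmonics_complete:
  fixes f :: "'a::euclidean_space \<Rightarrow> complex"
  assumes f: "continuous_on (sphere 0 1) f"
    and harm: "\<And>k h. h \<in> harmonic_polys k \<Longrightarrow> (SINT \<theta>. f \<theta> * h \<theta>) = 0"
    and z: "z \<in> sphere 0 1"
  shows "f z = 0"
proof -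
  let ?C = "SINT \<theta>. norm (f \<theta>)" and ?I = "SINT \<theta>. (norm (f \<theta>))\<^sup>2"
  have fi: "integrable sphere_measure (\<lambda>\<theta>. norm (f \<theta>))"
    by (intro integrable_sphere_measure continuous_intros f)
  have bound: "?I \<le> e * ?C" if e: "e > 0" for e
  proof -
    have "continuous_on (sphere 0 1) (\<lambda>x. cnj (f x))"
      by (intro continuous_intros f)
    then obtain p where p: "polynomial_function p" "\<And>x. x \<in> sphere 0 1 \<Longrightarrow> norm (cnj (f x) - p x) < e"
      using Stone_Weierstrass_polynomial_function [OF compact_sphere _ e] by metis
    have pc: "continuous_on (sphere 0 1) p"
      by (rule continuous_on_polymonial_function [OF p(1)])
    have "complex_of_real ?I = (SINT \<theta>. f \<theta> * cnj (f \<theta>))"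
      by (simp add: complex_norm_square [symmetric] flip: integral_complex_of_real of_real_power)
    also have "\<dots> = (SINT \<theta>. f \<theta> * (cnj (f \<theta>) - p \<theta>) + f \<theta> * p \<theta>)"
      by (simp add: algebra_simps)
    also have "\<dots> = (SINT \<theta>. f \<theta> * (cnj (f \<theta>) - p \<theta>)) + 0"
      using integral_polynomial_eq_0 [OF f harm p(1)]
      by (subst Bochner_Integration.integral_add)
         (auto intro!: integrable_sphere_measure continuous_intros f pc)
    finally have "norm (complex_of_real ?I) \<le> (SINT \<theta>. norm (f \<theta> * (cnj (f \<theta>) - p \<theta>)))"
      by (metis add.right_neutral integral_norm_bound)
    also have "\<dots> \<le> (SINT \<theta>. e * norm (f \<theta>))"
      by (intro integral_mono integrable_sphere_measure continuous_intros f pc)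
         (simp add: norm_mult space_sphere_measure mult.commute [of e] mult_left_mono less_imp_le p(2))
    finally show ?thesis by simp
  qed
  have "?I \<le> 0"
  proof (rule field_le_epsilon)
    fix e :: real assume "e > 0"
    have C: "0 \<le> ?C" by simp
    then have C1: "0 < ?C + 1" by linarith
    have "?I \<le> e / (?C + 1) * ?C"
      by (rule bound [OF divide_pos_pos [OF \<open>e > 0\<close> C1]])
    also have "\<dots> \<le> e"
      using \<open>e > 0\<close> C C1 by (simp add: pos_divide_le_eq)
    finally show "?I \<le> 0 + e" by simp
  qed
  then have "?I = 0"
    by (intro antisym) auto
  then have "(norm (f z))\<^sup>2 = 0"
    using z by (intro sphere_integral_nonneg_eq_0D [where f = "\<lambda>x. (norm (f x))\<^sup>2"]) (auto intro!: continuous_intros f)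
  then show ?thesis by simp
qed

section \<open>A pointwise bound for spherical harmonics\<close>

lemma measure_sphere_measure_pos: "0 < measure (sphere_measure :: 'a::euclidean_space measure) (sphere 0 1)"
proof -
  obtain z :: 'a where z: "z \<in> sphere 0 1"
    using nonempty_Basis norm_Basis by (metis all_not_in_conv mem_sphere_0)
  have "(LINT x|(sphere_measure :: 'a measure). (1::real)) \<noteq> 0"
    using sphere_integral_nonneg_eq_0D [of "\<lambda>_. 1" z] z by auto
  then show ?thesis
    using measure_nonneg [of sphere_measure "sphere (0::'a) 1"]
    by (simp add: space_sphere_measure order_less_le)
qed

text \<open>The radial formula with k = 0 and order 1: the moment of a harmonic function against the
  constant 1 has the single term c 0, so it does not depend on the radius. Radius 0 gives its
  value.\<close>

lemma harmonic_mean_value: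
  fixes p :: "'a::euclidean_space \<Rightarrow> complex"
  assumes d: "2 \<le> DIM('a)" and p: "polynomial_function p" "\<And>x. laplacian p x = 0" and r: "0 \<le> r" "r < 1"
  shows "(SINT \<theta>. p (a + r *\<^sub>R \<theta>)) = of_real (measure sphere_measure (sphere (0::'a) 1)) * p a"
proof -
  have one: "(\<lambda>x::'a. 1) \<in> harmonic_polys 0"
    by (simp add: harmonic_polys_def laplacian_def partial_deriv_const)
  have "polynomial_function (p \<circ> (\<lambda>x. a + x))"
    using p(1) by (intro polynomial_function_compose polynomial_function_add) auto
  then have "polyharmonic_on 1 (ball 0 1) (\<lambda>x. p (a + x))"
    using p(2) by (auto simp: polyharmonic_on_def o_def laplacian_shift intro: Ck_on_polynomial_function)
  from polyharmonic_radial_coeffs [OF d one this] obtain c where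
    "\<And>r. 0 \<le> r \<Longrightarrow> r < 1 \<Longrightarrow> (SINT \<theta>::'a. p (a + r *\<^sub>R \<theta>)) = c (0::nat)"
    by fastforce
  from this [OF r] this [of 0] show ?thesis
    by (simp add: space_sphere_measure scaleR_conv_of_real)
qed

text \<open>Subharmonicity of |p|^2: expand the nonnegative integral of |p(a + r theta) - p(a)|^2
  and evaluate the cross term by the mean value property.\<close>

lemma harmonic_mean_value_square:
  fixes p :: "'a::euclidean_space \<Rightarrow> complex"
  assumes d: "2 \<le> DIM('a)" and p: "polynomial_function p" "\<And>x. laplacian p x = 0" and r: "0 \<le> r" "r < 1"
  shows "measure sphere_measure (sphere (0::'a) 1) * (norm (p a))\<^sup>2 \<le>
    (SINT \<theta>. (norm (p (a + r *\<^sub>R \<theta>)))\<^sup>2)"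
proof -
  let ?A = "measure sphere_measure (sphere (0::'a) 1)" and ?w = "\<lambda>\<theta>. p (a + r *\<^sub>R \<theta>)"
  have c: "continuous_on S ?w" for S
    by (rule continuous_on_compose2 [OF continuous_on_polymonial_function [OF p(1), of UNIV]])
       (auto intro!: continuous_intros)
  define R where "R = (\<lambda>\<theta>. Re (cnj (p a) * ?w \<theta>))"
  have i: "integrable sphere_measure (\<lambda>\<theta>. (norm (?w \<theta>))\<^sup>2)" "integrable sphere_measure R"
    unfolding R_def by (intro integrable_sphere_measure continuous_intros c)+
  have "0 \<le> (SINT \<theta>. (norm (?w \<theta> - p a))\<^sup>2)"
    by (rule Bochner_Integration.integral_nonneg) simp
  also have "\<dots> = (SINT \<theta>. ((norm (?w \<theta>))\<^sup>2 + (norm (p a))\<^sup>2) - 2 * R \<theta>)"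
    unfolding R_def by (intro Bochner_Integration.integral_cong refl)
       (simp only: cmod_power2, simp add: power2_eq_square algebra_simps)
  also have "\<dots> = (SINT \<theta>. (norm (?w \<theta>))\<^sup>2) + ?A * (norm (p a))\<^sup>2
      - 2 * (SINT \<theta>. R \<theta>)"
    using i by (simp add: space_sphere_measure)
  also have "(SINT \<theta>. R \<theta>) = Re (SINT \<theta>. cnj (p a) * ?w \<theta>)"
    unfolding R_def by (intro integral_Re integrable_sphere_measure continuous_intros c)
  also have "(SINT \<theta>. cnj (p a) * ?w \<theta>) = cnj (p a) * (of_real ?A * p a)"
    by (simp only: integral_mult_right_zero harmonic_mean_value [OF d p r])
  also have "Re (cnj (p a) * (of_real ?A * p a)) = ?A * (norm (p a))\<^sup>2"
    by (simp only: cmod_power2, simp add: power2_eq_square algebra_simps)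
  finally show ?thesis by simp
qed

section \<open>Affine substitutions and polar coordinates\<close>

lemma nn_integral_affine:
  fixes g :: "'a::euclidean_space \<Rightarrow> ennreal"
  assumes [measurable]: "g \<in> borel_measurable borel" and c: "c \<noteq> 0"
  shows "(\<integral>\<^sup>+x. g x \<partial>lborel) = ennreal (\<bar>c\<bar> ^ DIM('a)) * (\<integral>\<^sup>+x. g (t + c *\<^sub>R x) \<partial>lborel)"
  by (subst lborel_affine [OF c, of t])
     (simp add: nn_integral_density nn_integral_distr nn_integral_cmult)

lemma nn_integral_affine':
  fixes g :: "'a::euclidean_space \<Rightarrow> ennreal"
  assumes [measurable]: "g \<in> borel_measurable borel" and c: "0 < c"
  shows "(\<integral>\<^sup>+x. g (t + c *\<^sub>R x) \<partial>lborel) = ennreal (1 / c ^ DIM('a)) * (\<integral>\<^sup>+x. g x \<partial>lborel)"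
proof -
  have "ennreal (1 / c ^ DIM('a)) * ennreal (\<bar>c\<bar> ^ DIM('a)) = 1"
    using c by (simp flip: ennreal_mult)
  then show ?thesis
    using c by (subst nn_integral_affine [of g c t]) (auto simp: mult.assoc [symmetric])
qed

text \<open>Integration in polar coordinates, as an inequality. Substituting \<open>\<rho> = s |x|\<close> in the integral of
  \<open>f (\<rho> x / |x|)\<close> over \<open>\<rho>\<close> and then \<open>y = s x\<close> avoids constructing the polar product measure.\<close>

lemma nn_integral_shell_le:
  fixes f :: "'a::euclidean_space \<Rightarrow> ennreal"
  assumes f [measurable]: "f \<in> borel_measurable borel"
  shows "(\<integral>\<^sup>+r. (\<integral>\<^sup>+\<theta>. f (r *\<^sub>R \<theta>) \<partial>sphere_measure) * indicator {1/2<..<1} r \<partial>lborel) \<le>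
    ennreal (2 ^ DIM('a)) * (\<integral>\<^sup>+y. f y * indicator (ball 0 1 - {0}) y \<partial>lborel)"
proof -
  let ?d = "DIM('a)" and ?B = "ball 0 1 - {0 :: 'a}" and ?J = "{1/2<..<1::real}"
  let ?I = "\<integral>\<^sup>+y. f y * indicator ?B y \<partial>lborel"
  have [measurable]: "ball 0 1 \<in> sets (borel :: 'a measure)" "{0} \<in> sets (borel :: 'a measure)"
    by auto
  have sgn [measurable]: "sgn \<in> borel_measurable (borel :: 'a measure)"
    unfolding sgn_div_norm [abs_def] by measurable
  have "(\<integral>\<^sup>+r. (\<integral>\<^sup>+\<theta>. f (r *\<^sub>R \<theta>) \<partial>sphere_measure) * indicator ?J r \<partial>lborel) =
      (\<integral>\<^sup>+r. ?d * (\<integral>\<^sup>+x. f (r *\<^sub>R sgn x) * indicator ?B x * indicator ?J r \<partial>lborel) \<partial>lborel)"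
  proof (rule nn_integral_cong)
    fix r :: real
    have [measurable]: "(\<lambda>x. f (r *\<^sub>R x)) \<in> borel_measurable borel" by measurable
    have "(\<integral>\<^sup>+x. f (r *\<^sub>R sgn x) * indicator ?B x * indicator ?J r \<partial>lborel) =
        (\<integral>\<^sup>+x. f (r *\<^sub>R sgn x) * indicator ?B x \<partial>lborel) * indicator ?J r"
      by (rule nn_integral_multc) measurable
    then show "(\<integral>\<^sup>+\<theta>. f (r *\<^sub>R \<theta>) \<partial>sphere_measure) * indicator ?J r =
      ?d * (\<integral>\<^sup>+x. f (r *\<^sub>R sgn x) * indicator ?B x * indicator ?J r \<partial>lborel)"
      by (subst nn_integral_sphere_measure) (simp_all add: mult.assoc)
  qed
  also have "\<dots> = ?d * (\<integral>\<^sup>+r. (\<integral>\<^sup>+x. f (r *\<^sub>R sgn x) * indicator ?B x * indicator ?J r \<partial>lborel) \<partial>lborel)"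
    by (rule nn_integral_cmult) measurable
  also have "(\<integral>\<^sup>+r. (\<integral>\<^sup>+x. f (r *\<^sub>R sgn x) * indicator ?B x * indicator ?J r \<partial>lborel) \<partial>lborel) =
      (\<integral>\<^sup>+x. (\<integral>\<^sup>+r. f (r *\<^sub>R sgn x) * indicator ?B x * indicator ?J r \<partial>lborel) \<partial>lborel)"
    by (rule lborel_pair.Fubini') measurable
  also have "\<dots> = (\<integral>\<^sup>+x. (\<integral>\<^sup>+s. f (s *\<^sub>R x) * indicator ?B x * indicator ?J (s * norm x) * ennreal (norm x) \<partial>lborel) \<partial>lborel)"
  proof (rule nn_integral_cong)
    fix x :: 'a
    show "(\<integral>\<^sup>+r. f (r *\<^sub>R sgn x) * indicator ?B x * indicator ?J r \<partial>lborel) =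
      (\<integral>\<^sup>+s. f (s *\<^sub>R x) * indicator ?B x * indicator ?J (s * norm x) * ennreal (norm x) \<partial>lborel)"
    proof (cases "x = 0")
      case False
      have e: "(norm x * s) *\<^sub>R sgn x = s *\<^sub>R x" for s
        using False by (simp add: sgn_div_norm)
      have e': "(s * norm x) *\<^sub>R sgn x = s *\<^sub>R x" for s
        using e [of s] by (simp only: mult.commute)
      have "(\<integral>\<^sup>+r. f (r *\<^sub>R sgn x) * indicator ?B x * indicator ?J r \<partial>lborel) =
        ennreal (norm x) * (\<integral>\<^sup>+s. f (s *\<^sub>R x) * indicator ?B x * indicator ?J (s * norm x) \<partial>lborel)"
        using False by (subst nn_integral_real_affine [where c = "norm x" and t = 0]) (auto simp: e e' mult.commute)
      also have "\<dots> = (\<integral>\<^sup>+s. ennreal (norm x) * (f (s *\<^sub>R x) * indicator ?B x * indicator ?J (s * norm x)) \<partial>lborel)"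
        by (rule nn_integral_cmult [symmetric]) measurable
      finally show ?thesis by (simp add: mult_ac)
    qed simp
  qed
  also have "\<dots> = (\<integral>\<^sup>+s. (\<integral>\<^sup>+x. f (s *\<^sub>R x) * indicator ?B x * indicator ?J (s * norm x) * ennreal (norm x) \<partial>lborel) \<partial>lborel)"
    by (rule lborel_pair.Fubini' [symmetric]) measurable
  \<comment> \<open>From |x| < 1 and s|x| > 1/2 follows s > 1/2; from s|x| < 1 follow |x| < 1/s and
    that s x is in the ball. The substitution y = s x supplies the remaining s^(-d).\<close>
  also have "\<dots> \<le> (\<integral>\<^sup>+s. ?I * (ennreal (1 / s ^ Suc ?d) * indicator {1/2..} s) \<partial>lborel)"
  proof (rule nn_integral_mono)
    fix s :: real
    show "(\<integral>\<^sup>+x. f (s *\<^sub>R x) * indicator ?B x * indicator ?J (s * norm x) * ennreal (norm x) \<partial>lborel)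
      \<le> ?I * (ennreal (1 / s ^ Suc ?d) * indicator {1/2..} s)"
    proof (cases "1 / 2 \<le> s")
      case True
      have "(\<integral>\<^sup>+x. f (s *\<^sub>R x) * indicator ?B x * indicator ?J (s * norm x) * ennreal (norm x) \<partial>lborel)
        \<le> (\<integral>\<^sup>+x. ennreal (1 / s) * (f (0 + s *\<^sub>R x) * indicator ?B (0 + s *\<^sub>R x)) \<partial>lborel)"
      proof (rule nn_integral_mono)
        fix x :: 'a
        show "f (s *\<^sub>R x) * indicator ?B x * indicator ?J (s * norm x) * ennreal (norm x)
          \<le> ennreal (1 / s) * (f (0 + s *\<^sub>R x) * indicator ?B (0 + s *\<^sub>R x))"
        proof (cases "x \<in> ?B \<and> s * norm x \<in> ?J")
          case C: True
          then have "norm x \<le> 1 / s" "s *\<^sub>R x \<in> ?B"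
            using True by (auto simp: field_simps)
          then have "f (s *\<^sub>R x) * ennreal (norm x) \<le> f (s *\<^sub>R x) * ennreal (1 / s)"
            by (intro mult_left_mono ennreal_leI) auto
          then show ?thesis
            using C \<open>s *\<^sub>R x \<in> ?B\<close> by (simp add: mult.commute)
        qed (auto simp: indicator_def)
      qed
      also have "\<dots> = ennreal (1 / s) * (ennreal (1 / s ^ ?d) * ?I)"
        using True by (subst nn_integral_cmult, measurable) (subst nn_integral_affine' [where g = "\<lambda>y. f y * indicator ?B y"], auto)
      also have "\<dots> = ?I * (ennreal (1 / s ^ Suc ?d) * indicator {1/2..} s)"
        using True by (simp add: mult.assoc [symmetric] mult.commute flip: ennreal_mult)
      finally show ?thesis .
    next
      case False
      have "indicator ?B x * indicator ?J (s * norm x) = (0 :: ennreal)" for x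
      proof -
        have "s * norm x \<le> 1 / 2" if "norm x < 1"
        proof (cases "0 \<le> s")
          case True
          then have "s * norm x \<le> s * 1" using that by (intro mult_left_mono) auto
          then show ?thesis using False by linarith
        next
          case F: False
          then have "s * norm x \<le> 0" by (simp add: mult_le_0_iff)
          then show ?thesis by linarith
        qed
        then show ?thesis by (auto simp: indicator_def)
      qed
      then have "f (s *\<^sub>R x) * indicator ?B x * indicator ?J (s * norm x) * ennreal (norm x) = 0" for x
        by (metis mult.assoc mult_zero_left mult_zero_right)
      then have Z: "(\<lambda>x. f (s *\<^sub>R x) * indicator ?B x * indicator ?J (s * norm x) * ennreal (norm x)) = (\<lambda>x. 0)"
        by (rule ext)
      show ?thesis unfolding Z by simp
    qed
  qed
  also have "\<dots> = ?I * (\<integral>\<^sup>+s. ennreal (1 / s ^ Suc ?d) * indicator {1/2..} s \<partial>lborel)"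
    by (rule nn_integral_cmult) measurable
  \<comment> \<open>This integral is 2^d / d; the denominator cancels the d from the definition of
    the surface measure.\<close>
  also have "(\<integral>\<^sup>+s. ennreal (1 / s ^ Suc ?d) * indicator {1/2..} s \<partial>lborel) =
    ennreal (0 - - (1 / ?d) * inverse (1/2) ^ ?d)"
  proof (rule nn_integral_FTC_atLeast)
    have "((\<lambda>s::real. inverse s ^ ?d) \<longlongrightarrow> 0 ^ ?d) at_top"
      by (intro tendsto_power tendsto_inverse_0_at_top filterlim_ident)
    then have "((\<lambda>s::real. - (1 / ?d) * inverse s ^ ?d) \<longlongrightarrow> - (1 / ?d) * 0 ^ ?d) at_top"
      by (rule tendsto_mult_left)
    then show "((\<lambda>s::real. - (1 / ?d) * inverse s ^ ?d) \<longlongrightarrow> 0) at_top"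
      by (simp add: zero_power)
    show "((\<lambda>s. - (1 / ?d) * inverse s ^ ?d) has_real_derivative 1 / x ^ Suc ?d) (at x)" if "1 / 2 \<le> x" for x :: real
    proof (rule DERIV_cong)
      have x: "x \<noteq> 0" using that by auto
      show "((\<lambda>s. - (1 / ?d) * inverse s ^ ?d) has_real_derivative
          - (1 / ?d) * (real ?d * (- (inverse x ^ Suc (Suc 0)) * inverse x ^ (?d - Suc 0)))) (at x)"
        by (intro DERIV_cmult DERIV_power DERIV_inverse x)
      have g: "- (1 / real ?d) * (real ?d * (- A * B)) = A * B" for A B
        by simp
      have p: "inverse x ^ Suc (Suc 0) * inverse x ^ (?d - Suc 0) = inverse x ^ Suc ?d"
        unfolding power_add [symmetric] by (rule arg_cong [where f = "power (inverse x)"]) (use DIM_positive [where 'a = 'a] in linarith)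
      show "- (1 / ?d) * (real ?d * (- (inverse x ^ Suc (Suc 0)) * inverse x ^ (?d - Suc 0))) = 1 / x ^ Suc ?d"
        unfolding g p by (simp only: inverse_eq_divide power_one_over)
    qed
  qed auto
  finally have "(\<integral>\<^sup>+r. (\<integral>\<^sup>+\<theta>. f (r *\<^sub>R \<theta>) \<partial>sphere_measure) * indicator ?J r \<partial>lborel) \<le>
    ?d * (?I * ennreal (0 - - (1 / ?d) * inverse (1/2) ^ ?d))"
    by (auto simp: mult_left_mono)
  also have "\<dots> = ?I * (ennreal (real ?d) * ennreal (0 - - (1 / ?d) * inverse (1/2) ^ ?d))"
    by (simp add: mult_ac ennreal_of_nat_eq_real_of_nat)
  also have "ennreal (real ?d) * ennreal (0 - - (1 / ?d) * inverse (1/2) ^ ?d) = ennreal (2 ^ ?d)"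
    by (subst ennreal_mult [symmetric]) auto
  finally show ?thesis
    by (simp only: mult.commute)
qed

text \<open>Averaging the mean value inequality over radii controls |h(a)|^2 by the integral of
  |h|^2 over the ball of radius \<open>\<delta>\<close> about a. This ball lies in the ball of
  radius 1 + \<open>\<delta>\<close> about 0; scaling it back costs (1 +
  \<open>\<delta>\<close>)^(2k) <= q^k by homogeneity, and the integral over the unit ball is at
  most that over the sphere. The constant does not depend on k.\<close>

lemma harmonic_polys_pointwise_bound:
  assumes d: "2 \<le> DIM('a::euclidean_space)" and q: "1 < q"
  shows "\<exists>C. \<forall>k. \<forall>h\<in>harmonic_polys k. \<forall>a\<in>sphere 0 (1::real).
    (norm (h (a::'a)))\<^sup>2 \<le> C * q ^ k * (SINT \<theta>. (norm (h \<theta>))\<^sup>2)"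
proof -
  let ?d = "DIM('a)" and ?B = "ball 0 1 - {0 :: 'a}" and ?A = "measure sphere_measure (sphere (0::'a) 1)"
  have [measurable]: "ball 0 1 \<in> sets (borel :: 'a measure)" "{0} \<in> sets (borel :: 'a measure)"
    by auto
  \<comment> \<open>The second entry gives (1 + \<open>\<delta>\<close>)^2 <= 1 +
    3\<open>\<delta>\<close> <= q; the first keeps the ball about a away from the origin.\<close>
  define \<delta> where "\<delta> = min (1/2) ((q - 1) / 3)"
  have \<delta>: "0 < \<delta>" "\<delta> < 1" "(1 + \<delta>)\<^sup>2 \<le> q"
  proof -
    show 01: "0 < \<delta>" "\<delta> < 1" using q by (auto simp: \<delta>_def)
    have "(1 + \<delta>)\<^sup>2 = 1 + 2 * \<delta> + \<delta> * \<delta>" by (simp add: power2_eq_square algebra_simps)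
    also have "\<dots> \<le> 1 + 3 * \<delta>" using 01 mult_left_le [of \<delta> \<delta>] by simp
    finally have "(1 + \<delta>)\<^sup>2 \<le> 1 + 3 * \<delta>" .
    moreover have "\<delta> \<le> (q - 1) / 3" unfolding \<delta>_def by (rule min.cobounded2)
    ultimately show "(1 + \<delta>)\<^sup>2 \<le> q" by simp
  qed
  \<comment> \<open>Scaling by 1 / (1 + \<open>\<delta>\<close>) turns a + \<open>\<delta>\<close> y
    into a / (1 + \<open>\<delta>\<close>) + c y.\<close>
  define c where "c = \<delta> / (1 + \<delta>)"
  have c: "0 < c" using \<delta> by (simp add: c_def)
  \<comment> \<open>The 2 is the inverse length of the radius interval (1/2, 1), 2^d comes from
    \<open>nn_integral_shell_le\<close>, c^(-d) from the affine substitution, and ?A is the surface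
    area from the mean value inequality.\<close>
  define C where "C = 2 * 2 ^ ?d * (1 / c ^ ?d) / ?A"
  have "(norm (h a))\<^sup>2 \<le> C * q ^ k * (SINT \<theta>. (norm (h \<theta>))\<^sup>2)"
    if h: "h \<in> harmonic_polys k" and a: "a \<in> sphere 0 1" for h k and a :: 'a
  proof -
    note hp = harmonic_polysD(1) [OF h] and hom = harmonic_polysD(2) [OF h]
    have hc: "continuous_on S h" for S
      by (rule continuous_on_polymonial_function [OF hp])
    define I where "I = (SINT \<theta>. (norm (h \<theta>))\<^sup>2)"
    have I0: "0 \<le> I" unfolding I_def by (rule Bochner_Integration.integral_nonneg) simp
    define G where "G = (\<lambda>x. ennreal ((norm (h x))\<^sup>2))"
    have [measurable]: "h \<in> borel_measurable borel"
      by (rule borel_measurable_continuous_onI [OF hc])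
    have G [measurable]: "G \<in> borel_measurable borel"
      unfolding G_def by measurable
    have GI: "(\<integral>\<^sup>+y. G y * indicator ?B y \<partial>lborel) \<le> ennreal I"
    proof -
      have "(\<integral>\<^sup>+y. G y * indicator ?B y \<partial>lborel) \<le> (\<integral>\<^sup>+y. G (sgn y) * indicator ?B y \<partial>lborel)"
      proof (rule nn_integral_mono)
        fix y :: 'a
        show "G y * indicator ?B y \<le> G (sgn y) * indicator ?B y"
        proof (cases "y \<in> ?B")
          case True
          then have "norm (h y) = norm y ^ k * norm (h (sgn y))"
            using hom [of "norm y" "sgn y"] by (simp add: sgn_div_norm norm_mult norm_power)
          also have "\<dots> \<le> 1 * norm (h (sgn y))"
            using True by (intro mult_right_mono power_le_one) auto
          finally show ?thesis
            by (auto simp: G_def intro!: mult_right_mono ennreal_leI power_mono)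
        qed simp
      qed
      \<comment> \<open>The factor d >= 1 is inserted to match
        \<open>nn_integral_sphere_measure\<close>.\<close>
      also have "\<dots> \<le> ?d * (\<integral>\<^sup>+y. G (sgn y) * indicator ?B y \<partial>lborel)"
      proof -
        have "(1 :: ennreal) \<le> of_nat ?d"
          by (metis DIM_positive One_nat_def Suc_leI of_nat_1 of_nat_mono)
        from mult_right_mono [OF this] show ?thesis by simp
      qed
      also have "\<dots> = (\<integral>\<^sup>+\<theta>. G \<theta> \<partial>sphere_measure)"
        by (simp add: nn_integral_sphere_measure)
      also have "\<dots> = ennreal I"
        unfolding G_def I_def
        by (intro nn_integral_eq_integral integrable_sphere_measure continuous_intros hc) auto
      finally show ?thesis .
    qed
    define F where "F = (\<lambda>y. G (a + \<delta> *\<^sub>R y))"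
    have F [measurable]: "F \<in> borel_measurable borel" unfolding F_def by measurable
    have "(\<integral>\<^sup>+y. F y * indicator ?B y \<partial>lborel) \<le> (\<integral>\<^sup>+y. ennreal (q ^ k) *
        (G (a /\<^sub>R (1 + \<delta>) + c *\<^sub>R y) * indicator ?B (a /\<^sub>R (1 + \<delta>) + c *\<^sub>R y)) \<partial>lborel)"
    proof (rule nn_integral_mono)
      fix y :: 'a
      let ?z = "a /\<^sub>R (1 + \<delta>) + c *\<^sub>R y"
      have z: "a + \<delta> *\<^sub>R y = (1 + \<delta>) *\<^sub>R ?z"
        using \<delta> by (simp add: c_def scaleR_add_right divide_inverse mult_ac)
      show "F y * indicator ?B y \<le> ennreal (q ^ k) * (G ?z * indicator ?B ?z)"
      proof (cases "y \<in> ?B")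
        case True
        have na: "norm a = 1" using a by simp
        have "norm (a + \<delta> *\<^sub>R y) \<le> 1 + \<delta> * norm y"
          using norm_triangle_ineq [of a "\<delta> *\<^sub>R y"] \<delta> na by simp
        also have "\<dots> < 1 + \<delta>" using True \<delta> by simp
        finally have "norm ((1 + \<delta>) *\<^sub>R ?z) < 1 + \<delta>"
          unfolding z .
        then have z1: "norm ?z < 1" using \<delta> by simp
        \<comment> \<open>The ball is punctured, so the image point has to be shown nonzero as
          well.\<close>
        have "a + \<delta> *\<^sub>R y \<noteq> 0"
        proof
          assume "a + \<delta> *\<^sub>R y = 0"
          then have "norm a = \<delta> * norm y"
            using \<delta> by (metis abs_of_pos add_eq_0_iff norm_minus_cancel norm_scaleR)
          also have "\<dots> < 1 * 1" using True \<delta> by (intro mult_strict_mono') auto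
          finally show False using na by simp
        qed
        then have "?z \<in> ?B" using z z1 by auto
        moreover have "(norm (h (a + \<delta> *\<^sub>R y)))\<^sup>2 \<le> q ^ k * (norm (h ?z))\<^sup>2"
        proof -
          have "(norm (h (a + \<delta> *\<^sub>R y)))\<^sup>2 = ((1 + \<delta>)\<^sup>2) ^ k * (norm (h ?z))\<^sup>2"
            unfolding z hom using \<delta> by (simp add: norm_mult norm_power power_mult_distrib power_mult [symmetric] mult.commute
                flip: of_real_add)
          also have "\<dots> \<le> q ^ k * (norm (h ?z))\<^sup>2"
            using \<delta> by (intro mult_right_mono power_mono) auto
          finally show ?thesis .
        qed
        ultimately show ?thesis
          using True q by (simp add: F_def G_def flip: ennreal_mult)
      qed simp
    qed
    also have "\<dots> = ennreal (q ^ k) * (ennreal (1 / c ^ ?d) * (\<integral>\<^sup>+y. G y * indicator ?B y \<partial>lborel))"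
      using c by (subst nn_integral_cmult, measurable) (subst nn_integral_affine' [where g = "\<lambda>y. G y * indicator ?B y"], auto)
    also have "\<dots> \<le> ennreal (q ^ k) * (ennreal (1 / c ^ ?d) * ennreal I)"
      by (intro mult_left_mono GI) auto
    also have "\<dots> = ennreal (q ^ k * ((1 / c ^ ?d) * I))"
    proof -
      have "0 \<le> q ^ k" "0 \<le> 1 / c ^ ?d" "0 \<le> (1 / c ^ ?d) * I"
        using q c I0 by auto
      then show ?thesis
        using I0 by (metis ennreal_mult)
    qed
    finally have FB: "(\<integral>\<^sup>+y. F y * indicator ?B y \<partial>lborel) \<le> ennreal (q ^ k * (1 / c ^ ?d) * I)"
      by (simp only: mult.assoc)
    have "ennreal (1/2 * (?A * (norm (h a))\<^sup>2)) = (\<integral>\<^sup>+r. ennreal (?A * (norm (h a))\<^sup>2) * indicator {1/2<..<1::real} r \<partial>lborel)"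
      by (subst nn_integral_cmult_indicator, simp, subst emeasure_lborel_Ioo, simp,
          subst ennreal_mult [symmetric]) (auto intro!: arg_cong [where f = ennreal])
    also have "\<dots> \<le> (\<integral>\<^sup>+r. (\<integral>\<^sup>+\<theta>. F (r *\<^sub>R \<theta>) \<partial>sphere_measure) * indicator {1/2<..<1} r \<partial>lborel)"
    proof (rule nn_integral_mono)
      fix r :: real
      show "ennreal (?A * (norm (h a))\<^sup>2) * indicator {1/2<..<1} r \<le>
        (\<integral>\<^sup>+\<theta>. F (r *\<^sub>R \<theta>) \<partial>sphere_measure) * indicator {1/2<..<1} r"
      proof (cases "r \<in> {1/2<..<1}")
        case True
        then have r: "0 \<le> \<delta> * r" "\<delta> * r < 1"
          using \<delta> mult_strict_mono [of \<delta> 1 r 1] by auto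
        have cont: "continuous_on S (\<lambda>\<theta>. h (a + (\<delta> * r) *\<^sub>R \<theta>))" for S
          by (rule continuous_on_compose2 [OF hc [of UNIV]]) (auto intro!: continuous_intros)
        have "ennreal (?A * (norm (h a))\<^sup>2) \<le> ennreal (SINT \<theta>. (norm (h (a + (\<delta> * r) *\<^sub>R \<theta>)))\<^sup>2)"
          by (intro ennreal_leI harmonic_mean_value_square d hp harmonic_polysD(3) [OF h] r)
        also have "\<dots> = (\<integral>\<^sup>+\<theta>. F (r *\<^sub>R \<theta>) \<partial>sphere_measure)"
          unfolding F_def G_def scaleR_scaleR
          by (intro nn_integral_eq_integral [symmetric] integrable_sphere_measure continuous_intros cont) auto
        finally show ?thesis using True by simp
      qed simp
    qed
    also have "\<dots> \<le> ennreal (2 ^ ?d) * (\<integral>\<^sup>+y. F y * indicator ?B y \<partial>lborel)"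
      by (rule nn_integral_shell_le [OF F])
    also have "\<dots> \<le> ennreal (2 ^ ?d) * ennreal (q ^ k * (1 / c ^ ?d) * I)"
      by (intro mult_left_mono FB) auto
    also have "\<dots> = ennreal (2 ^ ?d * (q ^ k * (1 / c ^ ?d) * I))"
      using q c I0 by (intro ennreal_mult [symmetric]) auto
    finally have "1/2 * (?A * (norm (h a))\<^sup>2) \<le> 2 ^ ?d * (q ^ k * (1 / c ^ ?d) * I)"
      using q c I0 by (subst (asm) ennreal_le_iff) auto
    then have "(norm (h a))\<^sup>2 * ?A \<le> 2 * (2 ^ ?d * (q ^ k * (1 / c ^ ?d) * I))"
      by (simp add: mult.commute)
    then have "(norm (h a))\<^sup>2 \<le> 2 * (2 ^ ?d * (q ^ k * (1 / c ^ ?d) * I)) / ?A"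
      by (subst pos_le_divide_eq [OF measure_sphere_measure_pos])
    also have "\<dots> = C * q ^ k * I"
      by (simp add: C_def)
    finally have "(norm (h a))\<^sup>2 \<le> C * q ^ k * I" .
    then show ?thesis by (simp add: I_def)
  qed
  then show ?thesis by blast
qed

section \<open>Series of spherical harmonics\<close>

text \<open>The filter is arbitrary: this serves both the sequence of Almansi partial sums and the
  net of finite subsets behind \<open>has_sum\<close>.\<close>

lemma sphere_integral_uniform_limit:
  fixes f :: "'i \<Rightarrow> 'a::euclidean_space \<Rightarrow> complex"
  assumes lim: "uniform_limit (sphere 0 1) f l F" and F: "F \<noteq> bot"
    and cont: "\<forall>\<^sub>F n in F. continuous_on (sphere 0 1) (f n)" and g: "continuous_on (sphere 0 1) g"
  shows "((\<lambda>n. SINT \<theta>. f n \<theta> * g \<theta>) \<longlongrightarrow> (SINT \<theta>. l \<theta> * g \<theta>)) F"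
proof (rule tendstoI)
  fix e :: real assume e: "0 < e"
  let ?C = "SINT \<theta>. norm (g \<theta>)"
  have l: "continuous_on (sphere 0 1) l"
    using uniform_limit_theorem [OF cont lim] F by simp
  have C1: "0 < ?C + 1"
    by (intro add_nonneg_pos Bochner_Integration.integral_nonneg) auto
  have "\<forall>\<^sub>F n in F. \<forall>\<theta>\<in>sphere 0 1. dist (f n \<theta>) (l \<theta>) < e / (?C + 1)"
    by (rule uniform_limitD [OF lim]) (use e C1 in simp)
  then show "\<forall>\<^sub>F n in F. dist (SINT \<theta>. f n \<theta> * g \<theta>) (SINT \<theta>. l \<theta> * g \<theta>) < e"
    using cont
  proof eventually_elim
    case (elim n)
    have "(SINT \<theta>. f n \<theta> * g \<theta>) - (SINT \<theta>. l \<theta> * g \<theta>) =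
        (SINT \<theta>. (f n \<theta> - l \<theta>) * g \<theta>)"
      using elim l g by (subst Bochner_Integration.integral_diff [symmetric])
        (auto intro!: integrable_sphere_measure continuous_intros simp: algebra_simps)
    also have "norm \<dots> \<le> (SINT \<theta>. norm ((f n \<theta> - l \<theta>) * g \<theta>))"
      by (rule integral_norm_bound)
    also have "\<dots> \<le> (SINT \<theta>. e / (?C + 1) * norm (g \<theta>))"
    proof (rule integral_mono)
      show "integrable sphere_measure (\<lambda>\<theta>. norm ((f n \<theta> - l \<theta>) * g \<theta>))"
        "integrable sphere_measure (\<lambda>\<theta>. e / (?C + 1) * norm (g \<theta>))"
        using elim l g by (auto intro!: integrable_sphere_measure continuous_intros)
      fix \<theta> :: 'a assume "\<theta> \<in> space sphere_measure"
      then have "norm (f n \<theta> - l \<theta>) \<le> e / (?C + 1)"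
        using elim by (simp add: space_sphere_measure dist_norm less_imp_le)
      then show "norm ((f n \<theta> - l \<theta>) * g \<theta>) \<le> e / (?C + 1) * norm (g \<theta>)"
        unfolding norm_mult by (rule mult_right_mono) simp
    qed
    also have "\<dots> = e / (?C + 1) * ?C" by simp
    also have "\<dots> < e"
      using e C1 by (simp add: pos_divide_less_eq)
    finally show ?case by (simp add: dist_norm)
  qed
qed

locale sphere_basis =
  fixes Y :: "nat \<Rightarrow> nat \<Rightarrow> 'a::euclidean_space \<Rightarrow> complex"
  assumes basis: "harmonic_basis Y" and dim: "2 \<le> DIM('a)"
begin

section \<open>Orthonormality, completeness and growth of the basis\<close>

lemma index_iff: "(k, l) \<in> harmonic_index TYPE('a) \<longleftrightarrow> l \<in> {1..harmonic_dim TYPE('a) k}"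
  by (auto simp: harmonic_index_def)

lemma Y_real: "(k, l) \<in> harmonic_index TYPE('a) \<Longrightarrow> cnj (Y k l x) = Y k l x"
  using basis by (auto simp: harmonic_basis_def Let_def index_iff Reals_cnj_iff)

lemma Y_span: "cfun.span (Y k ` {1..harmonic_dim TYPE('a) k}) = harmonic_polys k"
  using basis by (simp add: harmonic_basis_def Let_def)

lemma Y_harmonic: "(k, l) \<in> harmonic_index TYPE('a) \<Longrightarrow> Y k l \<in> harmonic_polys k"
  using Y_span [of k] cfun.span_base [of "Y k l" "Y k ` {1..harmonic_dim TYPE('a) k}"] by (auto simp: index_iff)

lemma continuous_on_Y: "(k, l) \<in> harmonic_index TYPE('a) \<Longrightarrow> continuous_on S (Y k l)"
  using Y_harmonic harmonic_polysD(1) continuous_on_polymonial_function by blast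

text \<open>Within one degree this is the hypothesis on the basis, with the conjugation dropped for
  real values. Different degrees are orthogonal as eigenspaces of the symmetric angular Laplacian to
  distinct eigenvalues.\<close>

lemma Y_orthonormal:
  assumes "(k, l) \<in> harmonic_index TYPE('a)" "(k', l') \<in> harmonic_index TYPE('a)"
  shows "(SINT \<theta>. Y k l \<theta> * Y k' l' \<theta>) = (if (k, l) = (k', l') then 1 else 0)"
proof (cases "k = k'")
  case True
  then have "(SINT \<theta>. Y k l \<theta> * cnj (Y k l' \<theta>)) = (if l = l' then 1 else 0)"
    using basis assms by (simp add: harmonic_basis_def Let_def index_iff)
  moreover have "cnj (Y k l' \<theta>) = Y k' l' \<theta>" for \<theta>
    using True Y_real [OF assms(2)] by simp
  ultimately show ?thesis
    using True by simp
next
  case False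
  let ?c = "\<lambda>k. complex_of_real (real k * (real k + DIM('a) - 2))" and ?I = "SINT \<theta>. Y k l \<theta> * Y k' l' \<theta>"
  note h = Y_harmonic [OF assms(1)] and h' = Y_harmonic [OF assms(2)]
  have "(SINT \<theta>. angular_laplacian (Y k l) (1 *\<^sub>R \<theta>) * Y k' l' (1 *\<^sub>R \<theta>)) =
      (SINT \<theta>. Y k l (1 *\<^sub>R \<theta>) * angular_laplacian (Y k' l') (1 *\<^sub>R \<theta>))"
    by (rule angular_laplacian_self_adjoint [OF open_UNIV _ _ Ck_on_polynomial_function Ck_on_polynomial_function])
       (auto intro: harmonic_polysD h h')
  then have "(SINT \<theta>. - ?c k * (Y k l \<theta> * Y k' l' \<theta>)) = (SINT \<theta>. - ?c k' * (Y k l \<theta> * Y k' l' \<theta>))"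
    unfolding angular_laplacian_harmonic [OF h] angular_laplacian_harmonic [OF h'] by (simp only: scaleR_one mult_ac)
  then have "?c k * ?I = ?c k' * ?I"
    by (simp only: integral_mult_right_zero) simp
  moreover have "?c k \<noteq> ?c k'"
  proof -
    \<comment> \<open>k(k + d - 2) is strictly increasing in k because d >= 2.\<close>
    have mono: "real a * (real a + DIM('a) - 2) < real b * (real b + DIM('a) - 2)" if "a < b" for a b :: nat
    proof -
      have "real a * (real a + DIM('a) - 2) \<le> real a * (real b + DIM('a) - 2)"
        using that by (intro mult_left_mono) auto
      also have "\<dots> < real b * (real b + DIM('a) - 2)"
        using that dim by (intro mult_strict_right_mono) auto
      finally show ?thesis .
    qed
    have "real k * (real k + DIM('a) - 2) \<noteq> real k' * (real k' + DIM('a) - 2)"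
      using False mono [of k k'] mono [of k' k] by (cases "k < k'") auto
    then show ?thesis unfolding of_real_eq_iff .
  qed
  ultimately show ?thesis
    using False by simp
qed

text \<open>Orthogonality to f - g defines a subspace; containing the basis of degree k, it contains
  all harmonic polynomials of that degree, and completeness applies.\<close>

lemma sphere_function_eqI:
  fixes f g :: "'a \<Rightarrow> complex"
  assumes f: "continuous_on (sphere 0 1) f" and g: "continuous_on (sphere 0 1) g"
    and eq: "\<And>k l. (k, l) \<in> harmonic_index TYPE('a) \<Longrightarrow>
      (SINT \<theta>. f \<theta> * Y k l \<theta>) = (SINT \<theta>. g \<theta> * Y k l \<theta>)"
    and z: "z \<in> sphere 0 1"
  shows "f z = g z"
proof -
  have fg: "continuous_on (sphere 0 1) (\<lambda>x. f x - g x)"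
    by (intro continuous_intros f g)
  have "f z - g z = 0"
  proof (rule sphere_harmonics_complete [OF fg _ z])
    fix k and h :: "'a \<Rightarrow> complex" assume h: "h \<in> harmonic_polys k"
    let ?S = "{h. continuous_on (sphere 0 1) h \<and> (SINT \<theta>. (f \<theta> - g \<theta>) * h \<theta>) = 0}"
    have int: "integrable sphere_measure (\<lambda>\<theta>. (f \<theta> - g \<theta>) * h \<theta>)" if "continuous_on (sphere 0 1) h" for h :: "'a \<Rightarrow> complex"
      by (intro integrable_sphere_measure continuous_intros f g that)
    have "cfun.subspace ?S"
    proof (rule cfun.subspaceI)
      show "0 \<in> ?S" by (simp add: zero_fun_def)
      show "x + y \<in> ?S" if "x \<in> ?S" "y \<in> ?S" for x y
      proof -
        have "(SINT \<theta>. (f \<theta> - g \<theta>) * (x \<theta> + y \<theta>)) =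
          (SINT \<theta>. (f \<theta> - g \<theta>) * x \<theta>) + (SINT \<theta>. (f \<theta> - g \<theta>) * y \<theta>)"
          unfolding distrib_left using that int by (intro Bochner_Integration.integral_add) auto
        then show ?thesis
          using that by (auto simp: plus_fun_def intro: continuous_intros)
      qed
      show "cfun_scale c x \<in> ?S" if "x \<in> ?S" for c x
      proof -
        have "(SINT \<theta>. (f \<theta> - g \<theta>) * (c * x \<theta>)) = c * (SINT \<theta>. (f \<theta> - g \<theta>) * x \<theta>)"
          by (simp only: integral_mult_right_zero [symmetric] mult.left_commute)
        then show ?thesis
          using that by (auto simp: cfun_scale_def intro: continuous_intros)
      qed
    qed
    moreover have "Y k ` {1..harmonic_dim TYPE('a) k} \<subseteq> ?S"
    proof
      fix y assume "y \<in> Y k ` {1..harmonic_dim TYPE('a) k}"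
      then obtain l where l: "y = Y k l" "(k, l) \<in> harmonic_index TYPE('a)" by (auto simp: index_iff)
      have "(SINT \<theta>. (f \<theta> - g \<theta>) * Y k l \<theta>) =
        (SINT \<theta>. f \<theta> * Y k l \<theta>) - (SINT \<theta>. g \<theta> * Y k l \<theta>)"
        unfolding left_diff_distrib
        by (intro Bochner_Integration.integral_diff integrable_sphere_measure continuous_on_mult f g continuous_on_Y l)
      then show "y \<in> ?S"
        using eq l continuous_on_Y by auto
    qed
    ultimately have "cfun.span (Y k ` {1..harmonic_dim TYPE('a) k}) \<subseteq> ?S"
      by (rule cfun.span_minimal [rotated])
    then show "(SINT \<theta>. (f \<theta> - g \<theta>) * h \<theta>) = 0"
      using h Y_span [of k] by auto
  qed
  then show ?thesis by simp
qed

lemma Y_norm_integral: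
  assumes kl: "(k, l) \<in> harmonic_index TYPE('a)"
  shows "(SINT \<theta>. (norm (Y k l \<theta>))\<^sup>2) = 1"
proof -
  have "complex_of_real ((norm (Y k l \<theta>))\<^sup>2) = Y k l \<theta> * Y k l \<theta>" for \<theta>
    using complex_norm_square [of "Y k l \<theta>"] Y_real [OF kl] by simp
  then have "complex_of_real (SINT \<theta>. (norm (Y k l \<theta>))\<^sup>2) = 1"
    using Y_orthonormal [OF kl kl] by (simp flip: integral_complex_of_real)
  then show ?thesis by (metis of_real_eq_1_iff)
qed

text \<open>The dimension is the integral of Z, the sum of |Y k l|^2 over l. The reproducing kernel
  h at a satisfies h(a) = Z(a), and its squared L2 norm is Z(a) too. The pointwise bound for h then
  reads Z(a)^2 <= C0 q^k Z(a), which bounds Z and hence the dimension.\<close>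

lemma Y_bound:
  assumes q: "1 < q"
  obtains C where "0 < C" "\<And>k. real (harmonic_dim TYPE('a) k) \<le> C * q ^ k"
    "\<And>k l \<theta>. (k, l) \<in> harmonic_index TYPE('a) \<Longrightarrow> \<theta> \<in> sphere 0 1 \<Longrightarrow> norm (Y k l \<theta>) \<le> C * q ^ k"
proof -
  obtain C0 where C0: "\<And>k h (a::'a). h \<in> harmonic_polys k \<Longrightarrow> a \<in> sphere 0 1 \<Longrightarrow>
    (norm (h a))\<^sup>2 \<le> C0 * q ^ k * (SINT \<theta>. (norm (h \<theta>))\<^sup>2)"
    using harmonic_polys_pointwise_bound [OF dim q] by blast
  let ?A = "measure sphere_measure (sphere (0::'a) 1)"
  define C where "C = 1 + \<bar>C0\<bar> + \<bar>C0\<bar> * ?A"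
  have A: "0 < ?A" by (rule measure_sphere_measure_pos)
  have C: "0 < C" "1 + \<bar>C0\<bar> \<le> C" "\<bar>C0\<bar> * ?A \<le> C"
    using A by (auto simp: C_def add_pos_nonneg)
  have normI: "complex_of_real (SINT \<theta>. (norm (h \<theta>))\<^sup>2) = (SINT \<theta>. h \<theta> * cnj (h \<theta>))"
    for h :: "'a \<Rightarrow> complex"
    by (simp add: complex_norm_square [symmetric] flip: integral_complex_of_real of_real_power)
  have Ybound: "norm (Y k l \<theta>) \<le> C * q ^ k" if kl: "(k, l) \<in> harmonic_index TYPE('a)" and \<theta>: "\<theta> \<in> sphere 0 1" for k l \<theta>
  proof -
    have "(norm (Y k l \<theta>))\<^sup>2 \<le> C0 * q ^ k"
      using C0 [OF Y_harmonic [OF kl] \<theta>] Y_norm_integral [OF kl] by simp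
    \<comment> \<open>The estimate t <= 1 + t^2 passes from the square to the norm while keeping the
      same q.\<close>
    moreover have "norm (Y k l \<theta>) \<le> 1 + (norm (Y k l \<theta>))\<^sup>2"
    proof -
      have "0 \<le> (norm (Y k l \<theta>) - 1 / 2)\<^sup>2" by simp
      then show ?thesis by (simp add: power2_eq_square algebra_simps)
    qed
    moreover have "1 \<le> q ^ k" "C0 * q ^ k \<le> \<bar>C0\<bar> * q ^ k"
      using q by (auto intro!: mult_right_mono)
    ultimately have "norm (Y k l \<theta>) \<le> (1 + \<bar>C0\<bar>) * q ^ k"
      unfolding distrib_right by linarith
    also have "\<dots> \<le> C * q ^ k"
      using C q by (intro mult_right_mono) auto
    finally show ?thesis .
  qed
  have dimbound: "real (harmonic_dim TYPE('a) k) \<le> C * q ^ k" for k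
  proof -
    let ?I = "{1..harmonic_dim TYPE('a) k}"
    define Z where "Z = (\<lambda>\<theta>. \<Sum>l\<in>?I. (norm (Y k l \<theta>))\<^sup>2)"
    have kl: "(k, l) \<in> harmonic_index TYPE('a)" if "l \<in> ?I" for l using that by (simp add: index_iff)
    have YY: "Y k l \<theta> * Y k l \<theta> = of_real ((norm (Y k l \<theta>))\<^sup>2)" if "l \<in> ?I" for l \<theta>
      using Y_real [OF kl [OF that], of \<theta>] complex_norm_square [of "Y k l \<theta>"] by simp
    have Zb: "Z a \<le> \<bar>C0\<bar> * q ^ k" if a: "a \<in> sphere 0 1" for a
    proof -
      define h where "h = (\<Sum>l\<in>?I. cfun_scale (Y k l a) (Y k l))"
      have h_eq: "h x = (\<Sum>l\<in>?I. Y k l a * Y k l x)" for x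
      proof -
        have "(\<Sum>l\<in>I. g l) x = (\<Sum>l\<in>I. g l x)" for I :: "nat set" and g :: "nat \<Rightarrow> 'a \<Rightarrow> complex"
          by (induction I rule: infinite_finite_induct) auto
        then show ?thesis by (simp add: h_def cfun_scale_def)
      qed
      have "h \<in> cfun.span (Y k ` ?I)"
        unfolding h_def by (intro cfun.span_sum cfun.span_scale cfun.span_base) auto
      then have h: "h \<in> harmonic_polys k" using Y_span by simp
      have "h a = of_real (Z a)"
        unfolding h_eq Z_def of_real_sum by (intro sum.cong refl YY)
      moreover have "complex_of_real (SINT \<theta>. (norm (h \<theta>))\<^sup>2) = of_real (Z a)"
      proof -
        have "(SINT \<theta>. h \<theta> * cnj (h \<theta>)) =
          (SINT \<theta>. (\<Sum>l\<in>?I. \<Sum>m\<in>?I. (Y k l a * Y k m a) * (Y k l \<theta> * Y k m \<theta>)))"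
          unfolding h_eq cnj_sum sum_product complex_cnj_mult
          by (intro Bochner_Integration.integral_cong refl sum.cong) (simp add: Y_real kl mult_ac)
        also have "\<dots> = (\<Sum>l\<in>?I. (SINT \<theta>. (\<Sum>m\<in>?I. (Y k l a * Y k m a) * (Y k l \<theta> * Y k m \<theta>))))"
          by (intro Bochner_Integration.integral_sum Bochner_Integration.integrable_sum integrable_sphere_measure
              continuous_on_mult continuous_on_const continuous_on_Y kl)
        also have "\<dots> = (\<Sum>l\<in>?I. \<Sum>m\<in>?I. (SINT \<theta>. (Y k l a * Y k m a) * (Y k l \<theta> * Y k m \<theta>)))"
          by (intro sum.cong refl Bochner_Integration.integral_sum integrable_sphere_measure
              continuous_on_mult continuous_on_const continuous_on_Y kl)
        also have "\<dots> = (\<Sum>l\<in>?I. \<Sum>m\<in>?I. (Y k l a * Y k m a) * (if l = m then 1 else 0))"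
          using Y_orthonormal [OF kl kl] by (intro sum.cong refl) simp
        also have "\<dots> = (\<Sum>l\<in>?I. Y k l a * Y k l a)"
          by (intro sum.cong refl) (simp add: if_distrib cong: if_cong)
        also have "\<dots> = of_real (Z a)"
          unfolding Z_def of_real_sum by (intro sum.cong refl YY)
        finally show ?thesis by (simp only: normI)
      qed
      then have "(SINT \<theta>. (norm (h \<theta>))\<^sup>2) = Z a"
        by (simp only: of_real_eq_iff)
      moreover have Z0: "0 \<le> Z a" by (simp add: Z_def sum_nonneg)
      ultimately have "Z a * Z a \<le> C0 * q ^ k * Z a"
        using C0 [OF h a] by (simp add: power2_eq_square)
      \<comment> \<open>The sign of \<open>C0\<close> is unknown, so its absolute value takes over
        before Z(a) is cancelled.\<close>
      then have "Z a * Z a \<le> (\<bar>C0\<bar> * q ^ k) * Z a"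
        using Z0 q by (smt (verit) mult_right_mono zero_le_power)
      then show ?thesis
        using Z0 q by (cases "Z a = 0") auto
    qed
    have int: "integrable sphere_measure (\<lambda>\<theta>. (norm (Y k l \<theta>))\<^sup>2)" if "l \<in> ?I" for l
      by (intro integrable_sphere_measure continuous_on_power continuous_on_norm continuous_on_Y kl that)
    have "real (harmonic_dim TYPE('a) k) = (\<Sum>l\<in>?I. 1)" by simp
    also have "\<dots> = (\<Sum>l\<in>?I. (SINT \<theta>. (norm (Y k l \<theta>))\<^sup>2))"
      using Y_norm_integral kl by simp
    also have "\<dots> = (SINT \<theta>. Z \<theta>)"
      unfolding Z_def by (intro Bochner_Integration.integral_sum [symmetric] int)
    also have "\<dots> \<le> (SINT \<theta>::'a. \<bar>C0\<bar> * q ^ k)"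
    proof (intro integral_mono)
      show "integrable sphere_measure Z"
        unfolding Z_def by (intro Bochner_Integration.integrable_sum int)
      show "Z x \<le> \<bar>C0\<bar> * q ^ k" if "x \<in> space sphere_measure" for x
        using Zb [of x] that by (simp add: space_sphere_measure)
    qed simp
    also have "\<dots> = (\<bar>C0\<bar> * ?A) * q ^ k"
      by (simp add: space_sphere_measure)
    also have "\<dots> \<le> C * q ^ k"
      using C q by (intro mult_right_mono) auto
    finally show ?thesis .
  qed
  show thesis
    by (rule that [OF C(1) dimbound Ybound])
qed

section \<open>Convergence and moments of series of harmonics\<close>

abbreviation sterm ::
  "(nat \<Rightarrow> nat \<Rightarrow> nat \<Rightarrow> complex) \<Rightarrow> complex \<Rightarrow> 'a \<Rightarrow> (nat \<times> nat) \<times> nat \<Rightarrow> complex" where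
  "sterm c z \<theta> \<equiv> \<lambda>((k, l), j). c k l j * z ^ (k + 2 * j) * Y k l \<theta>"

text \<open>The growth condition under which the series converges for all |z| < 1. It asks for
  uniformity in l and j; the powers z^(2j) take care of the sum over j.\<close>

definition subexponential :: "(nat \<Rightarrow> nat \<Rightarrow> nat \<Rightarrow> complex) \<Rightarrow> bool" where
  "subexponential c \<longleftrightarrow> (\<forall>q>1. \<exists>C. \<forall>k l j. (k, l) \<in> harmonic_index TYPE('a) \<longrightarrow> norm (c k l j) \<le> C * q ^ k)"

lemma summable_on_geometric_index:
  fixes s t :: real
  assumes q: "\<And>k. real (harmonic_dim TYPE('a) k) \<le> C * q ^ k" and s: "0 \<le> s" "0 \<le> q" "q * s < 1" and t: "0 \<le> t" "t < 1"
  shows "(\<lambda>((k, l), j). s ^ k * t ^ j) summable_on (harmonic_index TYPE('a) \<times> UNIV)"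
proof (rule summable_on_SigmaI)
  have t': "((\<lambda>j. t ^ j) has_sum (1 / (1 - t))) UNIV"
    using t by (intro sums_nonneg_imp_has_sum geometric_sums) auto
  show "((\<lambda>j. (\<lambda>((k, l), j). s ^ k * t ^ j) (x, j)) has_sum (s ^ fst x * (1 / (1 - t)))) UNIV"
    for x :: "nat \<times> nat"
    using has_sum_cmult_right [OF t', of "s ^ fst x"] by (simp add: case_prod_unfold)
  have "(\<lambda>x. s ^ fst x) summable_on harmonic_index TYPE('a)"
    unfolding harmonic_index_def
  proof (rule summable_on_SigmaI)
    show "((\<lambda>l. s ^ fst (k, l)) has_sum (real (harmonic_dim TYPE('a) k) * s ^ k)) {1..harmonic_dim TYPE('a) k}" for k
      using has_sum_finite [of "{1..harmonic_dim TYPE('a) k}" "\<lambda>l. s ^ k"] by simp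
    have "summable (\<lambda>k. C * (q * s) ^ k)"
      using s by (intro summable_mult summable_geometric) auto
    then have "summable (\<lambda>k. real (harmonic_dim TYPE('a) k) * s ^ k)"
    proof (rule summable_comparison_test' [where N = 0])
      show "norm (real (harmonic_dim TYPE('a) k) * s ^ k) \<le> C * (q * s) ^ k" for k
        using mult_right_mono [OF q, of "s ^ k" k] s by (simp add: power_mult_distrib mult_ac)
    qed
    then show "(\<lambda>k. real (harmonic_dim TYPE('a) k) * s ^ k) summable_on UNIV"
      using s by (intro summable_nonneg_imp_summable_on) auto
  qed (use s in auto)
  then show "(\<lambda>x. s ^ fst x * (1 / (1 - t))) summable_on harmonic_index TYPE('a)"
    by (rule summable_on_cmult_left)
qed (use s t in auto)

text \<open>Three factors q^k compete with \<open>\<rho>\<close>^k: one each from the coefficients,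
  from Y, and from the number of indices l. Hence q is chosen with q^3 \<open>\<rho>\<close> <
  1.\<close>

lemma series_majorant:
  assumes c: "subexponential c" and \<rho>: "0 \<le> \<rho>" "\<rho> < 1"
  obtains M where "M summable_on (harmonic_index TYPE('a) \<times> UNIV)"
    "\<And>x z \<theta>. x \<in> harmonic_index TYPE('a) \<times> UNIV \<Longrightarrow> norm z \<le> \<rho> \<Longrightarrow> \<theta> \<in> sphere 0 1 \<Longrightarrow>
      norm (sterm c z \<theta> x) \<le> M x"
proof -
  \<comment> \<open>With e = (1 - \<open>\<rho>\<close>) / 8 <= 1/8 one has (1 + e)^3 <= 1 + 4e, and
    (1 + 4e)(1 - 8e) < 1.\<close>
  define q where "q = 1 + (1 - \<rho>) / 8"
  have q: "1 < q" using \<rho> by (simp add: q_def)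
  have q3: "q * (q * q * \<rho>) < 1"
  proof -
    define e where "e = (1 - \<rho>) / 8"
    have "8 * e = 1 - \<rho>" by (simp add: e_def)
    then have e: "0 < e" "e \<le> 1 / 8" "\<rho> = 1 - 8 * e" using \<rho> by linarith+
    have "q * (q * q * \<rho>) = (1 + e) * (1 + e) * (1 + e) * (1 - 8 * e)"
      using e(3) by (simp only: q_def mult.assoc) simp
    also have "\<dots> \<le> (1 + 4 * e) * (1 - 8 * e)"
    proof (rule mult_right_mono)
      have "e * e \<le> e * (1 / 8)" "e * e * e \<le> (e * (1 / 8)) * (1 / 8)"
        using e by (intro mult_left_mono mult_mono; simp)+
      moreover have "(1 + e) * (1 + e) * (1 + e) = 1 + 3 * e + 3 * (e * e) + e * e * e"
        by (simp add: algebra_simps)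
      ultimately show "(1 + e) * (1 + e) * (1 + e) \<le> 1 + 4 * e"
        using e(1) by linarith
    qed (use e in auto)
    also have "\<dots> = 1 - 4 * e - 32 * (e * e)" by (simp add: algebra_simps)
    also have "\<dots> < 1" using e(1) mult_pos_pos [OF e(1) e(1)] by linarith
    finally show ?thesis .
  qed
  obtain C where C: "0 < C" "\<And>k. real (harmonic_dim TYPE('a) k) \<le> C * q ^ k"
    "\<And>k l \<theta>. (k, l) \<in> harmonic_index TYPE('a) \<Longrightarrow> \<theta> \<in> sphere 0 1 \<Longrightarrow> norm (Y k l \<theta>) \<le> C * q ^ k"
    using Y_bound [OF q] by blast
  obtain D where D: "\<And>k l j. (k, l) \<in> harmonic_index TYPE('a) \<Longrightarrow> norm (c k l j) \<le> D * q ^ k"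
    using c q unfolding subexponential_def by blast
  define M where "M = (\<lambda>x. (\<bar>D\<bar> * C) * (\<lambda>((k, l :: nat), j). (q * q * \<rho>) ^ k * (\<rho>\<^sup>2) ^ j) x)"
  show thesis
  proof (rule that)
    show "M summable_on (harmonic_index TYPE('a) \<times> UNIV)"
      unfolding M_def
      using \<rho> q q3 by (intro summable_on_cmult_right summable_on_geometric_index [OF C(2)]) (auto simp: abs_square_less_1)
    fix x :: "(nat \<times> nat) \<times> nat" and z :: complex and \<theta> :: 'a
    assume x: "x \<in> harmonic_index TYPE('a) \<times> UNIV" and z: "norm z \<le> \<rho>" and \<theta>: "\<theta> \<in> sphere 0 1"
    obtain k l j where kl: "x = ((k, l), j)" by (metis surj_pair)
    have i: "(k, l) \<in> harmonic_index TYPE('a)" using x kl by simp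
    have "norm (c k l j * z ^ (k + 2 * j) * Y k l \<theta>) = norm (c k l j) * norm z ^ (k + 2 * j) * norm (Y k l \<theta>)"
      by (simp add: norm_mult norm_power)
    also have "\<dots> \<le> (\<bar>D\<bar> * q ^ k) * \<rho> ^ (k + 2 * j) * (C * q ^ k)"
    proof (intro mult_mono power_mono z C(3) i \<theta>)
      have "D * q ^ k \<le> \<bar>D\<bar> * q ^ k" using q by (intro mult_right_mono) auto
      then show "norm (c k l j) \<le> \<bar>D\<bar> * q ^ k" using D [OF i, of j] by linarith
    qed (use q \<rho> C in auto)
    also have "\<dots> = M x"
      by (simp add: M_def kl power_add power_mult_distrib mult_ac flip: power_mult)
    finally show "norm (sterm c z \<theta> x) \<le> M x"
      by (simp add: kl)
  qed
qed

text \<open>The Weierstrass test. The range \<open>J\<close> of j is a parameter: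
  \<open>{..<N}\<close> for Almansi series and \<open>UNIV\<close> for functions of the Hardy
  space.\<close>

lemma series_uniform_limit:
  assumes c: "subexponential c" and \<rho>: "0 \<le> \<rho>" "\<rho> < 1"
  shows "uniform_limit {(z, \<theta>). norm z \<le> \<rho> \<and> \<theta> \<in> sphere 0 1}
    (\<lambda>X (z, \<theta>). sum (sterm c z \<theta>) (X))
    (\<lambda>(z, \<theta>). infsum (sterm c z \<theta>) (harmonic_index TYPE('a) \<times> J))
    (finite_subsets_at_top (harmonic_index TYPE('a) \<times> J))"
proof -
  obtain M where M: "M summable_on (harmonic_index TYPE('a) \<times> UNIV)"
    "\<And>x z \<theta>. x \<in> harmonic_index TYPE('a) \<times> UNIV \<Longrightarrow> norm z \<le> \<rho> \<Longrightarrow> \<theta> \<in> sphere 0 1 \<Longrightarrow>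
      norm (sterm c z \<theta> x) \<le> M x"
    using series_majorant [OF assms] by blast
  have "M summable_on (harmonic_index TYPE('a) \<times> J)"
    by (rule summable_on_subset_banach [OF M(1)]) auto
  then have "uniform_limit {(z, \<theta>). norm z \<le> \<rho> \<and> \<theta> \<in> sphere 0 1}
    (\<lambda>X y. \<Sum>x\<in>X. case y of (z, \<theta>) \<Rightarrow> (sterm c z \<theta>) x)
    (\<lambda>y. \<Sum>\<^sub>\<infinity>x\<in>harmonic_index TYPE('a) \<times> J. case y of (z, \<theta>) \<Rightarrow> (sterm c z \<theta>) x)
    (finite_subsets_at_top (harmonic_index TYPE('a) \<times> J))"
    by (intro Weierstrass_m_test_general [where M = M]) (use M(2) in auto)
  then show ?thesis
    by (simp add: case_prod_unfold)
qed

lemma series_summable: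
  assumes c: "subexponential c" and z: "norm z < 1" and \<theta>: "\<theta> \<in> sphere 0 1"
  shows "(sterm c z \<theta>) summable_on (harmonic_index TYPE('a) \<times> J)"
proof -
  obtain M where M: "M summable_on (harmonic_index TYPE('a) \<times> UNIV)"
    "\<And>x z' \<theta>. x \<in> harmonic_index TYPE('a) \<times> UNIV \<Longrightarrow> norm z' \<le> norm z \<Longrightarrow> \<theta> \<in> sphere 0 1 \<Longrightarrow>
      norm (sterm c z' \<theta> x) \<le> M x"
    using series_majorant [OF c norm_ge_zero z] by blast
  have "(\<lambda>x. norm (sterm c z \<theta> x)) summable_on (harmonic_index TYPE('a) \<times> UNIV)"
    by (rule Infinite_Sum.abs_summable_on_comparison_test' [OF M(1) M(2)]) (use \<theta> in auto)
  then have "(sterm c z \<theta>) summable_on (harmonic_index TYPE('a) \<times> UNIV)"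
    by (rule abs_summable_summable)
  then show ?thesis
    by (rule summable_on_subset_banach) auto
qed

lemma finite_series_coeff:
  assumes X: "finite X" "X \<subseteq> harmonic_index TYPE('a) \<times> UNIV" and kl: "(k, l) \<in> harmonic_index TYPE('a)"
  shows "(SINT \<theta>. sum (sterm c z \<theta>) X * Y k l \<theta>) =
    (\<Sum>(kl, j)\<in>X. if kl = (k, l) then c k l j * z ^ (k + 2 * j) else 0)"
proof -
  let ?\<phi> = "\<lambda>(kl, j). if kl = (k, l) then c k l j * z ^ (k + 2 * j) else 0"
  have "(SINT \<theta>. sum (sterm c z \<theta>) X * Y k l \<theta>) =
    (SINT \<theta>. (\<Sum>x\<in>X. case x of ((k', l'), j) \<Rightarrow> (c k' l' j * z ^ (k' + 2 * j)) * (Y k' l' \<theta> * Y k l \<theta>)))"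
    by (simp add: sum_distrib_right case_prod_unfold mult.assoc)
  also have "\<dots> = (\<Sum>x\<in>X. (SINT \<theta>. (case x of ((k', l'), j) \<Rightarrow> (c k' l' j * z ^ (k' + 2 * j)) * (Y k' l' \<theta> * Y k l \<theta>))))"
  proof (rule Bochner_Integration.integral_sum)
    fix x assume "x \<in> X"
    then obtain k' l' j where x: "x = ((k', l'), j)" "(k', l') \<in> harmonic_index TYPE('a)" using X by auto
    show "integrable sphere_measure (\<lambda>\<theta>. case x of ((k', l'), j) \<Rightarrow> (c k' l' j * z ^ (k' + 2 * j)) * (Y k' l' \<theta> * Y k l \<theta>))"
      unfolding x prod.case
      by (intro integrable_sphere_measure continuous_on_mult continuous_on_const continuous_on_Y x kl)
  qed
  also have "\<dots> = sum ?\<phi> X"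
  proof (rule sum.cong [OF refl])
    fix x assume "x \<in> X"
    then obtain k' l' j where x: "x = ((k', l'), j)" "(k', l') \<in> harmonic_index TYPE('a)" using X by auto
    show "(SINT \<theta>. (case x of ((k', l'), j) \<Rightarrow> (c k' l' j * z ^ (k' + 2 * j)) * (Y k' l' \<theta> * Y k l \<theta>))) = ?\<phi> x"
      unfolding x prod.case integral_mult_right_zero Y_orthonormal [OF x(2) kl] by simp
  qed
  finally show ?thesis .
qed

text \<open>On a sphere the finite partial sums converge uniformly, so the moments pass to the
  limit; by orthonormality only the terms with index (k, l) survive.\<close>

lemma
  assumes c: "subexponential c" and z: "norm z < 1"
  shows continuous_on_series:
      "continuous_on (sphere 0 1) (\<lambda>\<theta>. infsum (sterm c z \<theta>) (harmonic_index TYPE('a) \<times> J))"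
    and series_coeffs: "(k, l) \<in> harmonic_index TYPE('a) \<Longrightarrow> ((\<lambda>j. c k l j * z ^ (k + 2 * j)) has_sum
      (SINT \<theta>. (infsum (sterm c z \<theta>) (harmonic_index TYPE('a) \<times> J)) * Y k l \<theta>)) J"
proof -
  let ?F = "finite_subsets_at_top (harmonic_index TYPE('a) \<times> J)"
  let ?f = "\<lambda>X \<theta>. sum (sterm c z \<theta>) (X)"
  let ?l = "\<lambda>\<theta>. infsum (sterm c z \<theta>) (harmonic_index TYPE('a) \<times> J)"
  have ul: "uniform_limit (sphere 0 1) ?f ?l ?F"
  proof (rule uniform_limitI)
    fix e :: real assume "0 < e"
    from uniform_limitD [OF series_uniform_limit [OF c norm_ge_zero z, of J] this]
    show "\<forall>\<^sub>F X in ?F. \<forall>\<theta>\<in>sphere 0 1. dist (?f X \<theta>) (?l \<theta>) < e"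
      by eventually_elim auto
  qed
  have cont: "\<forall>\<^sub>F X in ?F. continuous_on (sphere 0 1) (?f X)"
    by (rule eventually_finite_subsets_at_top_weakI)
       (auto intro!: continuous_intros continuous_on_Y)
  show "continuous_on (sphere 0 1) ?l"
    by (rule uniform_limit_theorem [OF cont ul]) simp
  assume kl: "(k, l) \<in> harmonic_index TYPE('a)"
  define \<phi> where "\<phi> = (\<lambda>(kl, j). if kl = (k, l) then c k l j * z ^ (k + 2 * j) else 0)"
  have "((\<lambda>X. SINT \<theta>. ?f X \<theta> * Y k l \<theta>) \<longlongrightarrow> (SINT \<theta>. ?l \<theta> * Y k l \<theta>)) ?F"
    by (rule sphere_integral_uniform_limit [OF ul _ cont continuous_on_Y [OF kl]]) simp
  moreover have "\<forall>\<^sub>F X in ?F. (SINT \<theta>. ?f X \<theta> * Y k l \<theta>) = sum \<phi> X"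
    unfolding \<phi>_def
    by (rule eventually_finite_subsets_at_top_weakI) (intro finite_series_coeff kl, auto)
  ultimately have "(sum \<phi> \<longlongrightarrow> (SINT \<theta>. ?l \<theta> * Y k l \<theta>)) ?F"
    by (rule Lim_transform_eventually)
  then have "(\<phi> has_sum (SINT \<theta>. ?l \<theta> * Y k l \<theta>)) (harmonic_index TYPE('a) \<times> J)"
    by (simp add: has_sum_def)
  \<comment> \<open>\<open>\<phi>\<close> vanishes off the fibre over (k, l), so the sum reduces to
    one over j.\<close>
  then have "(\<phi> has_sum (SINT \<theta>. ?l \<theta> * Y k l \<theta>)) ((\<lambda>j. ((k, l), j)) ` J)"
    by (rule has_sum_cong_neutral [THEN iffD1, rotated -1]) (auto simp: \<phi>_def kl split: if_splits)
  then have "(\<phi> \<circ> (\<lambda>j. ((k, l), j)) has_sum (SINT \<theta>. ?l \<theta> * Y k l \<theta>)) J"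
    by (subst (asm) has_sum_reindex) (auto simp: inj_on_def)
  then show "((\<lambda>j. c k l j * z ^ (k + 2 * j)) has_sum (SINT \<theta>. ?l \<theta> * Y k l \<theta>)) J"
    by (simp add: \<phi>_def o_def)
qed

end

section \<open>The Almansi expansion\<close>

text \<open>Evaluation at the points of S is injective on polynomials of degree below
  \<open>card S\<close>, so values control coefficients. Induction on S by dividing off one node.
  The alternative \<open>p = 0\<close> covers empty S and a vanishing quotient.\<close>

lemma poly_coeff_bound:
  assumes "finite (S :: complex set)"
  shows "\<exists>C\<ge>0. \<forall>p A. degree p < card S \<or> p = 0 \<longrightarrow> (\<forall>s\<in>S. norm (poly p s) \<le> A) \<longrightarrow> 0 \<le> A \<longrightarrow>
    (\<forall>j. norm (coeff p j) \<le> C * A)"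
  using assms
proof induction
  case empty
  then show ?case by (intro exI [of _ 0]) auto
next
  case (insert s0 S)
  then obtain C where C0: "0 \<le> C" and C1: "\<forall>p A. degree p < card S \<or> p = 0 \<longrightarrow>
      (\<forall>s\<in>S. norm (poly p s) \<le> A) \<longrightarrow> 0 \<le> A \<longrightarrow> (\<forall>j. norm (coeff p j) \<le> C * A)"
    by blast
  \<comment> \<open>The quotient at s is (p(s) - p(s0)) / (s - s0), of norm at most 2A / |s - s0|;
    the sum over S dominates all these bounds at once.\<close>
  define K where "K = (\<Sum>s\<in>S. 2 / norm (s - s0))"
  have K0: "0 \<le> K" unfolding K_def by (intro sum_nonneg) auto
  \<comment> \<open>A coefficient of p is -s0 times one of the quotient plus the preceding one, or
    plus p(s0) at index 0: the three summands.\<close>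
  define C' where "C' = norm s0 * (C * K) + C * K + 1"
  have "norm (coeff p j) \<le> C' * A"
    if p: "degree p < card (insert s0 S) \<or> p = 0" "\<forall>s\<in>insert s0 S. norm (poly p s) \<le> A" "0 \<le> A" for p A j
  proof -
    define q where "q = synthetic_div p s0"
    have pq: "p = [:- s0, 1:] * q + [:poly p s0:]"
      unfolding q_def by (rule synthetic_div_correct' [symmetric])
    have dq: "degree q < card S \<or> q = 0"
      using p(1) insert.hyps synthetic_div_eq_0_iff [of p s0]
      by (cases "degree p = 0") (auto simp: q_def degree_synthetic_div)
    have "norm (poly q s) \<le> K * A" if s: "s \<in> S" for s
    proof -
      have ne: "s - s0 \<noteq> 0" using s insert.hyps by auto
      have "poly p s = (s - s0) * poly q s + poly p s0"
        using arg_cong [where f = "\<lambda>p. poly p s", OF pq] by (simp add: algebra_simps)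
      then have "norm (s - s0) * norm (poly q s) = norm (poly p s - poly p s0)"
        by (simp add: norm_mult)
      also have "\<dots> \<le> 2 * A"
        using norm_triangle_ineq4 [of "poly p s" "poly p s0"] p(2) s by fastforce
      finally have "norm (poly q s) \<le> 2 / norm (s - s0) * A"
        using ne by (simp add: field_simps)
      also have "2 / norm (s - s0) \<le> K"
        unfolding K_def using s insert.hyps by (intro member_le_sum) auto
      then have "2 / norm (s - s0) * A \<le> K * A"
        by (rule mult_right_mono [OF _ p(3)])
      finally show ?thesis .
    qed
    then have q: "norm (coeff q j) \<le> C * (K * A)" for j
      by (rule C1 [rule_format, OF dq _ mult_nonneg_nonneg [OF K0 p(3)]])
    have "coeff p j = coeff ([:- s0, 1:] * q + [:poly p s0:]) j"
      by (rule arg_cong [where f = "\<lambda>p. coeff p j", OF pq])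
    also have "\<dots> = - s0 * coeff q j + (case j of 0 \<Rightarrow> poly p s0 | Suc i \<Rightarrow> coeff q i)"
      by (cases j) (auto simp: coeff_pCons)
    also have "norm \<dots> \<le> norm s0 * norm (coeff q j) + norm (case j of 0 \<Rightarrow> poly p s0 | Suc i \<Rightarrow> coeff q i)"
      using norm_triangle_ineq by (metis norm_minus_cancel norm_mult mult_minus_left)
    also have "\<dots> \<le> norm s0 * (C * (K * A)) + (C * (K * A) + A)"
    proof (intro add_mono mult_left_mono q)
      have "0 \<le> C * (K * A)" using C0 K0 p(3) by auto
      then show "norm (case j of 0 \<Rightarrow> poly p s0 | Suc i \<Rightarrow> coeff q i) \<le> C * (K * A) + A"
        using q p(2,3) by (auto split: nat.split intro: add_increasing add_increasing2)
    qed auto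
    also have "\<dots> = C' * A"
      by (simp add: C'_def algebra_simps)
    finally show ?thesis .
  qed
  moreover have "0 \<le> C'"
    using C0 K0 by (auto simp: C'_def intro!: add_nonneg_nonneg)
  ultimately show ?case by blast
qed

text \<open>After division by r^k the sum is a polynomial of degree below N in r^2, and N distinct
  positive radii have distinct squares. Nodes in [\<open>\<rho>\<close>, 1) make the division cost
  at most \<open>\<rho>\<close>^(-k), while R and C do not depend on k.\<close>

lemma radial_coeff_bound:
  assumes \<rho>: "0 < \<rho>" "\<rho> < 1"
  shows "\<exists>R C. finite R \<and> R \<subseteq> {\<rho>..<1::real} \<and> 0 \<le> C \<and>
    (\<forall>c k A. (\<forall>r\<in>R. norm (\<Sum>j<N. c j * complex_of_real r ^ (k + 2 * j)) \<le> A) \<longrightarrow> 0 \<le> A \<longrightarrow>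
      (\<forall>j<N. norm (c j) \<le> C * A / \<rho> ^ k))"
proof -
  obtain R where R: "R \<subseteq> {\<rho>..<1}" "finite R" "card R = N"
    using infinite_arbitrarily_large [of "{\<rho>..<1}" N] \<rho> by (auto simp: infinite_Ico_iff)
  let ?S = "(\<lambda>r. complex_of_real r ^ 2) ` R"
  have "inj_on (\<lambda>r. complex_of_real r ^ 2) R"
  proof (rule inj_onI)
    fix x y assume "x \<in> R" "y \<in> R" "complex_of_real x ^ 2 = complex_of_real y ^ 2"
    then have "x\<^sup>2 = y\<^sup>2" by (metis of_real_eq_iff of_real_power)
    moreover have "0 \<le> x" "0 \<le> y" using \<open>x \<in> R\<close> \<open>y \<in> R\<close> R(1) \<rho> by auto
    ultimately show "x = y" by (rule power2_eq_imp_eq)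
  qed
  then have card: "card ?S = N" using R by (simp add: card_image)
  obtain C where C: "0 \<le> C \<and> (\<forall>p A. degree p < card ?S \<or> p = 0 \<longrightarrow>
      (\<forall>s\<in>?S. norm (poly p s) \<le> A) \<longrightarrow> 0 \<le> A \<longrightarrow> (\<forall>j. norm (coeff p j) \<le> C * A))"
    using poly_coeff_bound [OF finite_imageI [OF R(2), of "\<lambda>r. complex_of_real r ^ 2"]] by (elim exE)
  note C0 = conjunct1 [OF C] and C1 = conjunct2 [OF C, unfolded card]
  have "norm (c j) \<le> C * A / \<rho> ^ k"
    if b: "\<forall>r\<in>R. norm (\<Sum>j<N. c j * complex_of_real r ^ (k + 2 * j)) \<le> A" and A: "0 \<le> A" and j: "j < N"
    for c k A j
  proof -
    define p where "p = (\<Sum>j<N. monom (c j) j)"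
    have coeff: "coeff p i = (if i < N then c i else 0)" for i
      by (simp add: p_def coeff_sum)
    have "degree p < N \<or> p = 0"
    proof (cases N)
      case (Suc n)
      have "degree p \<le> n" using Suc by (intro degree_le) (auto simp: coeff)
      then show ?thesis using Suc by simp
    qed (simp add: p_def)
    moreover have "norm (poly p s) \<le> A / \<rho> ^ k" if s: "s \<in> ?S" for s
    proof -
      obtain r where r: "r \<in> R" "s = complex_of_real r ^ 2" using s by auto
      then have r\<rho>: "\<rho> \<le> r" using R by auto
      have "(\<Sum>j<N. c j * complex_of_real r ^ (k + 2 * j)) = complex_of_real r ^ k * poly p s"
        unfolding p_def poly_sum poly_monom sum_distrib_left r(2)
        by (intro sum.cong refl) (simp add: power_add mult_ac flip: power_mult)
      then have "r ^ k * norm (poly p s) \<le> A"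
        using bspec [OF b r(1)] r\<rho> \<rho> by (simp add: norm_mult norm_power)
      moreover have "\<rho> ^ k * norm (poly p s) \<le> r ^ k * norm (poly p s)"
        using r\<rho> \<rho> by (intro mult_right_mono power_mono) auto
      ultimately show ?thesis
        using \<rho> by (simp add: field_simps)
    qed
    moreover have "0 \<le> A / \<rho> ^ k"
      using A \<rho> by simp
    ultimately have "norm (coeff p j) \<le> C * (A / \<rho> ^ k)"
      by (rule C1 [rule_format])
    then show ?thesis
      using j by (simp add: coeff)
  qed
  then show ?thesis
    by (intro exI [of _ R] exI [of _ C] conjI R C0 allI impI)
qed

text \<open>The coefficient bound with A = 0, applied to the difference.\<close>

lemma radial_coeffs_unique:
  assumes "\<And>r. 0 < r \<Longrightarrow> r < 1 \<Longrightarrow>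
    (\<Sum>j<N. c j * complex_of_real r ^ (k + 2 * j)) = (\<Sum>j<N. c' j * complex_of_real r ^ (k + 2 * j))"
    and "j < N"
  shows "c j = c' j"
proof -
  obtain R C where R: "R \<subseteq> {1 / 2..<1::real}"
    and C: "\<forall>c k A. (\<forall>r\<in>R. norm (\<Sum>j<N. c j * complex_of_real r ^ (k + 2 * j)) \<le> A) \<longrightarrow> 0 \<le> A \<longrightarrow>
      (\<forall>j<N. norm (c j) \<le> C * A / (1 / 2) ^ k)"
    using radial_coeff_bound [of "1 / 2" N] by auto
  have "norm (\<Sum>j<N. (c j - c' j) * complex_of_real r ^ (k + 2 * j)) \<le> 0" if "r \<in> R" for r
  proof -
    have "0 < r" "r < 1" using that R by auto
    then show ?thesis
      using assms(1) by (simp add: left_diff_distrib sum_subtractf)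
  qed
  then have "norm (c j - c' j) \<le> C * 0 / (1 / 2) ^ k"
    using spec [OF C, of "\<lambda>j. c j - c' j"] assms(2) by blast
  then show ?thesis by simp
qed

context sphere_basis
begin

text \<open>With nodes in [1/q, 1) the loss of \<open>radial_coeff_bound\<close> is q^k; the
  finitely many bounds at the nodes are added up.\<close>

lemma subexponentialI:
  assumes 0: "\<And>k l j. N \<le> j \<Longrightarrow> c k l j = 0"
    and bound: "\<And>r. 0 < r \<Longrightarrow> r < 1 \<Longrightarrow> \<exists>M. \<forall>k l. (k, l) \<in> harmonic_index TYPE('a) \<longrightarrow>
      norm (\<Sum>j<N. c k l j * complex_of_real r ^ (k + 2 * j)) \<le> M"
  shows "subexponential c"
  unfolding subexponential_def
proof (intro allI impI)
  fix q :: real assume q: "1 < q"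
  have \<rho>: "0 < 1 / q" "1 / q < 1" using q by auto
  obtain R C where R: "finite R" "R \<subseteq> {1 / q..<1}" "0 \<le> C"
    and C: "\<forall>c k A. (\<forall>r\<in>R. norm (\<Sum>j<N. c j * complex_of_real r ^ (k + 2 * j)) \<le> A) \<longrightarrow> 0 \<le> A \<longrightarrow>
      (\<forall>j<N. norm (c j) \<le> C * A / (1 / q) ^ k)"
    using radial_coeff_bound [OF \<rho>, of N] by blast
  have "\<exists>M. \<forall>k l. (k, l) \<in> harmonic_index TYPE('a) \<longrightarrow> norm (\<Sum>j<N. c k l j * complex_of_real r ^ (k + 2 * j)) \<le> M" if "r \<in> R" for r
  proof (rule bound)
    have "1 / q \<le> r" "r < 1" using that R(2) by auto
    then show "0 < r" "r < 1" using \<rho>(1) by linarith+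
  qed
  then obtain M where M: "\<And>r k l. r \<in> R \<Longrightarrow> (k, l) \<in> harmonic_index TYPE('a) \<Longrightarrow> norm (\<Sum>j<N. c k l j * complex_of_real r ^ (k + 2 * j)) \<le> M r"
    by metis
  define A where "A = (\<Sum>r\<in>R. \<bar>M r\<bar>)"
  have A0: "0 \<le> A" by (simp add: A_def sum_nonneg)
  have "norm (c k l j) \<le> (C * A) * q ^ k" if kl: "(k, l) \<in> harmonic_index TYPE('a)" for k l j
  proof (cases "j < N")
    case True
    have "norm (\<Sum>j<N. c k l j * complex_of_real r ^ (k + 2 * j)) \<le> A" if r: "r \<in> R" for r
    proof -
      have "M r \<le> \<bar>M r\<bar>" by simp
      also have "\<bar>M r\<bar> \<le> A" unfolding A_def using r R(1) by (intro member_le_sum) auto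
      finally show ?thesis
        using M [OF r kl] by simp
    qed
    then have "norm (c k l j) \<le> C * A / (1 / q) ^ k"
      using spec [OF C, of "c k l"] A0 True by blast
    then show ?thesis by (simp add: power_one_over)
  next
    case False
    then show ?thesis using 0 R(3) A0 q by simp
  qed
  then show "\<exists>C. \<forall>k l j. (k, l) \<in> harmonic_index TYPE('a) \<longrightarrow> norm (c k l j) \<le> C * q ^ k"
    by blast
qed

section \<open>Existence and uniqueness of the expansion\<close>

text \<open>Since |Y| <= 1 + |Y|^2, normalization bounds the integrals of |Y| uniformly in k and
  l.\<close>

lemma sphere_coeffs_bounded:
  fixes f :: "'a \<Rightarrow> complex"
  assumes f: "continuous_on (sphere 0 1) f"
  shows "\<exists>M. \<forall>k l. (k, l) \<in> harmonic_index TYPE('a) \<longrightarrow> norm (SINT \<theta>. f \<theta> * Y k l \<theta>) \<le> M"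
proof -
  have "bounded (f ` sphere 0 1)"
    by (intro compact_imp_bounded compact_continuous_image f compact_sphere)
  then obtain B where B: "\<And>x. x \<in> sphere 0 1 \<Longrightarrow> norm (f x) \<le> B"
    unfolding bounded_iff by blast
  have "norm (SINT \<theta>. f \<theta> * Y k l \<theta>) \<le> \<bar>B\<bar> * (measure sphere_measure (sphere (0::'a) 1) + 1)"
    if kl: "(k, l) \<in> harmonic_index TYPE('a)" for k l
  proof -
    have i: "integrable sphere_measure (\<lambda>\<theta>. (norm (Y k l \<theta>))\<^sup>2)"
      by (intro integrable_sphere_measure continuous_on_power continuous_on_norm continuous_on_Y kl)
    note sq = Y_norm_integral [OF kl]
    have "norm (SINT \<theta>. f \<theta> * Y k l \<theta>) \<le> (SINT \<theta>. norm (f \<theta> * Y k l \<theta>))"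
      by (rule integral_norm_bound)
    also have "\<dots> \<le> (SINT \<theta>. \<bar>B\<bar> * (1 + (norm (Y k l \<theta>))\<^sup>2))"
    proof (rule integral_mono)
      show "integrable sphere_measure (\<lambda>\<theta>. norm (f \<theta> * Y k l \<theta>))"
        by (intro integrable_sphere_measure continuous_intros f continuous_on_Y kl)
      show "integrable sphere_measure (\<lambda>\<theta>. \<bar>B\<bar> * (1 + (norm (Y k l \<theta>))\<^sup>2))"
        using i by simp
      fix \<theta> :: 'a assume "\<theta> \<in> space sphere_measure"
      then have "norm (f \<theta>) \<le> \<bar>B\<bar>" using B by (force simp: space_sphere_measure)
      moreover have "norm (Y k l \<theta>) \<le> 1 + (norm (Y k l \<theta>))\<^sup>2"
      proof -
        have "0 \<le> (norm (Y k l \<theta>) - 1 / 2)\<^sup>2" by simp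
        then show ?thesis by (simp add: power2_eq_square algebra_simps)
      qed
      ultimately show "norm (f \<theta> * Y k l \<theta>) \<le> \<bar>B\<bar> * (1 + (norm (Y k l \<theta>))\<^sup>2)"
        unfolding norm_mult by (intro mult_mono) auto
    qed
    also have "\<dots> = \<bar>B\<bar> * (measure sphere_measure (sphere (0::'a) 1) + 1)"
      using i sq by (simp add: space_sphere_measure)
    finally show ?thesis .
  qed
  then show ?thesis by blast
qed

lemma almansi_partial_sum:
  "(\<Sum>k<n. \<Sum>l=1..harmonic_dim TYPE('a) k. \<Sum>j<N. c k l j * z ^ (k + 2 * j) * Y k l \<theta>) =
   sum (sterm c z \<theta>) ((SIGMA k:{..<n}. {1..harmonic_dim TYPE('a) k}) \<times> {..<N})"
  by (subst sum.Sigma, simp, simp, subst sum.cartesian_product [symmetric]) (simp add: case_prod_unfold)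

text \<open>The closed ball of radius r is an admissible compact set, so the expansion converges
  uniformly on its boundary sphere and may be integrated against Y. This is the uniqueness half: the
  moments of u fix the coefficients.\<close>

lemma almansi_expansion_coeffs:
  fixes u :: "'a \<Rightarrow> complex"
  assumes ex: "almansi_expansion N Y u c" and kl: "(k, l) \<in> harmonic_index TYPE('a)" and r: "0 \<le> r" "r < 1"
  shows "(SINT \<theta>. u (r *\<^sub>R \<theta>) * Y k l \<theta>) = (\<Sum>j<N. c k l j * of_real r ^ (k + 2 * j))"
proof -
  let ?X = "\<lambda>n. (SIGMA k:{..<n}. {1..harmonic_dim TYPE('a) k}) \<times> {..<N}"
  let ?f = "\<lambda>n \<theta>. sum (sterm c (of_real r) \<theta>) (?X n)"
  have fin: "finite (?X n)" "?X n \<subseteq> harmonic_index TYPE('a) \<times> UNIV" for n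
    by (auto simp: harmonic_index_def)
  have K: "compact (cball (0::'a) r)" "cball (0::'a) r \<subseteq> ball 0 1" using r by auto
  have lim: "uniform_limit {(t, \<theta>). 0 \<le> t \<and> \<theta> \<in> sphere 0 1 \<and> t *\<^sub>R \<theta> \<in> cball 0 r}
          (\<lambda>n (r, \<theta>). \<Sum>k<n. \<Sum>l=1..harmonic_dim TYPE('a) k. \<Sum>j<N.
             c k l j * of_real r ^ (k + 2 * j) * Y k l \<theta>)
          (\<lambda>(r, \<theta>). u (r *\<^sub>R \<theta>)) sequentially"
    using ex K unfolding almansi_expansion_def by blast
  have ul: "uniform_limit (sphere 0 1) ?f (\<lambda>\<theta>. u (r *\<^sub>R \<theta>)) sequentially"
  proof (rule uniform_limitI)
    fix e :: real assume "0 < e"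
    from uniform_limitD [OF lim this]
    show "\<forall>\<^sub>F n in sequentially. \<forall>\<theta>\<in>sphere 0 1. dist (?f n \<theta>) (u (r *\<^sub>R \<theta>)) < e"
    proof eventually_elim
      case (elim n)
      show ?case
      proof
        fix \<theta> :: 'a assume \<theta>: "\<theta> \<in> sphere 0 1"
        then have "(r, \<theta>) \<in> {(t, \<theta>). 0 \<le> t \<and> \<theta> \<in> sphere 0 1 \<and> t *\<^sub>R \<theta> \<in> cball 0 r}"
          using r by simp
        from bspec [OF elim this] show "dist (?f n \<theta>) (u (r *\<^sub>R \<theta>)) < e"
          by (simp only: prod.case almansi_partial_sum)
      qed
    qed
  qed
  have cont: "continuous_on (sphere 0 1) (?f n)" for n
    by (auto intro!: continuous_intros continuous_on_Y simp: index_iff)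
  have "(\<lambda>n. SINT \<theta>. ?f n \<theta> * Y k l \<theta>) \<longlonglongrightarrow> (SINT \<theta>. u (r *\<^sub>R \<theta>) * Y k l \<theta>)"
    by (rule sphere_integral_uniform_limit [OF ul trivial_limit_sequentially always_eventually [OF allI [OF cont]]
          continuous_on_Y [OF kl]])
  moreover have "\<forall>\<^sub>F n in sequentially. (SINT \<theta>. ?f n \<theta> * Y k l \<theta>) = (\<Sum>j<N. c k l j * of_real r ^ (k + 2 * j))"
  proof (rule eventually_sequentiallyI)
    \<comment> \<open>Once the partial sum includes degree k, its moment no longer changes.\<close>
    fix n assume n: "Suc k \<le> n"
    have "(SINT \<theta>. ?f n \<theta> * Y k l \<theta>) =
      (\<Sum>(kl, j)\<in>?X n. if kl = (k, l) then c k l j * of_real r ^ (k + 2 * j) else 0)"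
      by (rule finite_series_coeff [OF fin kl])
    also have "\<dots> = (\<Sum>(kl, j)\<in>{(k, l)} \<times> {..<N}. c k l j * of_real r ^ (k + 2 * j))"
      using n kl by (intro sum.mono_neutral_cong_right) (auto simp: index_iff split: if_splits)
    also have "\<dots> = (\<Sum>j<N. c k l j * of_real r ^ (k + 2 * j))"
      by (simp add: sum.cartesian_product [symmetric])
    finally show "(SINT \<theta>. ?f n \<theta> * Y k l \<theta>) = \<dots>" .
  qed
  ultimately have "(\<lambda>n. \<Sum>j<N. c k l j * of_real r ^ (k + 2 * j)) \<longlonglongrightarrow> (SINT \<theta>. u (r *\<^sub>R \<theta>) * Y k l \<theta>)"
    by (rule Lim_transform_eventually)
  then show ?thesis
    by (simp add: LIMSEQ_const_iff)
qed

text \<open>Both sides are continuous on the sphere and have the same moments, so completeness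
  identifies them.\<close>

lemma series_eq:
  fixes u :: "'a \<Rightarrow> complex"
  assumes c: "subexponential c" and u: "continuous_on (ball 0 1) u" and r: "0 \<le> r" "r < 1"
    and coeffs: "\<And>k l. (k, l) \<in> harmonic_index TYPE('a) \<Longrightarrow>
      (SINT \<theta>. u (r *\<^sub>R \<theta>) * Y k l \<theta>) = (\<Sum>j<N. c k l j * of_real r ^ (k + 2 * j))"
    and \<theta>: "\<theta> \<in> sphere 0 1"
  shows "(\<Sum>\<^sub>\<infinity>((k, l), j)\<in>harmonic_index TYPE('a) \<times> {..<N}. c k l j * of_real r ^ (k + 2 * j) * Y k l \<theta>) = u (r *\<^sub>R \<theta>)"
proof (rule sphere_function_eqI [OF _ _ _ \<theta>])
  have z: "norm (complex_of_real r) < 1" using r by simp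
  show "continuous_on (sphere 0 1) (\<lambda>\<theta>. \<Sum>\<^sub>\<infinity>((k, l), j)\<in>harmonic_index TYPE('a) \<times> {..<N}. c k l j * of_real r ^ (k + 2 * j) * Y k l \<theta>)"
    by (rule continuous_on_series [OF c z])
  show "continuous_on (sphere 0 1) (\<lambda>\<theta>. u (r *\<^sub>R \<theta>))"
    by (rule continuous_on_compose2 [OF u]) (use r in \<open>auto intro!: continuous_intros\<close>)
  fix k l assume kl: "(k, l) \<in> harmonic_index TYPE('a)"
  have "((\<lambda>j. c k l j * of_real r ^ (k + 2 * j)) has_sum (\<Sum>j<N. c k l j * of_real r ^ (k + 2 * j))) {..<N}"
    by (rule has_sum_finite) simp
  with series_coeffs [OF c z kl, of "{..<N}"]
  show "(SINT \<theta>. (\<Sum>\<^sub>\<infinity>((k, l), j)\<in>harmonic_index TYPE('a) \<times> {..<N}. c k l j * of_real r ^ (k + 2 * j) * Y k l \<theta>) * Y k l \<theta>)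
    = (SINT \<theta>. u (r *\<^sub>R \<theta>) * Y k l \<theta>)"
    unfolding coeffs [OF kl] by (rule has_sum_unique)
qed

text \<open>The Almansi partial sums form a cofinal sequence of finite index sets, so unconditional
  uniform convergence yields convergence in the order of the definition.\<close>

lemma filterlim_almansi_index:
  fixes N :: nat
  shows
  "filterlim (\<lambda>n. (SIGMA k:{..<n}. {1..harmonic_dim TYPE('a) k}) \<times> {..<N})
    (finite_subsets_at_top (harmonic_index TYPE('a) \<times> {..<N})) sequentially"
  unfolding filterlim_finite_subsets_at_top
proof (intro allI impI)
  fix X assume X: "finite X \<and> X \<subseteq> harmonic_index TYPE('a) \<times> {..<N}"
  define m where "m = Suc (Max ((fst \<circ> fst) ` X))"
  have m: "k < m" if "((k, l), j) \<in> X" for k l j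
  proof -
    have "(fst \<circ> fst) ((k, l), j) \<le> Max ((fst \<circ> fst) ` X)"
      using X that by (intro Max_ge) (auto intro!: image_eqI [where x = "((k, l), j)"])
    then show ?thesis by (simp add: m_def)
  qed
  have "X \<subseteq> (SIGMA k:{..<n}. {1..harmonic_dim TYPE('a) k}) \<times> {..<N}" if "m \<le> n" for n
    using X m that by (fastforce simp: harmonic_index_def)
  then show "\<forall>\<^sub>F n in sequentially. finite ((SIGMA k:{..<n}. {1..harmonic_dim TYPE('a) k}) \<times> {..<N}) \<and>
      X \<subseteq> (SIGMA k:{..<n}. {1..harmonic_dim TYPE('a) k}) \<times> {..<N} \<and>
      (SIGMA k:{..<n}. {1..harmonic_dim TYPE('a) k}) \<times> {..<N} \<subseteq> harmonic_index TYPE('a) \<times> {..<N}"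
    by (intro eventually_sequentiallyI [of m] conjI finite_cartesian_product finite_SigmaI)
       (auto simp: harmonic_index_def)
qed

lemma almansi_expansionI:
  fixes u :: "'a \<Rightarrow> complex"
  assumes c: "subexponential c" and u: "continuous_on (ball 0 1) u"
    and 0: "\<And>k l j. (k, l) \<notin> harmonic_index TYPE('a) \<or> N \<le> j \<Longrightarrow> c k l j = 0"
    and coeffs: "\<And>k l r. (k, l) \<in> harmonic_index TYPE('a) \<Longrightarrow> 0 \<le> r \<Longrightarrow> r < 1 \<Longrightarrow>
      (SINT \<theta>. u (r *\<^sub>R \<theta>) * Y k l \<theta>) = (\<Sum>j<N. c k l j * of_real r ^ (k + 2 * j))"
  shows "almansi_expansion N Y u c"
  unfolding almansi_expansion_def
proof (intro conjI allI impI)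
  show "c k l j = 0" if "(k, l) \<notin> harmonic_index TYPE('a) \<or> N \<le> j" for k l j
    using 0 that .
  fix K :: "'a set" assume K: "compact K \<and> K \<subseteq> ball 0 1"
  \<comment> \<open>A compact subset of the open ball stays at a positive distance from its
    boundary.\<close>
  obtain \<rho> where \<rho>: "0 \<le> \<rho>" "\<rho> < 1" "\<And>x. x \<in> K \<Longrightarrow> norm x \<le> \<rho>"
  proof (cases "K = {}")
    case True
    then show ?thesis using that [of 0] by auto
  next
    case False
    have "continuous_on K norm" by (intro continuous_intros)
    from continuous_attains_sup [OF _ False this] K obtain x where x: "x \<in> K" "\<And>y. y \<in> K \<Longrightarrow> norm y \<le> norm x"
      by blast
    then show ?thesis using that [of "norm x"] K by auto
  qed
  show "uniform_limit {(r, \<theta>). 0 \<le> r \<and> \<theta> \<in> sphere 0 1 \<and> r *\<^sub>R \<theta> \<in> K}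
          (\<lambda>n (r, \<theta>). \<Sum>k<n. \<Sum>l=1..harmonic_dim TYPE('a) k. \<Sum>j<N.
             c k l j * of_real r ^ (k + 2 * j) * Y k l \<theta>)
          (\<lambda>(r, \<theta>). u (r *\<^sub>R \<theta>)) sequentially"
  proof (rule uniform_limitI)
    fix e :: real assume "0 < e"
    from uniform_limitD [OF series_uniform_limit [OF c \<rho>(1,2), of "{..<N}"] this]
    have "\<forall>\<^sub>F n in sequentially. \<forall>x\<in>{(z, \<theta>). norm z \<le> \<rho> \<and> \<theta> \<in> sphere 0 1}.
      dist (case x of (z, \<theta>) \<Rightarrow> sum (sterm c z \<theta>) ((SIGMA k:{..<n}. {1..harmonic_dim TYPE('a) k}) \<times> {..<N}))
       (case x of (z, \<theta>) \<Rightarrow> \<Sum>\<^sub>\<infinity>((k, l), j)\<in>harmonic_index TYPE('a) \<times> {..<N}. c k l j * z ^ (k + 2 * j) * Y k l \<theta>) < e"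
      by (rule eventually_compose_filterlim [OF _ filterlim_almansi_index])
    then show "\<forall>\<^sub>F n in sequentially. \<forall>x\<in>{(r, \<theta>). 0 \<le> r \<and> \<theta> \<in> sphere 0 1 \<and> r *\<^sub>R \<theta> \<in> K}.
      dist (case x of (r, \<theta>) \<Rightarrow> \<Sum>k<n. \<Sum>l=1..harmonic_dim TYPE('a) k. \<Sum>j<N.
             c k l j * of_real r ^ (k + 2 * j) * Y k l \<theta>) (case x of (r, \<theta>) \<Rightarrow> u (r *\<^sub>R \<theta>)) < e"
    proof eventually_elim
      case (elim n)
      show ?case
      proof safe
        fix r :: real and \<theta> :: 'a assume r: "0 \<le> r" "\<theta> \<in> sphere 0 1" "r *\<^sub>R \<theta> \<in> K"
        then have r\<rho>: "r \<le> \<rho>" using \<rho>(3) [of "r *\<^sub>R \<theta>"] by simp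
        then have "(complex_of_real r, \<theta>) \<in> {(z, \<theta>). norm z \<le> \<rho> \<and> \<theta> \<in> sphere 0 1}"
          using r by simp
        from bspec [OF elim this]
        have "dist (sum (sterm c (of_real r) \<theta>) ((SIGMA k:{..<n}. {1..harmonic_dim TYPE('a) k}) \<times> {..<N}))
          (\<Sum>\<^sub>\<infinity>((k, l), j)\<in>harmonic_index TYPE('a) \<times> {..<N}. c k l j * of_real r ^ (k + 2 * j) * Y k l \<theta>) < e"
          by (simp only: prod.case)
        also have "(\<Sum>\<^sub>\<infinity>((k, l), j)\<in>harmonic_index TYPE('a) \<times> {..<N}. c k l j * of_real r ^ (k + 2 * j) * Y k l \<theta>) = u (r *\<^sub>R \<theta>)"
          using r(1) r\<rho> \<rho>(2) by (intro series_eq [OF c u r(1) _ coeffs r(2)]) auto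
        finally show "dist (\<Sum>k<n. \<Sum>l=1..harmonic_dim TYPE('a) k. \<Sum>j<N. c k l j * of_real r ^ (k + 2 * j) * Y k l \<theta>) (u (r *\<^sub>R \<theta>)) < e"
          unfolding almansi_partial_sum .
      qed
    qed
  qed
qed

text \<open>The coefficients are read off the moments. They are subexponential because the moments
  at each radius are bounded, so they give an expansion; any other expansion has the same moments,
  which justifies the definite description.\<close>

lemma almansi_coeffs_polyharmonic:
  fixes u :: "'a \<Rightarrow> complex"
  assumes N: "1 \<le> N" and u: "polyharmonic_on N (ball 0 1) u"
  obtains c where "almansi_coeffs N Y u = c" "subexponential c"
    "\<And>k l j. (k, l) \<notin> harmonic_index TYPE('a) \<or> N \<le> j \<Longrightarrow> c k l j = 0"
    "\<And>k l j r. (k, l) \<in> harmonic_index TYPE('a) \<Longrightarrow> j \<le> N \<Longrightarrow> 0 \<le> r \<Longrightarrow> r < 1 \<Longrightarrow>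
      (SINT \<theta>. (laplacian ^^ j) u (r *\<^sub>R \<theta>) * Y k l \<theta>) =
      (\<Sum>i<N - j. of_real (laplacian_factor DIM('a) k j i) * c k l (i + j) * of_real r ^ (k + 2 * i))"
proof -
  have uc: "continuous_on (ball 0 1) u"
    using u Ck_on_mono [of "2 * N" "ball 0 1" u 0] by (simp add: polyharmonic_on_def)
  define P where "P = (\<lambda>kl c. \<forall>j\<le>N. \<forall>r. 0 \<le> r \<longrightarrow> r < 1 \<longrightarrow>
    (SINT \<theta>. (laplacian ^^ j) u (r *\<^sub>R \<theta>) * Y (fst kl) (snd kl) \<theta>) =
    (\<Sum>i<N - j. of_real (laplacian_factor DIM('a) (fst kl) j i) * c (i + j) * of_real r ^ (fst kl + 2 * i)))"
  have "\<exists>c. P kl c" if "kl \<in> harmonic_index TYPE('a)" for kl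
    unfolding P_def using that by (intro polyharmonic_radial_coeffs [OF dim Y_harmonic u]) simp
  then have "\<forall>kl\<in>harmonic_index TYPE('a). \<exists>c. P kl c"
    by blast
  then obtain c0 where c0: "\<forall>kl\<in>harmonic_index TYPE('a). P kl (c0 kl)"
    by (rule bchoice [THEN exE])
  \<comment> \<open>The extension by zero is part of \<open>almansi_expansion\<close>; it makes the
    family unique.\<close>
  define c where "c = (\<lambda>k l j. if (k, l) \<in> harmonic_index TYPE('a) \<and> j < N then c0 (k, l) j else 0)"
  have c_0: "c k l j = 0" if "(k, l) \<notin> harmonic_index TYPE('a) \<or> N \<le> j" for k l j
    using that by (auto simp: c_def)
  have cj: "(SINT \<theta>. (laplacian ^^ j) u (r *\<^sub>R \<theta>) * Y k l \<theta>) =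
      (\<Sum>i<N - j. of_real (laplacian_factor DIM('a) k j i) * c k l (i + j) * of_real r ^ (k + 2 * i))"
    if "(k, l) \<in> harmonic_index TYPE('a)" "j \<le> N" "0 \<le> r" "r < 1" for k l j r
    using bspec [OF c0 that(1)] that by (auto simp: c_def P_def intro!: sum.cong)
  have coeffs: "(SINT \<theta>. u (r *\<^sub>R \<theta>) * Y k l \<theta>) = (\<Sum>j<N. c k l j * of_real r ^ (k + 2 * j))"
    if "(k, l) \<in> harmonic_index TYPE('a)" "0 \<le> r" "r < 1" for k l r
    using cj [of k l 0 r] that by simp
  have sub: "subexponential c"
  proof (rule subexponentialI [where N = N])
    show "c k l j = 0" if "N \<le> j" for k l j using c_0 that by simp
    fix r :: real assume r: "0 < r" "r < 1"
    have "continuous_on (sphere 0 1) (\<lambda>\<theta>. u (r *\<^sub>R \<theta>))"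
      by (rule continuous_on_compose2 [OF uc]) (use r in \<open>auto intro!: continuous_intros\<close>)
    from sphere_coeffs_bounded [OF this]
    show "\<exists>M. \<forall>k l. (k, l) \<in> harmonic_index TYPE('a) \<longrightarrow> norm (\<Sum>j<N. c k l j * complex_of_real r ^ (k + 2 * j)) \<le> M"
      using coeffs r by auto
  qed
  have "almansi_coeffs N Y u = c"
    unfolding almansi_coeffs_def
  proof (rule the_equality)
    show "almansi_expansion N Y u c"
      by (rule almansi_expansionI [OF sub uc c_0 coeffs])
    fix c' assume c': "almansi_expansion N Y u c'"
    have "c' k l j = c k l j" for k l j
    proof (cases "(k, l) \<in> harmonic_index TYPE('a) \<and> j < N")
      case True
      show ?thesis
      proof (rule radial_coeffs_unique [where N = N and k = k])
        show "(\<Sum>j<N. c' k l j * complex_of_real r ^ (k + 2 * j)) = (\<Sum>j<N. c k l j * complex_of_real r ^ (k + 2 * j))"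
          if "0 < r" "r < 1" for r
          using almansi_expansion_coeffs [OF c', of k l r] coeffs [of k l r] True that by simp
      qed (use True in auto)
    next
      case False
      then have "c' k l j = 0" using c' unfolding almansi_expansion_def by (metis not_le)
      then show ?thesis using False by (auto simp: c_def)
    qed
    then show "c' = c" by (simp add: fun_eq_iff)
  qed
  then show thesis
    by (rule that [OF _ sub c_0 cj])
qed

end

section \<open>Square summable coefficients\<close>

text \<open>By strong induction the lower coefficients vanish; dividing by r^n and letting r tend to
  0 along real values isolates the n-th one.\<close>

lemma power_series_unique:
  fixes a :: "nat \<Rightarrow> complex"
  assumes bound: "\<And>n. norm (a n) \<le> D"
    and 0: "\<And>r. 0 < r \<Longrightarrow> r < 1 \<Longrightarrow> (\<lambda>n. a n * complex_of_real r ^ n) sums 0"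
  shows "a n = 0"
proof (induction n rule: less_induct)
  case (less n)
  define b where "b = (\<lambda>i. a (i + n))"
  have summable: "summable (\<lambda>i. b i * x ^ i)" if "norm x < 1" for x
  proof (rule summable_comparison_test' [where N = 0])
    show "summable (\<lambda>i. D * norm x ^ i)"
      using that by (intro summable_mult summable_geometric) auto
    show "norm (b i * x ^ i) \<le> D * norm x ^ i" for i
      by (simp add: b_def norm_mult norm_power mult_right_mono bound)
  qed
  define f where "f = (\<lambda>x. \<Sum>i. b i * x ^ i)"
  have lim: "(f \<longlongrightarrow> b 0) (at 0)"
    by (rule powser_limit_0 [of 1]) (auto simp: f_def intro: summable_sums summable)
  have fr: "f (complex_of_real r) = 0" if r: "0 < r" "r < 1" for r
  proof -
    have "(\<lambda>i. a (i + n) * complex_of_real r ^ (i + n)) sums (0 - (\<Sum>i<n. a i * complex_of_real r ^ i))"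
      by (rule sums_split_initial_segment [OF 0 [OF r]])
    also have "(\<Sum>i<n. a i * complex_of_real r ^ i) = 0"
      using less by simp
    finally have "(\<lambda>i. complex_of_real r ^ n * (b i * complex_of_real r ^ i)) sums 0"
      by (simp add: b_def power_add mult_ac)
    then have "complex_of_real r ^ n * f (complex_of_real r) = 0"
      unfolding f_def using r by (subst suminf_mult [symmetric, OF summable]) (auto simp: sums_iff)
    then show ?thesis using r by simp
  qed
  \<comment> \<open>The points 1 / (m + 2) lie strictly between 0 and 1.\<close>
  have X: "filterlim (\<lambda>m. complex_of_real (inverse (real (Suc (Suc m))))) (at 0) sequentially"
  proof (rule filterlim_atI)
    show "(\<lambda>m. complex_of_real (inverse (real (Suc (Suc m))))) \<longlonglongrightarrow> 0"
      using tendsto_of_real [OF LIMSEQ_Suc [OF LIMSEQ_inverse_real_of_nat]] by (simp only: of_real_0)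
    show "\<forall>\<^sub>F m in sequentially. complex_of_real (inverse (real (Suc (Suc m)))) \<noteq> 0"
      unfolding of_real_eq_0_iff by (intro always_eventually allI) simp
  qed
  have "(\<lambda>m. f (complex_of_real (inverse (real (Suc (Suc m)))))) \<longlonglongrightarrow> b 0"
    by (rule filterlim_compose [OF lim X])
  moreover have "f (complex_of_real (inverse (real (Suc (Suc m))))) = 0" for m
    by (rule fr) (auto simp: divide_simps)
  ultimately have "b 0 = 0"
    by (simp only: LIMSEQ_const_iff)
  then show ?case by (simp add: b_def)
qed

lemma summable_on_finite_sum:
  fixes f :: "'i \<Rightarrow> 'j \<Rightarrow> real"
  assumes "\<And>i. i \<in> I \<Longrightarrow> f i summable_on A"
  shows "(\<lambda>x. \<Sum>i\<in>I. f i x) summable_on A"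
  using assms by (induction I rule: infinite_finite_induct) (auto intro: summable_on_add)

section \<open>Square summable families\<close>

definition square_summable_on :: "('i \<Rightarrow> complex) \<Rightarrow> 'i set \<Rightarrow> bool" where
  "square_summable_on f A \<longleftrightarrow> (\<lambda>x. (norm (f x))\<^sup>2) summable_on A"

lemma square_summable_on_add:
  assumes "square_summable_on f A" "square_summable_on g A"
  shows "square_summable_on (\<lambda>x. f x + g x) A"
  unfolding square_summable_on_def
proof (rule summable_on_comparison_test)
  show "(\<lambda>x. 2 * (norm (f x))\<^sup>2 + 2 * (norm (g x))\<^sup>2) summable_on A"
    using assms unfolding square_summable_on_def by (intro summable_on_add summable_on_cmult_right)
  show "(norm (f x + g x))\<^sup>2 \<le> 2 * (norm (f x))\<^sup>2 + 2 * (norm (g x))\<^sup>2" for x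
  proof -
    have "(norm (f x + g x))\<^sup>2 \<le> (norm (f x) + norm (g x))\<^sup>2"
      by (intro power_mono norm_triangle_ineq) simp
    also have "\<dots> \<le> 2 * (norm (f x))\<^sup>2 + 2 * (norm (g x))\<^sup>2"
      using zero_le_power2 [of "norm (f x) - norm (g x)"] by (simp add: power2_eq_square algebra_simps)
    finally show ?thesis .
  qed
qed simp

lemma square_summable_on_mult:
  assumes f: "square_summable_on f A" and m: "\<And>x. x \<in> A \<Longrightarrow> \<bar>m x\<bar> \<le> K"
  shows "square_summable_on (\<lambda>x. of_real (m x) * f x) A"
  unfolding square_summable_on_def
proof (rule summable_on_comparison_test)
  show "(\<lambda>x. K\<^sup>2 * (norm (f x))\<^sup>2) summable_on A"
    using f unfolding square_summable_on_def by (rule summable_on_cmult_right)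
  show "(norm (of_real (m x) * f x))\<^sup>2 \<le> K\<^sup>2 * (norm (f x))\<^sup>2" if "x \<in> A" for x
    unfolding norm_mult power_mult_distrib
    using m [OF that] by (intro mult_right_mono power_mono) auto
qed simp

lemma square_summable_on_zero: "square_summable_on (\<lambda>x. 0) A"
  by (simp add: square_summable_on_def)

lemma square_summable_on_sum:
  assumes "\<And>i. i \<in> I \<Longrightarrow> square_summable_on (f i) A"
  shows "square_summable_on (\<lambda>x. \<Sum>i\<in>I. f i x) A"
  using assms
  by (induction I rule: infinite_finite_induct) (auto simp: square_summable_on_zero square_summable_on_add)

lemma square_summable_on_cong:
  "(\<And>x. x \<in> A \<Longrightarrow> f x = g x) \<Longrightarrow> square_summable_on f A \<longleftrightarrow> square_summable_on g A"
  unfolding square_summable_on_def by (intro summable_on_cong) simp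

text \<open>Each factor is at least 1 + k, since m >= 1 and d >= 2. The constant 1 makes the
  rescaled inverse of the diagonal bounded by 1.\<close>

lemma laplacian_factor_ge:
  assumes "2 \<le> d"
  shows "(1 + real k) ^ j \<le> laplacian_factor d k j i"
proof (induction j)
  case (Suc j)
  let ?m = "real (Suc (i + j))"
  have "1 * (1 + real k) \<le> real (2 * Suc (i + j)) * (2 * ?m + 2 * real k + real d - 2)"
    using assms by (intro mult_mono) auto
  then have "(1 + real k) ^ j * (1 + real k) \<le>
    laplacian_factor d k j i * (real (2 * Suc (i + j)) * (2 * ?m + 2 * real k + real d - 2))"
    using order_trans [OF _ Suc] by (intro mult_mono Suc) auto
  then show ?case
    by (simp only: laplacian_factor_Suc power_Suc mult.commute)
qed simp

text \<open>Every factor is bounded by the same constant times 1 + k; the constant involves i, j and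
  d but not k.\<close>

lemma laplacian_factor_le:
  assumes "2 \<le> d"
  shows "laplacian_factor d k j i \<le> (real (2 * (i + j)) * (2 * real (i + j) + real d)) ^ j * (1 + real k) ^ j"
proof -
  let ?K = "real (2 * (i + j)) * (2 * real (i + j) + real d)"
  have "laplacian_factor d k j i \<le> (\<Prod>m=Suc i..i + j. ?K * (1 + real k))"
    unfolding laplacian_factor_def
  proof (intro prod_mono conjI)
    fix m assume m: "m \<in> {Suc i..i + j}"
    show "0 \<le> real (2 * m) * (2 * real m + 2 * real k + real d - 2)"
      using m assms by (intro mult_nonneg_nonneg) auto
    have "2 * real m + 2 * real k + real d - 2 \<le> (2 * real (i + j) + real d) * (1 + real k)"
    proof -
      define s where "s = real (i + j)"
      have "2 * real k \<le> real d * real k" using assms by (intro mult_right_mono) auto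
      moreover have "0 \<le> s * real k" "real m \<le> s" using m by (auto simp: s_def)
      moreover have "(2 * s + real d) * (1 + real k) = 2 * s + real d + 2 * (s * real k) + real d * real k"
        by (simp add: algebra_simps)
      ultimately have "2 * real m + 2 * real k + real d - 2 \<le> (2 * s + real d) * (1 + real k)"
        by linarith
      then show ?thesis by (simp only: s_def)
    qed
    then have "real (2 * m) * (2 * real m + 2 * real k + real d - 2) \<le>
        real (2 * (i + j)) * ((2 * real (i + j) + real d) * (1 + real k))"
      using m assms by (intro mult_mono) auto
    then show "real (2 * m) * (2 * real m + 2 * real k + real d - 2) \<le> ?K * (1 + real k)"
      by (simp only: mult.assoc)
  qed
  also have "\<dots> = ?K ^ j * (1 + real k) ^ j"
    by (simp add: power_mult_distrib)
  finally show ?thesis .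
qed

lemma boundary_coeffsI:
  assumes "\<And>r. 0 < r \<Longrightarrow> r < 1 \<Longrightarrow>
    (SINT \<theta>. v (r *\<^sub>R \<theta>) * Y k l \<theta>) = (\<Sum>i<n. b i * of_real r ^ (k + 2 * i))"
  shows "boundary_coeffs Y v k l = (\<Sum>i<n. b i)"
  unfolding boundary_coeffs_def
proof (rule tendsto_Lim)
  show "\<not> trivial_limit (at_left (1::real))" by simp
  have "((\<lambda>r. \<Sum>i<n. b i * complex_of_real r ^ (k + 2 * i)) \<longlongrightarrow> (\<Sum>i<n. b i * complex_of_real 1 ^ (k + 2 * i))) (at_left 1)"
    by (intro tendsto_intros)
  moreover have "\<forall>\<^sub>F r in at_left 1. (\<Sum>i<n. b i * complex_of_real r ^ (k + 2 * i)) = (SINT \<theta>. v (r *\<^sub>R \<theta>) * Y k l \<theta>)"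
    using eventually_at_left_real [of 0 1] by (rule eventually_mono) (use assms in auto)
  ultimately have "((\<lambda>r. SINT \<theta>. v (r *\<^sub>R \<theta>) * Y k l \<theta>) \<longlongrightarrow> (\<Sum>i<n. b i * complex_of_real 1 ^ (k + 2 * i))) (at_left 1)"
    by (rule Lim_transform_eventually)
  then show "((\<lambda>r. SINT \<theta>. v (r *\<^sub>R \<theta>) * Y k l \<theta>) \<longlongrightarrow> (\<Sum>i<n. b i)) (at_left 1)"
    by simp
qed

text \<open>The Sobolev weight is moved into the coefficients, so that bounded multipliers can act
  on plain square summable families.\<close>

lemma sobolev_sphere_iff:
  "g \<in> sobolev_sphere D (- real j) \<longleftrightarrow>
    square_summable_on (\<lambda>(k, l). of_real (1 / (1 + real k) ^ j) * g k l) (harmonic_index D)"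
proof -
  have "(1 + real k) powr (2 * - real j) * (norm (g k l))\<^sup>2 = (norm (of_real (1 / (1 + real k) ^ j) * g k l))\<^sup>2" for k l
  proof -
    have "(1 + real k) powr (2 * - real j) = 1 / (1 + real k) powr real (2 * j)"
      by (simp add: powr_minus_divide)
    also have "\<dots> = 1 / (1 + real k) ^ (2 * j)"
      by (subst powr_realpow) auto
    also have "\<dots> = (1 / (1 + real k) ^ j)\<^sup>2"
      by (simp add: power_divide mult.commute flip: power_mult)
    finally show ?thesis
      by (simp only: norm_mult power_mult_distrib norm_of_real power2_abs)
  qed
  then show ?thesis
    unfolding sobolev_sphere_def square_summable_on_def by (simp add: case_prod_unfold)
qed

text \<open>The boundary data depend on the Almansi coefficients through a triangular system whose
  \<open>j\<close>-th row is of exact order \<open>(1 + k) ^ j\<close>.\<close>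

lemma square_summable_triangular:
  fixes c :: "nat \<Rightarrow> nat \<Rightarrow> nat \<Rightarrow> complex" and D :: "'a::euclidean_space itself"
  assumes d: "2 \<le> d"
    and g: "\<And>j k l. j < N \<Longrightarrow> (k, l) \<in> harmonic_index D \<Longrightarrow>
      g j k l = (\<Sum>i<N - j. of_real (laplacian_factor d k j i) * c k l (i + j))"
  shows "(\<forall>j<N. square_summable_on (\<lambda>(k, l). c k l j) (harmonic_index D)) \<longleftrightarrow>
    (\<forall>j<N. g j \<in> sobolev_sphere D (- real j))"
proof -
  let ?I = "harmonic_index D" and ?b = "laplacian_factor d"
  define K where "K = (\<lambda>i j. (real (2 * (i + j)) * (2 * real (i + j) + real d)) ^ j)"
  have pos: "0 < (1 + real k) ^ j" for j k by simp
  have bpos: "0 < ?b k j i" for k j i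
    using laplacian_factor_ge [OF d, of k j i] pos [of k j] by linarith
  have sob: "g j \<in> sobolev_sphere D (- real j)"
    if c: "\<forall>j<N. square_summable_on (\<lambda>(k, l). c k l j) ?I" and j: "j < N" for j
  proof -
    have "square_summable_on (\<lambda>x. \<Sum>i<N - j. of_real (?b (fst x) j i / (1 + real (fst x)) ^ j) * c (fst x) (snd x) (i + j)) ?I"
    proof (intro square_summable_on_sum square_summable_on_mult)
      fix i assume "i \<in> {..<N - j}"
      then show "square_summable_on (\<lambda>x. c (fst x) (snd x) (i + j)) ?I"
        using c by (auto simp: case_prod_unfold)
      fix x :: "nat \<times> nat"
      show "\<bar>?b (fst x) j i / (1 + real (fst x)) ^ j\<bar> \<le> K i j"
        using laplacian_factor_le [OF d, of "fst x" j i] bpos [of "fst x" j i] pos [of "fst x" j]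
        by (simp add: K_def pos_divide_le_eq)
    qed
    moreover have "(\<Sum>i<N - j. of_real (?b (fst x) j i / (1 + real (fst x)) ^ j) * c (fst x) (snd x) (i + j)) =
      (\<lambda>(k, l). of_real (1 / (1 + real k) ^ j) * g j k l) x" if "x \<in> ?I" for x
      using g [OF j, of "fst x" "snd x"] that
      by (simp add: case_prod_unfold sum_distrib_left sum_divide_distrib)
    ultimately show ?thesis
      unfolding sobolev_sphere_iff using square_summable_on_cong by (metis (no_types, lifting))
  qed
  have coef: "square_summable_on (\<lambda>(k, l). c k l j) ?I"
    if s: "\<forall>j<N. g j \<in> sobolev_sphere D (- real j)" and j: "j < N" for j
    \<comment> \<open>Back substitution from the last row upwards: row j involves c at j and at
      larger indices only.\<close>
    using j
  proof (induction "N - j" arbitrary: j rule: less_induct)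
    case less
    \<comment> \<open>Ratios of off-diagonal to diagonal entries in row j. Both have order (1 +
      k)^j, so the ratios are bounded in k.\<close>
    define m where "m = (\<lambda>i (x :: nat \<times> nat). - (?b (fst x) j i / ?b (fst x) j 0))"
    have "square_summable_on (\<lambda>x. of_real ((1 + real (fst x)) ^ j / ?b (fst x) j 0) *
        (\<lambda>(k, l). of_real (1 / (1 + real k) ^ j) * g j k l) x +
        (\<Sum>i\<in>{1..<N - j}. of_real (m i x) * c (fst x) (snd x) (i + j))) ?I"
    proof (intro square_summable_on_add square_summable_on_sum square_summable_on_mult)
      show "square_summable_on (\<lambda>(k, l). of_real (1 / (1 + real k) ^ j) * g j k l) ?I"
        using s less.prems unfolding sobolev_sphere_iff [symmetric] by simp
      show "\<bar>(1 + real (fst x)) ^ j / ?b (fst x) j 0\<bar> \<le> 1" for x :: "nat \<times> nat"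
        using laplacian_factor_ge [OF d, of "fst x" j 0] bpos [of "fst x" j 0]
        by (subst abs_of_nonneg) (auto intro!: divide_nonneg_pos)
      fix i assume i: "i \<in> {1..<N - j}"
      then show "square_summable_on (\<lambda>x. c (fst x) (snd x) (i + j)) ?I"
        using less.hyps [of "i + j"] by (auto simp: case_prod_unfold)
      fix x :: "nat \<times> nat"
      have "?b (fst x) j i \<le> K i j * (1 + real (fst x)) ^ j"
        using laplacian_factor_le [OF d, of "fst x" j i] by (simp add: K_def)
      also have "\<dots> \<le> K i j * ?b (fst x) j 0"
        using laplacian_factor_ge [OF d, of "fst x" j 0] by (intro mult_left_mono) (auto simp: K_def)
      finally show "\<bar>m i x\<bar> \<le> K i j"
        using bpos [of "fst x" j i] bpos [of "fst x" j 0] by (simp add: m_def pos_divide_le_eq)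
    qed
    moreover have "of_real ((1 + real (fst x)) ^ j / ?b (fst x) j 0) *
        (\<lambda>(k, l). of_real (1 / (1 + real k) ^ j) * g j k l) x +
        (\<Sum>i\<in>{1..<N - j}. of_real (m i x) * c (fst x) (snd x) (i + j)) = (\<lambda>(k, l). c k l j) x"
      if "x \<in> ?I" for x
    proof -
      obtain k l where x: "x = (k, l)" by (cases x)
      let ?den = "complex_of_real (?b k j 0)" and ?p = "complex_of_real ((1 + real k) ^ j)"
      have nz: "?den \<noteq> 0" "?p \<noteq> 0"
        using bpos [of k j 0] pos [of k j] by (simp_all only: of_real_eq_0_iff)
      \<comment> \<open>The diagonal term i = 0 is separated, so that the row can be solved for c at
        index j.\<close>
      have "{..<N - j} = insert 0 {1..<N - j}"
        using less.prems by auto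
      then have "g j k l = ?den * c k l j + (\<Sum>i\<in>{1..<N - j}. of_real (?b k j i) * c k l (i + j))"
        using g [OF less.prems, of k l] that x by simp
      then have "c k l j = (1 / ?den) * g j k l - (1 / ?den) * (\<Sum>i\<in>{1..<N - j}. of_real (?b k j i) * c k l (i + j))"
        using nz by (simp add: field_simps)
      moreover have "of_real ((1 + real k) ^ j / ?b k j 0) * (of_real (1 / (1 + real k) ^ j) * g j k l) = (1 / ?den) * g j k l"
        using nz by (simp only: of_real_divide of_real_1) simp
      moreover have "(\<Sum>i\<in>{1..<N - j}. of_real (m i (k, l)) * c k l (i + j)) =
         - ((1 / ?den) * (\<Sum>i\<in>{1..<N - j}. of_real (?b k j i) * c k l (i + j)))"
        by (simp add: m_def sum_distrib_left sum_negf)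
      ultimately show ?thesis
        by (simp only: x prod.case fst_conv snd_conv) simp
    qed
    ultimately show ?case
      using square_summable_on_cong by (metis (no_types, lifting))
  qed
  show ?thesis
    using sob coef by blast
qed

context sphere_basis
begin

section \<open>Membership in the Hardy space\<close>

text \<open>A single term is at most the total sum, so the coefficients are uniformly
  bounded.\<close>

lemma square_summable_subexponential:
  assumes "(\<lambda>((k, l), j). (norm (c k l j))\<^sup>2) summable_on (harmonic_index TYPE('a) \<times> UNIV)"
  obtains D where "\<And>k l j. (k, l) \<in> harmonic_index TYPE('a) \<Longrightarrow> norm (c k l j) \<le> D" "subexponential c"
proof -
  define S where "S = infsum (\<lambda>((k, l), j). (norm (c k l j))\<^sup>2) (harmonic_index TYPE('a) \<times> UNIV)"
  have b: "norm (c k l j) \<le> sqrt S" if "(k, l) \<in> harmonic_index TYPE('a)" for k l j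
  proof -
    have "sum (\<lambda>((k, l), j). (norm (c k l j))\<^sup>2) {((k, l), j)} \<le> S"
      unfolding S_def by (rule finite_sum_le_infsum [OF assms]) (use that in auto)
    then have "(norm (c k l j))\<^sup>2 \<le> S" by simp
    then show ?thesis by (rule real_le_rsqrt)
  qed
  moreover have "subexponential c"
    unfolding subexponential_def
  proof (intro allI impI exI)
    fix q :: real and k l j
    assume q: "1 < q" and kl: "(k, l) \<in> harmonic_index TYPE('a)"
    have "0 \<le> sqrt S" using order_trans [OF norm_ge_zero b [OF kl]] .
    then have "sqrt S * 1 \<le> sqrt S * q ^ k"
      using q by (intro mult_left_mono) auto
    then show "norm (c k l j) \<le> sqrt S * q ^ k"
      using b [OF kl, of j] by simp
  qed
  ultimately show thesis by (rule that)
qed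

text \<open>From coefficients to function, c itself is the required family. Conversely, membership
  provides some c' with the same sums on the quadric; comparing moments at each radius gives an
  identity of power series in r^2, hence c' = c.\<close>

lemma hardy_space_iff:
  fixes u :: "'a \<Rightarrow> complex"
  assumes c: "almansi_coeffs N Y u = c" "subexponential c"
    and 0: "\<And>k l j. (k, l) \<notin> harmonic_index TYPE('a) \<or> N \<le> j \<Longrightarrow> c k l j = 0"
  shows "r_complexification N Y u \<in> hardy_space Y \<longleftrightarrow>
    (\<forall>j<N. square_summable_on (\<lambda>(k, l). c k l j) (harmonic_index TYPE('a)))"
proof -
  let ?I = "harmonic_index TYPE('a)"
  have c0: "j < N" if "c k l j \<noteq> 0" for k l j
    using 0 that by (meson not_le)
  \<comment> \<open>The complexification sums over j inside; summability over the product set allows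
    a single sum.\<close>
  have rc: "r_complexification N Y u (z, \<theta>) =
      (\<Sum>\<^sub>\<infinity>((k, l), j)\<in>?I \<times> {..<N}. c k l j * z ^ (k + 2 * j) * Y k l \<theta>)"
    if "norm z < 1" "\<theta> \<in> sphere 0 1" for z \<theta>
    unfolding r_complexification_def c(1)
    by (subst infsum_Sigma_banach [OF series_summable [OF c(2) that], symmetric])
       (simp add: case_prod_unfold)
  have rc_sum: "(sterm c z \<theta> has_sum r_complexification N Y u (z, \<theta>)) (?I \<times> UNIV)"
    if "norm z < 1" "\<theta> \<in> sphere 0 1" for z \<theta>
  proof -
    have "(sterm c z \<theta> has_sum r_complexification N Y u (z, \<theta>)) (?I \<times> {..<N})"
      unfolding rc [OF that] by (rule has_sum_infsum [OF series_summable [OF c(2) that]])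
    then show ?thesis
      by (rule has_sum_cong_neutral [THEN iffD1, rotated -1]) (auto dest: c0)
  qed
  have sq: "(\<lambda>((k, l), j). (norm (c k l j))\<^sup>2) summable_on (?I \<times> UNIV) \<longleftrightarrow>
    (\<forall>j<N. square_summable_on (\<lambda>(k, l). c k l j) ?I)"
  proof
    assume s: "(\<lambda>((k, l), j). (norm (c k l j))\<^sup>2) summable_on (?I \<times> UNIV)"
    show "\<forall>j<N. square_summable_on (\<lambda>(k, l). c k l j) ?I"
    proof (intro allI impI)
      fix j :: nat
      have "(\<lambda>((k, l), j). (norm (c k l j))\<^sup>2) summable_on ((\<lambda>x. (x, j)) ` ?I)"
        by (rule summable_on_subset_banach [OF s]) auto
      then have "(\<lambda>((k, l), j). (norm (c k l j))\<^sup>2) \<circ> (\<lambda>x. (x, j)) summable_on ?I"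
        by (subst (asm) summable_on_reindex) (auto simp: inj_on_def)
      then show "square_summable_on (\<lambda>(k, l). c k l j) ?I"
        by (simp add: square_summable_on_def o_def case_prod_unfold)
    qed
  next
    assume s: "\<forall>j<N. square_summable_on (\<lambda>(k, l). c k l j) ?I"
    have "(\<lambda>x. \<Sum>j<N. (norm (c (fst x) (snd x) j))\<^sup>2) summable_on ?I"
      using s by (intro summable_on_finite_sum) (auto simp: square_summable_on_def case_prod_unfold)
    then have "(\<lambda>((k, l), j). (norm (c k l j))\<^sup>2) summable_on (?I \<times> {..<N})"
      by (rule summable_on_SigmaI [rotated]) (auto simp: case_prod_unfold)
    then show "(\<lambda>((k, l), j). (norm (c k l j))\<^sup>2) summable_on (?I \<times> UNIV)"
      by (rule summable_on_cong_neutral [THEN iffD1, rotated -1]) (auto dest: c0)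
  qed
  show ?thesis
    unfolding sq [symmetric]
  proof
    assume "(\<lambda>((k, l), j). (norm (c k l j))\<^sup>2) summable_on (?I \<times> UNIV)"
    then show "r_complexification N Y u \<in> hardy_space Y"
      unfolding hardy_space_def using rc_sum by (intro CollectI exI [of _ c]) auto
  next
    assume "r_complexification N Y u \<in> hardy_space Y"
    then obtain c' where c'sq: "(\<lambda>((k, l), j). (norm (c' k l j))\<^sup>2) summable_on (?I \<times> UNIV)"
      and c'sum: "\<And>z \<theta>. z \<in> ball 0 1 \<Longrightarrow> \<theta> \<in> sphere 0 1 \<Longrightarrow>
        (sterm c' z \<theta> has_sum r_complexification N Y u (z, \<theta>)) (?I \<times> UNIV)"
      unfolding hardy_space_def by blast
    obtain D where D: "\<And>k l j. (k, l) \<in> ?I \<Longrightarrow> norm (c' k l j) \<le> D" and c'sub: "subexponential c'"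
      using square_summable_subexponential [OF c'sq] by blast
    have eq: "c' k l j = c k l j" if kl: "(k, l) \<in> ?I" for k l j
    proof -
      define a where "a = (\<lambda>j. c' k l j - c k l j)"
      have "a j = 0"
      proof (rule power_series_unique)
        \<comment> \<open>The family c' is bounded by square summability, and for fixed (k, l) only
          finitely many entries of c are nonzero.\<close>
        show "norm (a j) \<le> D + (\<Sum>j<N. norm (c k l j))" for j
        proof -
          have "norm (c k l j) \<le> (\<Sum>j<N. norm (c k l j))"
            by (cases "j < N") (auto intro!: member_le_sum sum_nonneg simp: 0)
          then show ?thesis
            using D [OF kl, of j] norm_triangle_ineq4 [of "c' k l j" "c k l j"] by (simp add: a_def)
        qed
        fix s :: real assume s: "0 < s" "s < 1"
        \<comment> \<open>The exponents k + 2j become r^k s^j with s = r^2, and r^k is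
          nonzero.\<close>
        define r where "r = sqrt s"
        have r: "0 < r" "r < 1" "r\<^sup>2 = s" using s by (auto simp: r_def)
        have z: "norm (complex_of_real r) < 1" using r by simp
        have "(infsum (sterm c' (of_real r) \<theta>) (?I \<times> UNIV)) =
          (infsum (sterm c (of_real r) \<theta>) (?I \<times> UNIV))" if "\<theta> \<in> sphere 0 1" for \<theta>
          using infsumI [OF c'sum [of "of_real r" \<theta>]] infsumI [OF rc_sum [OF z that]] z that by simp
        then have "(SINT \<theta>. (infsum (sterm c' (of_real r) \<theta>) (?I \<times> UNIV)) * Y k l \<theta>) =
          (SINT \<theta>. (infsum (sterm c (of_real r) \<theta>) (?I \<times> UNIV)) * Y k l \<theta>)"
          by (intro Bochner_Integration.integral_cong refl) (simp add: space_sphere_measure)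
        with has_sum_add [OF series_coeffs [OF c'sub z kl, of UNIV] has_sum_uminusI [OF series_coeffs [OF c(2) z kl, of UNIV]]]
        have "((\<lambda>j. c' k l j * of_real r ^ (k + 2 * j) - c k l j * of_real r ^ (k + 2 * j)) has_sum 0) UNIV"
          by simp
        then have "(\<lambda>j. c' k l j * of_real r ^ (k + 2 * j) - c k l j * of_real r ^ (k + 2 * j)) sums 0"
          by (rule has_sum_imp_sums)
        moreover have "c' k l j * of_real r ^ (k + 2 * j) - c k l j * of_real r ^ (k + 2 * j) =
            complex_of_real r ^ k * (a j * complex_of_real s ^ j)" for j
          unfolding a_def r(3) [symmetric] by (simp add: power_add algebra_simps flip: power_mult)
        ultimately have "(\<lambda>j. complex_of_real r ^ k * (a j * complex_of_real s ^ j)) sums 0"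
          by simp
        from sums_mult [OF this, of "inverse (complex_of_real r ^ k)"] r
        show "(\<lambda>j. a j * complex_of_real s ^ j) sums 0"
          by (simp add: mult.assoc [symmetric])
      qed
      then show ?thesis by (simp add: a_def)
    qed
    have "(\<lambda>((k, l), j). (norm (c k l j))\<^sup>2) summable_on (?I \<times> UNIV) \<longleftrightarrow>
        (\<lambda>((k, l), j). (norm (c' k l j))\<^sup>2) summable_on (?I \<times> UNIV)"
      by (rule summable_on_cong) (auto simp: eq)
    then show "(\<lambda>((k, l), j). (norm (c k l j))\<^sup>2) summable_on (?I \<times> UNIV)"
      using c'sq by simp
  qed
qed

end

theorem theorem24:
  fixes u :: "real^'d \<Rightarrow> complex" and Y :: "nat \<Rightarrow> nat \<Rightarrow> real^'d \<Rightarrow> complex" and N :: nat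
  assumes "CARD('d) \<ge> 2" and "N \<ge> 1"
    and "harmonic_basis Y"
    and "polyharmonic_on N (ball 0 1) u"
  shows "r_complexification N Y u \<in> hardy_space Y \<longleftrightarrow>
    (\<forall>j<N. boundary_coeffs Y ((laplacian ^^ j) u) \<in> sobolev_sphere TYPE(real^'d) (- real j))"
proof -
  have dim: "2 \<le> DIM(real^'d)" using assms(1) by simp
  interpret sphere_basis Y
    by standard (use assms(3) dim in auto)
  obtain c where c: "almansi_coeffs N Y u = c" "subexponential c"
    "\<And>k l j. (k, l) \<notin> harmonic_index TYPE(real^'d) \<or> N \<le> j \<Longrightarrow> c k l j = 0"
    "\<And>k l j r. (k, l) \<in> harmonic_index TYPE(real^'d) \<Longrightarrow> j \<le> N \<Longrightarrow> 0 \<le> r \<Longrightarrow> r < 1 \<Longrightarrow>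
      (SINT \<theta>. (laplacian ^^ j) u (r *\<^sub>R \<theta>) * Y k l \<theta>) =
      (\<Sum>i<N - j. of_real (laplacian_factor DIM(real^'d) k j i) * c k l (i + j) * of_real r ^ (k + 2 * i))"
    using almansi_coeffs_polyharmonic [OF assms(2,4)] by blast
  have "boundary_coeffs Y ((laplacian ^^ j) u) k l =
      (\<Sum>i<N - j. of_real (laplacian_factor DIM(real^'d) k j i) * c k l (i + j))"
    if "j < N" "(k, l) \<in> harmonic_index TYPE(real^'d)" for j k l
    by (rule boundary_coeffsI) (use c(4) that in simp)
  then have "(\<forall>j<N. square_summable_on (\<lambda>(k, l). c k l j) (harmonic_index TYPE(real^'d))) \<longleftrightarrow>
    (\<forall>j<N. boundary_coeffs Y ((laplacian ^^ j) u) \<in> sobolev_sphere TYPE(real^'d) (- real j))"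
    by (rule square_summable_triangular [OF dim])
  moreover have "r_complexification N Y u \<in> hardy_space Y \<longleftrightarrow>
    (\<forall>j<N. square_summable_on (\<lambda>(k, l). c k l j) (harmonic_index TYPE(real^'d)))"
    by (rule hardy_space_iff [OF c(1,2)]) (rule c(3))
  ultimately show ?thesis by blast
qed

end
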